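(* Let $\lambda=6/\sqrt5$. There exists a smooth complete nearly parallel $\mathrm G_2$-structure (with $d\varphi=\lambda*_\varphi\varphi$) on the manifold $M_{23}$, invariant under the cohomogeneity-one $\mathrm{SO}(4)$-action and under the additional $\mathrm U(1)$-action, which is obtained by $\tau_{23}$-reflection of a solution $\eta_{a,c,\nu}$ at time $T$, and whose shooting parameters satisfy $$a\in 0.025880416406250467+10^{-7}[-1,1],\qquad c\in -0.07764124921873236+3\cdot10^{-7}[-1,1],$$ $$\nu=0,\qquad T\in 0.8578017401911906+5\cdot10^{-7}[-1,1].$$
   Context: A $\mathrm G_2$-structure is a positive 3-form $\varphi$ on a 7-manifold, with Hodge star $*_\varphi$; it is nearly parallel if $d\varphi=\lambda*_\varphi\varphi$, $\lambda\neq0$ constant. **Manifold.** Let $\widetilde G=\mathrm{Sp}(1)\times\mathrm{Sp}(1)\to\mathrm{SO}(4)$ be the double cover, $\Delta Q_8=\{\pm(1,1),\pm(i,i),\pm(j,j),\pm(k,k)\}$, $C^i_{m,n}=\{(e^{im\theta},e^{in\theta})\}$. $M_{23}$ is the compact cohomogeneity-one manifold with group diagram $\Delta Q_8\subset\{C^i_{3,-1}\Delta Q_8,\ C^i_{1,-3}\Delta Q_8\}\subset\widetilde G$ (effectively $\mathbb Z_2^2\subset\{K^i_{3,-1},K^i_{1,-3}\}\subset\mathrm{SO}(4)$, with $K^i_{m,n}$ the image of $C^i_{m,n}\Delta Q_8$). It is the quotient by a free involution of the simply connected cohomogeneity-one manifold with diagram $\Delta\mathbb Z_4\subset\{C^i_{3,-1},C^i_{1,-3}\}\subset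 S^3\times S^3$. **Frame.** Left-invariant coframe $e^1,\dots,e^6$ on $\widetilde G$ with $de^1=e^{35}$, $de^3=-e^{15}$, $de^5=e^{13}$, $de^2=e^{46}$, $de^4=-e^{26}$, $de^6=e^{24}$; dual frame $e_1=-\tfrac i2,\ e_3=\tfrac k2,\ e_5=-\tfrac j2$ (first factor), $e_2=\tfrac i2,\ e_4=-\tfrac k2,\ e_6=-\tfrac j2$ (second factor). **Nearly parallel system.** For functions $p_1,p_2,p_3,q_1,\dots,q_8$ of $t$ put $\varphi=dt\wedge(p_1e^{12}+p_2e^{34}+p_3e^{56})+q_1e^{135}+q_2e^{136}+q_3e^{145}+q_4e^{146}+q_5e^{235}+q_6e^{236}+q_7e^{245}+q_8e^{246}$, $P=p_1p_2p_3\ne0$, $\alpha_i=q_iq_{9-i}$ $(1\le i\le4)$, $\Sigma=\sum_{i=1}^4\alpha_i$. A solution is $(p,q)$ with $q_1'=\frac{\lambda}{2P}(q_1(2\alpha_1-\Sigma)+2q_2q_3q_5)$, $q_8'=-\frac{\lambda}{2P}(q_8(2\alpha_1-\Sigma)+2q_4q_6q_7)$, $q_2'=p_3-\frac{\lambda}{2P}(q_2(2\alpha_2-\Sigma)+2q_1q_4q_6)$, $q_7'=-p_3+\frac{\lambda}{2P}(q_7(2\alpha_2-\Sigma)+2q_3q_5q_8)$, $q_3'=p_2-\frac{\lambda}{2P}(q_3(2\alpha_3-\Sigma)+2q_1q_4q_7)$, $q_6'=-p_2+\frac{\lambda}{2P}(q_6(2\alpha_3-\Sigma)+2q_2q_5q_8)$,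 $q_4'=-p_1+\frac{\lambda}{2P}(q_4(2\alpha_4-\Sigma)+2q_2q_3q_8)$, $q_5'=p_1-\frac{\lambda}{2P}(q_5(2\alpha_4-\Sigma)+2q_1q_6q_7)$, the constraints $q_2+q_7=-\lambda p_1p_2$, $q_3+q_6=-\lambda p_1p_3$, $q_4+q_5=-\lambda p_2p_3$, and the normalisation $\sum_i\alpha_i^2-2\sum_{i<j}\alpha_i\alpha_j+4(q_1q_4q_6q_7+q_2q_3q_5q_8)=-4P^2$; then $d\varphi=\lambda*_\varphi\varphi$. Solutions lie in the chamber $q_2+q_7>0$, $q_3+q_6>0$, $q_4+q_5<0$, $p_1<0<p_2,p_3$. **Family $\eta_{a,c,\nu}$** ($a>0$, $c<0$, $3a-c\ne-\lambda^3ac$): the solution extending smoothly over the singular orbit $\widetilde G/(C^i_{3,-1}\Delta Q_8)$ at $t=0$ with $q_1(0)=a$, $q_5(0)=-3a$, $q_4(0)=c$, $q_8(0)=-3c$, $q_2(0)=q_3(0)=q_6(0)=q_7(0)=0$, $q_2'(0)=q_3'(0)=-\lambda\sqrt{-ac}+\sqrt{(3a-c)/\lambda}$, $q_6'(0)=q_7'(0)=3\lambda\sqrt{-ac}-\sqrt{(3a-c)/\lambda}$, $q_3''(0)=-q_2''(0)=2\nu$. **Additional $\mathrm U(1)$-action.** The circle acts on the coframe by $e^3+ie^5\mapsto e^{i\vartheta}(e^3+ie^5)$, $e^4+ie^6\mapsto e^{i\vartheta}(e^4+ie^6)$, fixing $e^1,e^2,dt$ (it is induced by right multiplication by a circle,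 and is defined on the double cover of $M_{23}$); invariance of $\varphi$ means $p_2=p_3$, $q_2=q_3$, $q_6=q_7$. **Reflection.** $\tau_{23}$ acts by $q_i\leftrightarrow q_{9-i}$ $(1\le i\le 8)$ with all $p_i$ fixed, and is a time-reversing symmetry of the system. "Obtained by $\tau_{23}$-reflection at time $T$" means: $\eta_{a,c,\nu}$ is defined on $[0,T]$, $\eta_{a,c,\nu}(T)$ is fixed by $\tau_{23}$ ($q_1=q_8$, $q_2=q_7$, $q_3=q_6$, $q_4=q_5$ at $t=T$), and the structure is $\eta_{a,c,\nu}(t)$ for $0\le t\le T$ and $\tau_{23}(\eta_{a,c,\nu}(2T-t))$ for $T\le t\le 2T$. *)

theory Defs
  imports "HOL-Analysis.Analysis"
begin

section \<open>The group Sp(1) x Sp(1) and its Lie algebra\<close>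

text \<open>
  The pair (z, w) of complex numbers stands for the quaternion z + w j.
\<close>

type_synonym quat = "complex \<times> complex"
type_synonym quat2 = "quat \<times> quat"

fun qmult :: "quat \<Rightarrow> quat \<Rightarrow> quat" where
  "qmult (z, w) (z', w') = (z * z' - w * cnj w', z * w' + w * cnj z')"

fun qcnj :: "quat \<Rightarrow> quat" where
  "qcnj (z, w) = (cnj z, - w)"

definition qone :: quat where "qone = (1, 0)"
definition qi :: quat where "qi = (\<i>, 0)"
definition qj :: quat where "qj = (0, 1)"
definition qk :: quat where "qk = (0, \<i>)"

lemma quaternion_relations:
  "qmult qi qj = qk" "qmult qj qk = qi" "qmult qk qi = qj"
  "qmult qi qi = - qone" "qmult qj qj = - qone" "qmult qk qk = - qone"
  by (simp_all add: qone_def qi_def qj_def qk_def)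

definition gmult :: "quat2 \<Rightarrow> quat2 \<Rightarrow> quat2" where
  "gmult g h = (qmult (fst g) (fst h), qmult (snd g) (snd h))"

definition ginv :: "quat2 \<Rightarrow> quat2" where
  "ginv g = (qcnj (fst g), qcnj (snd g))"

definition Sp1Sp1 :: "quat2 set" where
  "Sp1Sp1 = {g. norm (fst g) = 1 \<and> norm (snd g) = 1}"

text \<open>
  An element (x, y) of the Lie algebra has the coordinates
  x = (e^1, e^3, e^5) and y = (e^2, e^4, e^6) in the left-invariant frame
  e_1 = -i/2, e_3 = k/2, e_5 = -j/2 (first factor),
  e_2 = i/2, e_4 = -k/2, e_6 = -j/2 (second factor);
  \<open>coords\<close> is the left inverse of \<open>frame\<close>.
\<close>

type_synonym lie = "(real^3) \<times> (real^3)"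

definition frame :: "lie \<Rightarrow> quat2" where
  "frame \<xi> =
     ( (fst \<xi> $ 1) *\<^sub>R ((-1/2) *\<^sub>R qi) + (fst \<xi> $ 2) *\<^sub>R ((1/2) *\<^sub>R qk) + (fst \<xi> $ 3) *\<^sub>R ((-1/2) *\<^sub>R qj),
       (snd \<xi> $ 1) *\<^sub>R ((1/2) *\<^sub>R qi) + (snd \<xi> $ 2) *\<^sub>R ((-1/2) *\<^sub>R qk) + (snd \<xi> $ 3) *\<^sub>R ((-1/2) *\<^sub>R qj) )"

definition coords :: "quat2 \<Rightarrow> lie" where
  "coords v =
     ( vector [- 2 * Im (fst (fst v)), 2 * Im (snd (fst v)), - 2 * Re (snd (fst v))],
       vector [2 * Im (fst (snd v)), - 2 * Im (snd (snd v)), - 2 * Re (snd (snd v))] )"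

definition bracket :: "lie \<Rightarrow> lie \<Rightarrow> lie" where
  "bracket \<xi> \<eta> = coords (gmult (frame \<xi>) (frame \<eta>) - gmult (frame \<eta>) (frame \<xi>))"

definition Ad :: "quat2 \<Rightarrow> lie \<Rightarrow> lie" where
  "Ad g \<xi> = coords (gmult (gmult g (frame \<xi>)) (ginv g))"

lemma coords_frame: "coords (frame \<xi>) = \<xi>"
  by (cases \<xi>)
    (simp add: coords_def frame_def qi_def qj_def qk_def vec_eq_iff forall_3)

text \<open>
  The structure equations: by d alpha (X, Y) = - alpha [X, Y] on left-invariant
  forms, the next lemma says de^1 = e^35, de^3 = -e^15, de^5 = e^13,
  de^2 = e^46, de^4 = -e^26, de^6 = e^24.
\<close>

lemma bracket_structure_equations:
  "- fst (bracket (x, y) (x', y')) $ 1 = x $ 2 * x' $ 3 - x $ 3 * x' $ 2"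
  "- fst (bracket (x, y) (x', y')) $ 2 = - (x $ 1 * x' $ 3 - x $ 3 * x' $ 1)"
  "- fst (bracket (x, y) (x', y')) $ 3 = x $ 1 * x' $ 2 - x $ 2 * x' $ 1"
  "- snd (bracket (x, y) (x', y')) $ 1 = y $ 2 * y' $ 3 - y $ 3 * y' $ 2"
  "- snd (bracket (x, y) (x', y')) $ 2 = - (y $ 1 * y' $ 3 - y $ 3 * y' $ 1)"
  "- snd (bracket (x, y) (x', y')) $ 3 = y $ 1 * y' $ 2 - y $ 2 * y' $ 1"
  by (simp_all add: bracket_def coords_def frame_def gmult_def qi_def qj_def qk_def field_simps)

definition qexp_im :: "quat \<Rightarrow> quat" where
  "qexp_im v = cos (norm v) *\<^sub>R qone + (sin (norm v) / norm v) *\<^sub>R v"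

definition gexp :: "lie \<Rightarrow> quat2" where
  "gexp \<xi> = (qexp_im (fst (frame \<xi>)), qexp_im (snd (frame \<xi>)))"


section \<open>Smooth functions\<close>

text \<open>
  \<open>Ck_on\<close> is only meant for open sets; \<open>smooth_on_set\<close> is smoothness on an
  arbitrary subset (here an embedded submanifold), i.e. existence of local
  smooth extensions.
\<close>

primrec Ck_on :: "nat \<Rightarrow> ('a::real_normed_vector \<Rightarrow> real) \<Rightarrow> 'a set \<Rightarrow> bool" where
  "Ck_on 0 f U = continuous_on U f"
| "Ck_on (Suc k) f U =
     ((\<forall>x\<in>U. f differentiable (at x)) \<and> (\<forall>v. Ck_on k (\<lambda>x. frechet_derivative f (at x) v) U))"

definition smooth_on_set :: "'a::real_normed_vector set \<Rightarrow> ('a \<Rightarrow> real) \<Rightarrow> bool" where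
  "smooth_on_set S f \<longleftrightarrow>
     (\<forall>x\<in>S. \<exists>U F. open U \<and> x \<in> U \<and> (\<forall>k. Ck_on k F U) \<and> (\<forall>y\<in>U \<inter> S. F y = f y))"


section \<open>The manifold M_23\<close>

definition DeltaQ8 :: "quat2 set" where
  "DeltaQ8 = {(u, u) | u. u \<in> {qone, - qone, qi, - qi, qj, - qj, qk, - qk}}"

definition circ :: "int \<Rightarrow> int \<Rightarrow> real \<Rightarrow> quat2" where
  "circ m n \<theta> = ((cis (of_int m * \<theta>), 0), (cis (of_int n * \<theta>), 0))"

datatype orbit_end = Start | End

fun slope :: "orbit_end \<Rightarrow> int \<times> int" where
  "slope Start = (3, -1)"
| "slope End = (1, -3)"

definition circ_at :: "orbit_end \<Rightarrow> real \<Rightarrow> quat2" where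
  "circ_at b \<theta> = circ (fst (slope b)) (snd (slope b)) \<theta>"

text \<open>
  The pairs (k, sigma k) with k in K = C^i_{m,n} Delta Q_8, where sigma is the
  slice representation of K on the normal plane of the singular orbit,
  identified with the complex numbers.  It is the orthogonal representation
  which is transitive on the unit circle and in which the stabiliser of 1 is
  Delta Q_8: as the circle C^i_{m,n} meets Delta Q_8 in the four points
  theta = 0, pi/2, pi, 3 pi/2, it acts with weight 4 (the sign of the weight is
  a matter of complex conjugation), and (j,j), (k,k), which invert the circle,
  act by complex conjugation.
\<close>

definition slice_rep :: "orbit_end \<Rightarrow> (quat2 \<times> (complex \<Rightarrow> complex)) set" where
  "slice_rep b =
     {(gmult (circ_at b \<theta>) h,
       \<lambda>z. cis (4 * \<theta>) * (if h \<in> {(u, u) | u. u \<in> {qone, - qone, qi, - qi}} then z else cnj z))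
      | \<theta> h. h \<in> DeltaQ8}"

text \<open>
  The tube around a singular orbit is the quotient of Sp(1) x Sp(1) x D, where D is
  the open disc of radius L, by the free action (g, z) k = (g k, sigma(k)^{-1} z)
  of K.  M_23 is glued from the two tubes along their principal
  parts, the point [g, s] of the first one being identified with the point
  [g, L - s] of the second one for 0 < s < L.  So L is the distance between the
  singular orbits when the curves t -> [g, t] are parametrised by arc length;
  as a manifold M_23 does not depend on L, by radial rescaling.
\<close>

type_synonym pt = "quat2 \<times> complex"

definition tube :: "real \<Rightarrow> pt set" where
  "tube L = Sp1Sp1 \<times> ball 0 L"

inductive same_point :: "real \<Rightarrow> orbit_end \<times> pt \<Rightarrow> orbit_end \<times> pt \<Rightarrow> bool" for L where
  refl: "x \<in> tube L \<Longrightarrow> same_point L (b, x) (b, x)"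
| sym: "same_point L X Y \<Longrightarrow> same_point L Y X"
| trans: "same_point L X Y \<Longrightarrow> same_point L Y Z \<Longrightarrow> same_point L X Z"
| slice: "g \<in> Sp1Sp1 \<Longrightarrow> z \<in> ball 0 L \<Longrightarrow> (k, \<sigma>) \<in> slice_rep b \<Longrightarrow>
    same_point L (b, (gmult g k, z)) (b, (g, \<sigma> z))"
| glue: "g \<in> Sp1Sp1 \<Longrightarrow> 0 < s \<Longrightarrow> s < L \<Longrightarrow>
    same_point L (Start, (g, complex_of_real s)) (End, (g, complex_of_real (L - s)))"

definition M23 :: "real \<Rightarrow> (orbit_end \<times> pt) set set" where
  "M23 L = (UNIV \<times> tube L) // {(X, Y). same_point L X Y}"


section \<open>Differential forms\<close>

text \<open>
  Tangent vectors of Sp(1) x Sp(1) x D are written in the left trivialisation: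
  (xi, w) at (g, z) is the vector (g xi, w).
\<close>

type_synonym tvec = "lie \<times> complex"
type_synonym form3 = "tvec \<Rightarrow> tvec \<Rightarrow> tvec \<Rightarrow> real"
type_synonym form4 = "tvec \<Rightarrow> tvec \<Rightarrow> tvec \<Rightarrow> tvec \<Rightarrow> real"

definition tangent_vector :: "pt \<Rightarrow> tvec \<Rightarrow> pt" where
  "tangent_vector x X = (gmult (fst x) (frame (fst X)), snd X)"

definition alt_trilinear :: "form3 \<Rightarrow> bool" where
  "alt_trilinear f \<longleftrightarrow>
     (\<forall>Y Z. linear (\<lambda>X. f X Y Z)) \<and> (\<forall>X Z. linear (\<lambda>Y. f X Y Z)) \<and> (\<forall>X Y. linear (\<lambda>Z. f X Y Z)) \<and>
     (\<forall>X Z. f X X Z = 0) \<and> (\<forall>X Y. f X Y Y = 0) \<and> (\<forall>X Y. f X Y X = 0)"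

definition smooth_form :: "real \<Rightarrow> (pt \<Rightarrow> form3) \<Rightarrow> bool" where
  "smooth_form L \<beta> \<longleftrightarrow>
     (\<forall>x\<in>tube L. alt_trilinear (\<beta> x)) \<and> (\<forall>X Y Z. smooth_on_set (tube L) (\<lambda>x. \<beta> x X Y Z))"

text \<open>
  Differential forms on the quotient of Sp(1) x Sp(1) x D by the free action
  of K are the basic forms on Sp(1) x Sp(1) x D: the K-invariant ones which vanish on
  the tangent vectors of the K-orbits, spanned at (g, z) by the derivative
  ((m i, n i), - 4 i z) of theta -> (g c_theta, e^{-4 i theta} z).
\<close>

definition basic_form :: "orbit_end \<Rightarrow> real \<Rightarrow> (pt \<Rightarrow> form3) \<Rightarrow> bool" where
  "basic_form b L \<beta> \<longleftrightarrow>
     (\<forall>g\<in>Sp1Sp1. \<forall>z\<in>ball 0 L. \<forall>(k, \<sigma>)\<in>slice_rep b. \<forall>\<xi> v \<eta> w \<zeta> u.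
        \<beta> (gmult g k, z) (\<xi>, v) (\<eta>, w) (\<zeta>, u) =
        \<beta> (g, \<sigma> z) (Ad k \<xi>, \<sigma> v) (Ad k \<eta>, \<sigma> w) (Ad k \<zeta>, \<sigma> u)) \<and>
     (\<forall>g\<in>Sp1Sp1. \<forall>z\<in>ball 0 L. \<forall>\<xi> Y Z.
        frame \<xi> = ((of_int (fst (slope b)) * \<i>, 0), (of_int (snd (slope b)) * \<i>, 0)) \<longrightarrow>
        \<beta> (g, z) (\<xi>, - 4 * \<i> * z) Y Z = 0)"

definition tube_form :: "orbit_end \<Rightarrow> real \<Rightarrow> (pt \<Rightarrow> form3) \<Rightarrow> bool" where
  "tube_form b L \<beta> \<longleftrightarrow> smooth_form L \<beta> \<and> basic_form b L \<beta>"

text \<open>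
  A smooth 3-form on M_23 is a pair of smooth 3-forms on the two tubes which agree
  under the gluing.  By K-invariance it suffices to compare their pullbacks to
  the section z = s > 0.
\<close>

definition M23_form :: "real \<Rightarrow> (orbit_end \<Rightarrow> pt \<Rightarrow> form3) \<Rightarrow> bool" where
  "M23_form L \<phi> \<longleftrightarrow>
     (\<forall>b. tube_form b L (\<phi> b)) \<and>
     (\<forall>g\<in>Sp1Sp1. \<forall>s\<in>{0<..<L}. \<forall>\<xi> \<eta> \<zeta> (r1::real) (r2::real) (r3::real).
        \<phi> Start (g, of_real s) (\<xi>, of_real r1) (\<eta>, of_real r2) (\<zeta>, of_real r3) =
        \<phi> End (g, of_real (L - s)) (\<xi>, of_real (- r1)) (\<eta>, of_real (- r2)) (\<zeta>, of_real (- r3)))"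

text \<open>
  Derivative of a function along the left-invariant vector field (xi, w), the
  bracket of two such fields, and the exterior derivative by the invariant
  (Koszul) formula.
\<close>

definition dir_deriv :: "tvec \<Rightarrow> (pt \<Rightarrow> real) \<Rightarrow> pt \<Rightarrow> real" where
  "dir_deriv X f x =
     deriv (\<lambda>s. f (gmult (fst x) (gexp (s *\<^sub>R fst X)), snd x + s *\<^sub>R snd X)) 0"

definition vbracket :: "tvec \<Rightarrow> tvec \<Rightarrow> tvec" where
  "vbracket X Y = (bracket (fst X) (fst Y), 0)"

definition ext_deriv :: "(pt \<Rightarrow> form3) \<Rightarrow> pt \<Rightarrow> form4" where
  "ext_deriv \<beta> x X0 X1 X2 X3 =
     dir_deriv X0 (\<lambda>y. \<beta> y X1 X2 X3) x - dir_deriv X1 (\<lambda>y. \<beta> y X0 X2 X3) x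
     + dir_deriv X2 (\<lambda>y. \<beta> y X0 X1 X3) x - dir_deriv X3 (\<lambda>y. \<beta> y X0 X1 X2) x
     - \<beta> x (vbracket X0 X1) X2 X3 + \<beta> x (vbracket X0 X2) X1 X3 - \<beta> x (vbracket X0 X3) X1 X2
     - \<beta> x (vbracket X1 X2) X0 X3 + \<beta> x (vbracket X1 X3) X0 X2 - \<beta> x (vbracket X2 X3) X0 X1"

definition wedge3 :: "('v \<Rightarrow> real) \<Rightarrow> ('v \<Rightarrow> real) \<Rightarrow> ('v \<Rightarrow> real) \<Rightarrow> 'v \<Rightarrow> 'v \<Rightarrow> 'v \<Rightarrow> real" where
  "wedge3 \<alpha> \<beta> \<gamma> X Y Z =
     \<alpha> X * (\<beta> Y * \<gamma> Z - \<beta> Z * \<gamma> Y) - \<alpha> Y * (\<beta> X * \<gamma> Z - \<beta> Z * \<gamma> X)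
     + \<alpha> Z * (\<beta> X * \<gamma> Y - \<beta> Y * \<gamma> X)"

definition wedge4 ::
    "('v \<Rightarrow> real) \<Rightarrow> ('v \<Rightarrow> real) \<Rightarrow> ('v \<Rightarrow> real) \<Rightarrow> ('v \<Rightarrow> real) \<Rightarrow> 'v \<Rightarrow> 'v \<Rightarrow> 'v \<Rightarrow> 'v \<Rightarrow> real" where
  "wedge4 \<alpha> \<beta> \<gamma> \<delta> X Y Z W =
     \<alpha> X * wedge3 \<beta> \<gamma> \<delta> Y Z W - \<alpha> Y * wedge3 \<beta> \<gamma> \<delta> X Z W
     + \<alpha> Z * wedge3 \<beta> \<gamma> \<delta> X Y W - \<alpha> W * wedge3 \<beta> \<gamma> \<delta> X Y Z"


section \<open>G2-structures\<close>

text \<open>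
  The standard positive 3-form on R^7 and its Hodge dual for the Euclidean metric and
  the orientation e^1234567.
\<close>

definition phi0 :: "real^7 \<Rightarrow> real^7 \<Rightarrow> real^7 \<Rightarrow> real" where
  "phi0 u v w =
     (let e = (\<lambda>i j k. wedge3 (\<lambda>x::real^7. x $ i) (\<lambda>x. x $ j) (\<lambda>x. x $ k) u v w)
      in e 1 2 3 + e 1 4 5 + e 1 6 7 + e 2 4 6 - e 2 5 7 - e 3 4 7 - e 3 5 6)"

definition psi0 :: "real^7 \<Rightarrow> real^7 \<Rightarrow> real^7 \<Rightarrow> real^7 \<Rightarrow> real" where
  "psi0 u v w z =
     (let e = (\<lambda>i j k l. wedge4 (\<lambda>x::real^7. x $ i) (\<lambda>x. x $ j) (\<lambda>x. x $ k) (\<lambda>x. x $ l) u v w z)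
      in e 4 5 6 7 + e 2 3 6 7 + e 2 3 4 5 + e 1 3 5 7 - e 1 3 4 6 - e 1 2 5 6 - e 1 2 4 7)"

text \<open>
  An adapted coframe at a point: an isomorphism of the 7-dimensional tangent
  space of the quotient with R^7 carrying the 3-form to \<open>phi0\<close>.  It is written
  upstairs, as a linear surjection of the 8-dimensional tangent space; its
  kernel is the null space of the (basic) 3-form, hence the tangent line of the K-orbit.
  A 3-form is positive if adapted coframes exist; its metric and Hodge dual are
  the pullbacks of the standard ones, independently of the coframe because G_2
  preserves the metric and the orientation of R^7.
\<close>

definition adapted :: "form3 \<Rightarrow> (tvec \<Rightarrow> real^7) \<Rightarrow> bool" where
  "adapted f A \<longleftrightarrow> linear A \<and> surj A \<and> (\<forall>X Y Z. f X Y Z = phi0 (A X) (A Y) (A Z))"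

definition is_metric :: "form3 \<Rightarrow> (tvec \<Rightarrow> tvec \<Rightarrow> real) \<Rightarrow> bool" where
  "is_metric f h \<longleftrightarrow> (\<exists>A. adapted f A \<and> (\<forall>X Y. h X Y = A X \<bullet> A Y))"

definition is_hodge_dual :: "form3 \<Rightarrow> form4 \<Rightarrow> bool" where
  "is_hodge_dual f \<psi> \<longleftrightarrow>
     (\<exists>A. adapted f A \<and> (\<forall>X Y Z W. \<psi> X Y Z W = psi0 (A X) (A Y) (A Z) (A W)))"

definition positive_form :: "real \<Rightarrow> (pt \<Rightarrow> form3) \<Rightarrow> bool" where
  "positive_form L \<beta> \<longleftrightarrow> (\<forall>x\<in>tube L. \<exists>A. adapted (\<beta> x) A)"

definition G2_structure_M23 :: "real \<Rightarrow> (orbit_end \<Rightarrow> pt \<Rightarrow> form3) \<Rightarrow> bool" where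
  "G2_structure_M23 L \<phi> \<longleftrightarrow> M23_form L \<phi> \<and> (\<forall>b. positive_form L (\<phi> b))"

definition nearly_parallel :: "real \<Rightarrow> real \<Rightarrow> (orbit_end \<Rightarrow> pt \<Rightarrow> form3) \<Rightarrow> bool" where
  "nearly_parallel lam L \<phi> \<longleftrightarrow>
     lam \<noteq> 0 \<and>
     (\<forall>b. \<forall>x\<in>tube L. \<exists>\<psi>. is_hodge_dual (\<phi> b x) \<psi> \<and>
        (\<forall>X Y Z W. ext_deriv (\<phi> b) x X Y Z W = lam * \<psi> X Y Z W))"

text \<open>
  Invariance under the SO(4)-action, i.e. under left multiplication by
  Sp(1) x Sp(1).
\<close>

definition SO4_invariant :: "real \<Rightarrow> (orbit_end \<Rightarrow> pt \<Rightarrow> form3) \<Rightarrow> bool" where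
  "SO4_invariant L \<phi> \<longleftrightarrow>
     (\<forall>b. \<forall>h\<in>Sp1Sp1. \<forall>g\<in>Sp1Sp1. \<forall>z\<in>ball 0 L. \<forall>X Y Z.
        \<phi> b (gmult h g, z) X Y Z = \<phi> b (g, z) X Y Z)"

text \<open>
  Invariance under (g, z) -> (g u, z) for u in the circle of all
  (e^{i theta}, e^{-i theta}), which rotates both e^3 + i e^5 and e^4 + i e^6
  with the same speed 2.  The circle commutes with C^i_{3,-1} and C^i_{1,-3}, but
  not with (j,j), so this action descends to the double cover of M_23 only.
\<close>

definition U1_invariant :: "real \<Rightarrow> (orbit_end \<Rightarrow> pt \<Rightarrow> form3) \<Rightarrow> bool" where
  "U1_invariant L \<phi> \<longleftrightarrow>
     (\<forall>b. \<forall>\<theta>. \<forall>g\<in>Sp1Sp1. \<forall>z\<in>ball 0 L. \<forall>\<xi> v \<eta> w \<zeta> u.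
        \<phi> b (gmult g (circ 1 (-1) \<theta>), z) (\<xi>, v) (\<eta>, w) (\<zeta>, u) =
        \<phi> b (g, z) (Ad (circ 1 (-1) \<theta>) \<xi>, v) (Ad (circ 1 (-1) \<theta>) \<eta>, w) (Ad (circ 1 (-1) \<theta>) \<zeta>, u))"

text \<open>
  Completeness of the Riemannian distance.  A piecewise C^1 curve in M_23 is a
  finite concatenation of C^1 curves each of which lies in a single tube and
  lifts to Sp(1) x Sp(1) x D; \<open>joined L h A B r\<close> says that such a curve of
  length r leads from A to B.
\<close>

definition C1_curve ::
    "real \<Rightarrow> (pt \<Rightarrow> tvec \<Rightarrow> tvec \<Rightarrow> real) \<Rightarrow> pt \<Rightarrow> pt \<Rightarrow> real \<Rightarrow> bool" where
  "C1_curve L h x y l \<longleftrightarrow>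
     (\<exists>c v. c 0 = x \<and> c 1 = y \<and> continuous_on {0..1} v \<and>
        (\<forall>s\<in>{0..1}. c s \<in> tube L \<and>
           (c has_vector_derivative tangent_vector (c s) (v s)) (at s within {0..1})) \<and>
        l = integral {0..1} (\<lambda>s. sqrt (h (c s) (v s) (v s))))"

inductive joined ::
    "real \<Rightarrow> (orbit_end \<Rightarrow> pt \<Rightarrow> tvec \<Rightarrow> tvec \<Rightarrow> real) \<Rightarrow>
     (orbit_end \<times> pt) set \<Rightarrow> (orbit_end \<times> pt) set \<Rightarrow> real \<Rightarrow> bool" for L h where
  refl: "A \<in> M23 L \<Longrightarrow> joined L h A A 0"
| step: "joined L h A B r \<Longrightarrow> (b, x) \<in> B \<Longrightarrow> C1_curve L (h b) x y l \<Longrightarrow>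
    (b, y) \<in> C \<Longrightarrow> C \<in> M23 L \<Longrightarrow> joined L h A C (r + l)"

definition dist_less ::
    "real \<Rightarrow> (orbit_end \<Rightarrow> pt \<Rightarrow> tvec \<Rightarrow> tvec \<Rightarrow> real) \<Rightarrow>
     (orbit_end \<times> pt) set \<Rightarrow> (orbit_end \<times> pt) set \<Rightarrow> real \<Rightarrow> bool" where
  "dist_less L h A B \<epsilon> \<longleftrightarrow> (\<exists>r<\<epsilon>. joined L h A B r)"

definition complete_structure :: "real \<Rightarrow> (orbit_end \<Rightarrow> pt \<Rightarrow> form3) \<Rightarrow> bool" where
  "complete_structure L \<phi> \<longleftrightarrow>
     (\<exists>h. (\<forall>b. \<forall>x\<in>tube L. is_metric (\<phi> b x) (h b x)) \<and>
        (\<forall>A. (\<forall>n. A n \<in> M23 L) \<and> (\<forall>\<epsilon>>0. \<exists>N::nat. \<forall>m\<ge>N. \<forall>n\<ge>N. dist_less L h (A m) (A n) \<epsilon>) \<longrightarrow>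
           (\<exists>B\<in>M23 L. \<forall>\<epsilon>>0. \<exists>N. \<forall>n\<ge>N. dist_less L h (A n) B \<epsilon>)))"


section \<open>The nearly parallel system\<close>

text \<open>
  The functions p_1, p_2, p_3 and q_1, ..., q_8 of t are written \<open>p i t\<close> and \<open>q i t\<close>.
\<close>

type_synonym coeffs = "nat \<Rightarrow> real \<Rightarrow> real"

definition coframe :: "nat \<Rightarrow> tvec \<Rightarrow> real" where
  "coframe i X =
     (if i = 1 then fst (fst X) $ 1 else if i = 3 then fst (fst X) $ 2 else
      if i = 5 then fst (fst X) $ 3 else if i = 2 then snd (fst X) $ 1 else
      if i = 4 then snd (fst X) $ 2 else snd (fst X) $ 3)"

definition dt :: "tvec \<Rightarrow> real" where
  "dt X = Re (snd X)"

definition phi_ansatz :: "coeffs \<Rightarrow> coeffs \<Rightarrow> real \<Rightarrow> form3" where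
  "phi_ansatz p q t X Y Z =
     (let f = (\<lambda>i j. wedge3 dt (coframe i) (coframe j) X Y Z);
          e = (\<lambda>i j k. wedge3 (coframe i) (coframe j) (coframe k) X Y Z)
      in p 1 t * f 1 2 + p 2 t * f 3 4 + p 3 t * f 5 6
         + q 1 t * e 1 3 5 + q 2 t * e 1 3 6 + q 3 t * e 1 4 5 + q 4 t * e 1 4 6
         + q 5 t * e 2 3 5 + q 6 t * e 2 3 6 + q 7 t * e 2 4 5 + q 8 t * e 2 4 6)"

definition agrees_with_ansatz :: "(pt \<Rightarrow> form3) \<Rightarrow> coeffs \<Rightarrow> coeffs \<Rightarrow> real set \<Rightarrow> bool" where
  "agrees_with_ansatz \<beta> p q I \<longleftrightarrow>
     (\<forall>g\<in>Sp1Sp1. \<forall>t\<in>I. \<forall>\<xi> \<eta> \<zeta> (r1::real) (r2::real) (r3::real).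
        \<beta> (g, of_real t) (\<xi>, of_real r1) (\<eta>, of_real r2) (\<zeta>, of_real r3) =
        phi_ansatz p q t (\<xi>, of_real r1) (\<eta>, of_real r2) (\<zeta>, of_real r3))"

text \<open>
  The right-hand side of the i-th equation of the system for q = (q_1, ..., q_8)
  at a fixed time.
\<close>

definition rhs :: "real \<Rightarrow> (nat \<Rightarrow> real) \<Rightarrow> (nat \<Rightarrow> real) \<Rightarrow> nat \<Rightarrow> real" where
  "rhs lam p q i =
     (let P = p 1 * p 2 * p 3; \<alpha> = (\<lambda>i. q i * q (9 - i)); \<Sigma> = (\<Sum>i=1..4. \<alpha> i); c = lam / (2 * P) in
      if i = 1 then c * (q 1 * (2 * \<alpha> 1 - \<Sigma>) + 2 * q 2 * q 3 * q 5)
      else if i = 8 then - c * (q 8 * (2 * \<alpha> 1 - \<Sigma>) + 2 * q 4 * q 6 * q 7)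
      else if i = 2 then p 3 - c * (q 2 * (2 * \<alpha> 2 - \<Sigma>) + 2 * q 1 * q 4 * q 6)
      else if i = 7 then - p 3 + c * (q 7 * (2 * \<alpha> 2 - \<Sigma>) + 2 * q 3 * q 5 * q 8)
      else if i = 3 then p 2 - c * (q 3 * (2 * \<alpha> 3 - \<Sigma>) + 2 * q 1 * q 4 * q 7)
      else if i = 6 then - p 2 + c * (q 6 * (2 * \<alpha> 3 - \<Sigma>) + 2 * q 2 * q 5 * q 8)
      else if i = 4 then - p 1 + c * (q 4 * (2 * \<alpha> 4 - \<Sigma>) + 2 * q 2 * q 3 * q 8)
      else p 1 - c * (q 5 * (2 * \<alpha> 4 - \<Sigma>) + 2 * q 1 * q 6 * q 7))"

definition constraints :: "real \<Rightarrow> (nat \<Rightarrow> real) \<Rightarrow> (nat \<Rightarrow> real) \<Rightarrow> bool" where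
  "constraints lam p q \<longleftrightarrow>
     q 2 + q 7 = - lam * p 1 * p 2 \<and> q 3 + q 6 = - lam * p 1 * p 3 \<and> q 4 + q 5 = - lam * p 2 * p 3 \<and>
     (let P = p 1 * p 2 * p 3; \<alpha> = (\<lambda>i. q i * q (9 - i)) in
      (\<Sum>i=1..4. (\<alpha> i)\<^sup>2) - 2 * (\<Sum>j=1..4. \<Sum>i\<in>{1..<j}. \<alpha> i * \<alpha> j)
        + 4 * (q 1 * q 4 * q 6 * q 7 + q 2 * q 3 * q 5 * q 8) = - 4 * P\<^sup>2)"

definition in_chamber :: "(nat \<Rightarrow> real) \<Rightarrow> (nat \<Rightarrow> real) \<Rightarrow> bool" where
  "in_chamber p q \<longleftrightarrow>
     q 2 + q 7 > 0 \<and> q 3 + q 6 > 0 \<and> q 4 + q 5 < 0 \<and> p 1 < 0 \<and> 0 < p 2 \<and> 0 < p 3"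

text \<open>
  \<open>is_solution lam p q q' T\<close>: a solution on (0, T] whose functions q_i are differentiable on
  [0, T] with derivatives \<open>q' i\<close> (one-sided at the end points).  The system is
  singular at t = 0, where p_1 vanishes; in the chamber P is nonzero.
\<close>

definition is_solution :: "real \<Rightarrow> coeffs \<Rightarrow> coeffs \<Rightarrow> coeffs \<Rightarrow> real \<Rightarrow> bool" where
  "is_solution lam p q q' T \<longleftrightarrow>
     (\<forall>i\<in>{1..8}. \<forall>t\<in>{0..T}. (q i has_real_derivative q' i t) (at t within {0..T})) \<and>
     (\<forall>t\<in>{0<..T}.
        (\<forall>i\<in>{1..8}. q' i t = rhs lam (\<lambda>j. p j t) (\<lambda>j. q j t) i) \<and>
        constraints lam (\<lambda>j. p j t) (\<lambda>j. q j t) \<and>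
        in_chamber (\<lambda>j. p j t) (\<lambda>j. q j t))"

text \<open>
  \<open>is_eta lam a c \<nu> T p q\<close>: (p, q) is the solution eta_{a,c,nu}, defined on [0, T].
  Smooth extension over the singular orbit at t = 0 means that the 3-form is the
  restriction of a smooth positive 3-form on the tube around that orbit.
\<close>

definition is_eta :: "real \<Rightarrow> real \<Rightarrow> real \<Rightarrow> real \<Rightarrow> real \<Rightarrow> coeffs \<Rightarrow> coeffs \<Rightarrow> bool" where
  "is_eta lam a c \<nu> T p q \<longleftrightarrow>
     a > 0 \<and> c < 0 \<and> 3 * a - c \<noteq> - (lam ^ 3) * a * c \<and> T > 0 \<and>
     (\<exists>q'. is_solution lam p q q' T \<and>
        q 1 0 = a \<and> q 5 0 = - 3 * a \<and> q 4 0 = c \<and> q 8 0 = - 3 * c \<and>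
        q 2 0 = 0 \<and> q 3 0 = 0 \<and> q 6 0 = 0 \<and> q 7 0 = 0 \<and>
        q' 2 0 = - lam * sqrt (- a * c) + sqrt ((3 * a - c) / lam) \<and>
        q' 3 0 = - lam * sqrt (- a * c) + sqrt ((3 * a - c) / lam) \<and>
        q' 6 0 = 3 * lam * sqrt (- a * c) - sqrt ((3 * a - c) / lam) \<and>
        q' 7 0 = 3 * lam * sqrt (- a * c) - sqrt ((3 * a - c) / lam) \<and>
        (q' 3 has_real_derivative 2 * \<nu>) (at 0 within {0..T}) \<and>
        (q' 2 has_real_derivative - (2 * \<nu>)) (at 0 within {0..T})) \<and>
     (\<exists>\<beta>. tube_form Start T \<beta> \<and> positive_form T \<beta> \<and> SO4_invariant T (\<lambda>_. \<beta>) \<and>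
        agrees_with_ansatz \<beta> p q {0..<T})"

definition tau_fixed :: "coeffs \<Rightarrow> real \<Rightarrow> bool" where
  "tau_fixed q T \<longleftrightarrow> (\<forall>i\<in>{1..8}. q i T = q (9 - i) T)"

definition reflect_p :: "real \<Rightarrow> coeffs \<Rightarrow> coeffs" where
  "reflect_p T p i t = (if t \<le> T then p i t else p i (2 * T - t))"

definition reflect_q :: "real \<Rightarrow> coeffs \<Rightarrow> coeffs" where
  "reflect_q T q i t = (if t \<le> T then q i t else q (9 - i) (2 * T - t))"

text \<open>
  On the principal part of M_23 the structure is the one given by eta_{a,c,nu}(t) for
  t <= T and by its reflection tau_23(eta_{a,c,nu}(2T - t)) for T <= t < 2T.
\<close>

definition obtained_by_reflection ::
    "real \<Rightarrow> real \<Rightarrow> real \<Rightarrow> real \<Rightarrow> real \<Rightarrow> (orbit_end \<Rightarrow> pt \<Rightarrow> form3) \<Rightarrow> bool" where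
  "obtained_by_reflection lam a c \<nu> T \<phi> \<longleftrightarrow>
     (\<exists>p q. is_eta lam a c \<nu> T p q \<and> tau_fixed q T \<and>
        agrees_with_ansatz (\<phi> Start) (reflect_p T p) (reflect_q T q) {0..<2 * T})"

end

theory Submission
  imports Defs
begin

text \<open>
  The solution is explicit.  On the locus \<open>q\<^sub>2 = q\<^sub>3 = q\<^sub>6 = q\<^sub>7\<close>, \<open>q\<^sub>4 = q\<^sub>5\<close>, \<open>q\<^sub>1 q\<^sub>8 = q\<^sub>4\<^sup>2\<close> the system
  reduces to \<open>\<theta>' = \<lambda>/2 sqrt ((7 - cos\<^sup>2 \<theta>) / (4 - cos\<^sup>2 \<theta>))\<close>: with \<open>W = cos \<theta> / 2\<close> one has
  \<open>\<lambda>\<^sup>3 q\<^sub>1 = 2 (1 - W)\<^sup>2\<close>, \<open>\<lambda>\<^sup>3 q\<^sub>8 = 2 (1 + W)\<^sup>2\<close>, \<open>\<lambda>\<^sup>3 q\<^sub>4 = - 2 (1 - W\<^sup>2)\<close>,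
  \<open>\<lambda>\<^sup>3 p\<^sub>1 = 4 W'\<close>, \<open>\<lambda>\<^sup>2 p\<^sub>2 = 2 sqrt (1 - W\<^sup>2)\<close> and \<open>2 q\<^sub>2 = - \<lambda> p\<^sub>1 p\<^sub>2\<close>.  Hence \<open>a = 1 / (2 \<lambda>\<^sup>3)\<close>
  and \<open>c = - 3 a\<close>, the reflection is \<open>\<theta> \<mapsto> \<pi> - \<theta>\<close>, and \<open>T\<close> is an elliptic integral over \<open>[0, \<pi>/2]\<close>.

  The structure has the form \<open>\<phi> = \<eta> \<and> \<omega> + Re \<Omega>\<close> with \<open>d\<eta> = \<lambda>/2 \<omega>\<close> and \<open>d\<Omega> = \<i> \<lambda> \<eta> \<and> \<Omega>\<close>, as on a
  Sasaki-Einstein manifold.  With \<open>E = e\<^sup>3 + \<i> e\<^sup>5\<close> and \<open>F = e\<^sup>4 + \<i> e\<^sup>6\<close> the form \<open>\<Omega>\<close> is \<open>Z \<and> G \<and> F'\<close>,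
  where \<open>G\<close> and \<open>F'\<close> are multiples of the conjugate of \<open>E\<close> and of \<open>F\<close>, and where \<open>Z\<close> extends \<open>dt\<close>
  to the normal disc; the coframe is smooth there because \<open>W\<close> and the other
  coefficients are smooth functions of \<open>\<bar>z\<bar>\<^sup>2\<close>.  Completeness is compactness.
\<close>

section \<open>Functions with continuous derivatives of all orders\<close>

text \<open>Put C = - 2 W' / lambda^2 and S = sqrt (1 - W^2). The reduced system is W' = - lambda^2
  C / 2 together with (C S)' = S W, so that lambda^2 (C S)^2 - S^4 is constant. The values
  prescribed on the singular orbit force W = 1/2 and C = 0 there (on the locus the ratio of
  \<open>q 8\<close> to \<open>q 1\<close> is 9), and the constant becomes - 9/16, that is, lambda^2
  (C S)^2 = (1/4 - W^2) (7/4 - W^2). This is the origin of the 4 and the 7 in the equation for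
  theta. The obstacle is the smooth extension over the singular orbits, where neither theta nor t =
  |z| is a smooth function. Hence the solution is rebuilt from integrals that make sense for y on
  both sides of 0, and divisions by |z|^2 are replaced by smooth quotients. One formula covers a
  whole tube |z| < 2 T, so that nothing has to be matched at t = T: reflecting amounts to the
  symmetry y -> 1 - y, and the gluing of the two tubes is this same symmetry.\<close>

lemma Ck_on_cong:
  assumes "open U" "\<And>x. x \<in> U \<Longrightarrow> f x = g x" "Ck_on k f U"
  shows "Ck_on k g U"
  using assms(2,3)
proof (induction k arbitrary: f g)
  case 0
  then show ?case by (simp add: continuous_on_eq)
next
  case (Suc k)
  have D: "(g has_derivative frechet_derivative f (at x)) (at x)" if "x \<in> U" for x
  proof -
    have "(f has_derivative frechet_derivative f (at x)) (at x)"
      using Suc.prems(2) that by (simp add: frechet_derivative_works)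
    then show ?thesis
      using assms(1) that Suc.prems(1) by (rule has_derivative_transform_within_open)
  qed
  show ?case
    unfolding Ck_on.simps
  proof (intro conjI ballI allI)
    show "g differentiable at x" if "x \<in> U" for x
      using D[OF that] by (auto simp: differentiable_def)
    show "Ck_on k (\<lambda>x. frechet_derivative g (at x) v) U" for v
    proof (rule Suc.IH)
      show "Ck_on k (\<lambda>x. frechet_derivative f (at x) v) U"
        using Suc.prems(2) by simp
      show "frechet_derivative f (at x) v = frechet_derivative g (at x) v" if "x \<in> U" for x
        using frechet_derivative_at[OF D[OF that]] by simp
    qed
  qed
qed

text \<open>\<open>Ck_on\<close> refers to \<open>frechet_derivative\<close>; this rule accepts any
  explicit derivative, so that the inductions below can work with formulas.\<close>

lemma Ck_on_SucI:
  assumes "open U" "\<And>x. x \<in> U \<Longrightarrow> (f has_derivative D x) (at x)"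
    "\<And>v. Ck_on k (\<lambda>x. D x v) U"
  shows "Ck_on (Suc k) f U"
  unfolding Ck_on.simps
proof (intro conjI ballI allI)
  show "f differentiable at x" if "x \<in> U" for x
    using assms(2)[OF that] by (auto simp: differentiable_def)
  show "Ck_on k (\<lambda>x. frechet_derivative f (at x) v) U" for v
    by (rule Ck_on_cong[OF assms(1) _ assms(3)[of v]])
      (simp add: frechet_derivative_at[OF assms(2)])
qed

lemma Ck_on_SucD:
  assumes "Ck_on (Suc k) f U"
  shows "\<And>x. x \<in> U \<Longrightarrow> (f has_derivative frechet_derivative f (at x)) (at x)"
    "\<And>v. Ck_on k (\<lambda>x. frechet_derivative f (at x) v) U"
  using assms by (auto simp: frechet_derivative_works)

lemma Ck_on_Suc_imp: "Ck_on (Suc k) f U \<Longrightarrow> Ck_on k f U"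
proof (induction k arbitrary: f)
  case 0
  then show ?case
    by (auto intro!: continuous_at_imp_continuous_on differentiable_imp_continuous_within)
next
  case (Suc k)
  from Suc.prems have "\<forall>v. Ck_on (Suc k) (\<lambda>x. frechet_derivative f (at x) v) U"
    by (subst (asm) Ck_on.simps(2)) blast
  then show ?case using Suc.IH Suc.prems by (simp add: Ck_on.simps(2)[of k f])
qed

lemma Ck_on_const: "open U \<Longrightarrow> Ck_on k (\<lambda>x. c) U"
proof (induction k arbitrary: c)
  case 0
  then show ?case by simp
next
  case (Suc k)
  show ?case
    by (rule Ck_on_SucI[OF Suc.prems, where D = "\<lambda>_ _. 0"]) (auto intro: Suc)
qed

lemma Ck_on_bounded_linear:
  assumes "open U" "bounded_linear f"
  shows "Ck_on k f U"
proof (cases k)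
  case 0
  then show ?thesis using assms by (simp add: linear_continuous_on)
next
  case (Suc j)
  show ?thesis unfolding Suc
    by (rule Ck_on_SucI[OF assms(1), where D = "\<lambda>_. f"])
      (auto intro: Ck_on_const assms bounded_linear_imp_has_derivative)
qed

lemma Ck_on_add:
  assumes "open U" "Ck_on k f U" "Ck_on k g U"
  shows "Ck_on k (\<lambda>x. f x + g x) U"
  using assms(2,3)
proof (induction k arbitrary: f g)
  case 0
  then show ?case by (simp add: continuous_on_add)
next
  case (Suc k)
  note f = Ck_on_SucD[OF Suc.prems(1)] and g = Ck_on_SucD[OF Suc.prems(2)]
  show ?case
    by (rule Ck_on_SucI[OF assms(1)], rule has_derivative_add[OF f(1) g(1)], assumption, assumption)
      (intro Suc.IH f(2) g(2))
qed

lemma Ck_on_mult: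
  assumes "open U" "Ck_on k f U" "Ck_on k g U"
  shows "Ck_on k (\<lambda>x. f x * g x) U"
  using assms(2,3)
proof (induction k arbitrary: f g)
  case 0
  then show ?case by (simp add: continuous_on_mult)
next
  case (Suc k)
  note f = Ck_on_SucD[OF Suc.prems(1)] and g = Ck_on_SucD[OF Suc.prems(2)]
  show ?case
    by (rule Ck_on_SucI[OF assms(1)], rule has_derivative_mult[OF f(1) g(1)], assumption, assumption)
      (intro Ck_on_add[OF assms(1)] Suc.IH f(2) g(2) Ck_on_Suc_imp[OF Suc.prems(1)] Ck_on_Suc_imp[OF Suc.prems(2)])
qed

text \<open>The outer function is scalar, so its derivative is multiplication by a number. The chain
  rule thus yields a product, to which \<open>Ck_on_mult\<close> and the induction hypothesis for
  general \<open>h\<close> apply.\<close>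

lemma Ck_on_compose:
  fixes h :: "real \<Rightarrow> real"
  assumes "open U" "open V" "Ck_on k h V" "Ck_on k f U" "\<And>x. x \<in> U \<Longrightarrow> f x \<in> V"
  shows "Ck_on k (\<lambda>x. h (f x)) U"
  using assms(3,4)
proof (induction k arbitrary: h)
  case 0
  have "f ` U \<subseteq> V" using assms(5) by blast
  with 0 show ?case
    by (simp add: continuous_on_compose2)
next
  case (Suc k)
  note h = Ck_on_SucD[OF Suc.prems(1)] and f = Ck_on_SucD[OF Suc.prems(2)]
  have D: "((\<lambda>x. h (f x)) has_derivative
      (\<lambda>v. frechet_derivative f (at x) v * frechet_derivative h (at (f x)) 1)) (at x)" if "x \<in> U" for x
  proof -
    have hd: "(h has_derivative frechet_derivative h (at (f x))) (at (f x))"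
      using h(1) assms(5) that by blast
    have "frechet_derivative h (at (f x)) r = r * frechet_derivative h (at (f x)) 1" for r
      using linear_scale[OF has_derivative_linear[OF hd], of r 1] by simp
    then have "(\<lambda>v. frechet_derivative h (at (f x)) (frechet_derivative f (at x) v)) =
        (\<lambda>v. frechet_derivative f (at x) v * frechet_derivative h (at (f x)) 1)"
      by (intro ext)
    with has_derivative_compose[OF f(1)[OF that] hd] show ?thesis by metis
  qed
  show ?case
    by (rule Ck_on_SucI[OF assms(1) D], assumption)
      (intro Ck_on_mult[OF assms(1)] f(2) Suc.IH[OF h(2)] Ck_on_Suc_imp[OF Suc.prems(2)])
qed

definition smooth_fun :: "('a::real_normed_vector \<Rightarrow> real) \<Rightarrow> 'a set \<Rightarrow> bool" where
  "smooth_fun f U \<longleftrightarrow> open U \<and> (\<forall>k. Ck_on k f U)"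

lemma smooth_fun_open: "smooth_fun f U \<Longrightarrow> open U"
  by (simp add: smooth_fun_def)

lemma smooth_fun_cong:
  "smooth_fun f U \<Longrightarrow> (\<And>x. x \<in> U \<Longrightarrow> f x = g x) \<Longrightarrow> smooth_fun g U"
  unfolding smooth_fun_def using Ck_on_cong by blast

lemma smooth_fun_const: "open U \<Longrightarrow> smooth_fun (\<lambda>x. c) U"
  by (simp add: smooth_fun_def Ck_on_const)

lemma smooth_fun_bounded_linear: "open U \<Longrightarrow> bounded_linear f \<Longrightarrow> smooth_fun f U"
  by (simp add: smooth_fun_def Ck_on_bounded_linear)

lemma smooth_fun_add: "smooth_fun f U \<Longrightarrow> smooth_fun g U \<Longrightarrow> smooth_fun (\<lambda>x. f x + g x) U"
  by (simp add: smooth_fun_def Ck_on_add)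

lemma smooth_fun_mult: "smooth_fun f U \<Longrightarrow> smooth_fun g U \<Longrightarrow> smooth_fun (\<lambda>x. f x * g x) U"
  by (simp add: smooth_fun_def Ck_on_mult)

lemma smooth_fun_minus: "smooth_fun f U \<Longrightarrow> smooth_fun (\<lambda>x. - f x) U"
  using smooth_fun_mult[OF smooth_fun_const[of U "-1"], of f] by (simp add: smooth_fun_def)

lemma smooth_fun_diff: "smooth_fun f U \<Longrightarrow> smooth_fun g U \<Longrightarrow> smooth_fun (\<lambda>x. f x - g x) U"
  using smooth_fun_add[OF _ smooth_fun_minus, of f U g] by simp

lemma smooth_fun_compose:
  fixes h :: "real \<Rightarrow> real"
  assumes "smooth_fun h V" "smooth_fun f U" "\<And>x. x \<in> U \<Longrightarrow> f x \<in> V"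
  shows "smooth_fun (\<lambda>x. h (f x)) U"
  using assms unfolding smooth_fun_def by (auto intro: Ck_on_compose)

lemma smooth_fun_inverse_real: "smooth_fun inverse {(0::real)<..}"
proof -
  have o: "open {(0::real)<..}" by simp
  have "Ck_on k inverse {(0::real)<..}" for k
  proof (induction k)
    case 0
    then show ?case by (auto intro!: continuous_intros)
  next
    case (Suc k)
    \<comment> \<open>The derivative is written in terms of \<open>inverse\<close> itself, so that
      smoothness bootstraps from k to k + 1.\<close>
    have D: "(inverse has_derivative (\<lambda>v. (inverse x * inverse x) * (- v))) (at x)"
      if "x \<in> {0<..}" for x :: real
      using that by (auto intro!: derivative_eq_intros simp: field_simps)
    show ?case
      by (rule Ck_on_SucI[OF o D], assumption) (intro Ck_on_mult[OF o] Suc Ck_on_const[OF o])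
  qed
  then show ?thesis by (simp add: smooth_fun_def)
qed

lemma smooth_fun_inverse:
  "smooth_fun f U \<Longrightarrow> (\<And>x. x \<in> U \<Longrightarrow> 0 < f x) \<Longrightarrow> smooth_fun (\<lambda>x. inverse (f x)) U"
  by (rule smooth_fun_compose[OF smooth_fun_inverse_real]) auto

lemma smooth_fun_divide:
  "smooth_fun f U \<Longrightarrow> smooth_fun g U \<Longrightarrow> (\<And>x. x \<in> U \<Longrightarrow> 0 < g x) \<Longrightarrow> smooth_fun (\<lambda>x. f x / g x) U"
  unfolding divide_inverse by (intro smooth_fun_mult smooth_fun_inverse)

lemma smooth_fun_sqrt_real: "smooth_fun sqrt {0<..}"
proof -
  have o: "open {(0::real)<..}" by simp
  have "Ck_on k sqrt {(0::real)<..}" for k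
  proof (induction k)
    case 0
    then show ?case by (auto intro!: continuous_intros)
  next
    case (Suc k)
    have D: "(sqrt has_derivative (\<lambda>v. inverse (sqrt x) * (v * (1 / 2)))) (at x)"
      if "x \<in> {0<..}" for x :: real
      using that by (auto intro!: derivative_eq_intros simp: field_simps)
    have "Ck_on k inverse {(0::real)<..}" using smooth_fun_inverse_real by (simp add: smooth_fun_def)
    then have "Ck_on k (\<lambda>x. inverse (sqrt x)) {0<..}"
      by (rule Ck_on_compose[OF o o _ Suc]) auto
    then show ?case
      by - (rule Ck_on_SucI[OF o D], assumption, intro Ck_on_mult[OF o] Ck_on_const[OF o])
  qed
  then show ?thesis by (simp add: smooth_fun_def)
qed

lemma smooth_fun_sqrt:
  "smooth_fun f U \<Longrightarrow> (\<And>x. x \<in> U \<Longrightarrow> 0 < f x) \<Longrightarrow> smooth_fun (\<lambda>x. sqrt (f x)) U"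
  by (rule smooth_fun_compose[OF smooth_fun_sqrt_real]) auto

lemma smooth_fun_power: "smooth_fun f U \<Longrightarrow> smooth_fun (\<lambda>x. f x ^ n) U"
  by (induction n) (auto intro: smooth_fun_mult smooth_fun_const smooth_fun_open)

lemma smooth_fun_imp_continuous_on: "smooth_fun f U \<Longrightarrow> continuous_on U f"
  using Ck_on.simps(1) unfolding smooth_fun_def by blast

lemma smooth_fun_differentiable: "smooth_fun f U \<Longrightarrow> x \<in> U \<Longrightarrow> f differentiable (at x)"
  using Ck_on.simps(2) unfolding smooth_fun_def by blast

lemma smooth_fun_deriv:
  fixes f :: "real \<Rightarrow> real"
  assumes "smooth_fun f U"
  shows "smooth_fun (deriv f) U"
    and "\<And>x. x \<in> U \<Longrightarrow> (f has_real_derivative deriv f x) (at x)"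
proof -
  show D: "(f has_real_derivative deriv f x) (at x)" if "x \<in> U" for x
    using smooth_fun_differentiable[OF assms that]
    by (simp add: DERIV_deriv_iff_real_differentiable)
  have "smooth_fun (\<lambda>x. frechet_derivative f (at x) 1) U"
    using assms Ck_on.simps(2) unfolding smooth_fun_def by blast
  moreover have "frechet_derivative f (at x) 1 = deriv f x" if "x \<in> U" for x
    using frechet_derivative_at[OF D[OF that, unfolded has_field_derivative_def]]
    by (metis mult_1_right)
  ultimately show "smooth_fun (deriv f) U" by (rule smooth_fun_cong)
qed

lemma smooth_fun_id: "open U \<Longrightarrow> smooth_fun (\<lambda>x::real. x) U"
  by (rule smooth_fun_bounded_linear) (auto intro: bounded_linear_ident)

lemma Ck_on_real_SucI:
  fixes f :: "real \<Rightarrow> real"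
  assumes "open U" "\<And>x. x \<in> U \<Longrightarrow> (f has_real_derivative D x) (at x)" "Ck_on k D U"
  shows "Ck_on (Suc k) f U"
  by (rule Ck_on_SucI[OF assms(1), where D = "\<lambda>x v. D x * v"],
      rule assms(2)[unfolded has_field_derivative_def], assumption)
    (intro Ck_on_mult Ck_on_const assms)

text \<open>Bootstrapping of the autonomous equation Y' = R(Y): if Y is of class C^k, so is the
  right-hand side, and then Y is of class C^(k+1).\<close>

lemma smooth_fun_inverse_function:
  fixes Y :: "real \<Rightarrow> real"
  assumes "open J" "smooth_fun R V" "\<And>x. x \<in> J \<Longrightarrow> Y x \<in> V"
    "\<And>x. x \<in> J \<Longrightarrow> (Y has_real_derivative R (Y x)) (at x)"
  shows "smooth_fun Y J"
proof -
  have "Ck_on k Y J" for k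
  proof (induction k)
    case 0
    show ?case using assms(4)
      by (auto intro!: continuous_at_imp_continuous_on DERIV_isCont)
  next
    case (Suc k)
    have "Ck_on k (\<lambda>x. R (Y x)) J"
      using assms(2) by (intro Ck_on_compose[OF assms(1) _ _ Suc assms(3)]) (auto simp: smooth_fun_def)
    then show ?case
      by - (rule Ck_on_real_SucI[OF assms(1) assms(4)])
  qed
  then show ?thesis using assms(1) by (simp add: smooth_fun_def)
qed

text \<open>Differentiation under the integral turns the weight \<open>w\<close> into
  \<open>w * p\<close> and \<open>f\<close> into its derivative, so these weighted averages are
  closed under differentiation; this is why a weight is carried along. As \<open>p\<close> takes
  values in [0, 1], the point \<open>y * p s\<close> stays in the interval, which contains
  0.\<close>

lemma smooth_fun_average:
  fixes f p w :: "real \<Rightarrow> real" and e :: real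
  defines "U \<equiv> {-e<..<1}"
  assumes "smooth_fun f U" "0 < e"
    and p: "continuous_on {0..1} p" "\<And>s. s \<in> {0..1} \<Longrightarrow> p s \<in> {0..1}"
    and w: "continuous_on {0..1} w"
  shows "smooth_fun (\<lambda>y. integral {0..1} (\<lambda>s. w s * f (y * p s))) U"
    and "\<And>y. y \<in> U \<Longrightarrow> ((\<lambda>y. integral {0..1} (\<lambda>s. w s * f (y * p s))) has_real_derivative
            integral {0..1} (\<lambda>s. w s * p s * deriv f (y * p s))) (at y)"
proof -
  have U: "open U" "convex U" by (auto simp: U_def)
  have mem: "y * p s \<in> U" if "y \<in> U" "s \<in> {0..1}" for y s
  proof -
    have "closed_segment 0 y \<subseteq> U"
      using that \<open>0 < e\<close> U by (intro closed_segment_subset) (auto simp: U_def)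
    moreover have "y * p s \<in> closed_segment 0 y"
      using p(2)[OF that(2)] by (auto simp: in_segment intro!: exI[of _ "p s"])
    ultimately show ?thesis by blast
  qed
  have cont: "continuous_on (U \<times> cbox 0 1) (\<lambda>(y, s). w s * f (y * p s))"
    if "continuous_on {0..1} w" "smooth_fun f U" for w f
    unfolding split_beta
    by (intro continuous_intros continuous_on_compose2[OF that(1)]
        continuous_on_compose2[OF smooth_fun_imp_continuous_on[OF that(2)]]
        continuous_on_compose2[OF p(1)])
      (use mem in \<open>auto simp: cbox_interval\<close>)
  have D: "((\<lambda>y. integral {0..1} (\<lambda>s. w s * f (y * p s))) has_real_derivative
            integral {0..1} (\<lambda>s. w s * p s * deriv f (y * p s))) (at y)"
    if w: "continuous_on {0..1} w" and f: "smooth_fun f U" and y: "y \<in> U" for w f y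
  proof -
    have "((\<lambda>y. integral (cbox 0 1) (\<lambda>s. w s * f (y * p s))) has_real_derivative
            integral (cbox 0 1) (\<lambda>s. w s * p s * deriv f (y * p s))) (at y within U)"
    proof (rule leibniz_rule_field_derivative[OF _ _ _ y U(2)])
      fix x s :: real assume xs: "x \<in> U" "s \<in> cbox 0 1"
      have "(f has_real_derivative deriv f (x * p s)) (at (x * p s))"
        using smooth_fun_deriv(2)[OF f mem] xs by auto
      then have "((\<lambda>x. f (x * p s)) has_real_derivative deriv f (x * p s) * p s) (at x)"
        by (rule DERIV_chain2[where g = "\<lambda>x. x * p s"]) (auto intro!: derivative_eq_intros)
      from DERIV_cmult[OF this, of "w s"]
      show "((\<lambda>x. w s * f (x * p s)) has_real_derivative w s * p s * deriv f (x * p s)) (at x within U)"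
        by - (rule has_field_derivative_at_within, simp add: ac_simps)
    next
      fix x assume "x \<in> U"
      then have "continuous_on (cbox 0 1) (\<lambda>s. w s * f (x * p s))"
        unfolding cbox_interval using mem
        by (intro continuous_on_mult continuous_on_compose2[OF smooth_fun_imp_continuous_on[OF f]]
            continuous_on_const p(1) w) auto
      then show "(\<lambda>s. w s * f (x * p s)) integrable_on cbox 0 1"
        by (rule integrable_continuous)
    next
      show "continuous_on (U \<times> cbox 0 1) (\<lambda>(x, s). w s * p s * deriv f (x * p s))"
        by (rule cont[where w = "\<lambda>s. w s * p s" and f = "deriv f"])
          (intro continuous_on_mult w p(1), rule smooth_fun_deriv(1)[OF f])
    qed
    then show ?thesis
      using at_within_open[OF y U(1)] by simp
  qed
  have "Ck_on k (\<lambda>y. integral {0..1} (\<lambda>s. w s * f (y * p s))) U"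
    if "continuous_on {0..1} w" "smooth_fun f U" for k w f
    using that
  proof (induction k arbitrary: w f)
    case 0
    show ?case
      using integral_continuous_on_param[OF cont[OF 0]] by simp
  next
    case (Suc k)
    show ?case
      by (rule Ck_on_real_SucI[OF U(1) D[OF Suc.prems]], assumption)
        (rule Suc.IH[where w = "\<lambda>s. w s * p s" and f = "deriv f"],
          intro continuous_on_mult Suc.prems p(1), rule smooth_fun_deriv(1)[OF Suc.prems(2)])
  qed
  with U(1) w assms(2) show "smooth_fun (\<lambda>y. integral {0..1} (\<lambda>s. w s * f (y * p s))) U"
    by (simp add: smooth_fun_def)
  show "\<And>y. y \<in> U \<Longrightarrow> ((\<lambda>y. integral {0..1} (\<lambda>s. w s * f (y * p s))) has_real_derivative
            integral {0..1} (\<lambda>s. w s * p s * deriv f (y * p s))) (at y)"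
    using D[OF w assms(2)] .
qed

text \<open>Hadamard's form of (f y - f 0) / y, which is smooth also at y = 0. The factor 1 is the
  weight in \<open>smooth_fun_average\<close>.\<close>

definition diff_quot :: "(real \<Rightarrow> real) \<Rightarrow> real \<Rightarrow> real" where
  "diff_quot f y = integral {0..1} (\<lambda>s. 1 * deriv f (y * s))"

lemma smooth_fun_diff_quot:
  fixes e :: real
  assumes "smooth_fun f {-e<..<1}" "0 < e"
  shows "smooth_fun (diff_quot f) {-e<..<1}"
  unfolding diff_quot_def
  by (rule smooth_fun_average(1)[where p = "\<lambda>s. s"])
    (use assms smooth_fun_deriv(1) in auto)

lemma diff_quot:
  fixes e :: real
  assumes f: "smooth_fun f {-e<..<1}" and "0 < e" and y: "y \<in> {-e<..<1}"
  shows "f y = f 0 + y * diff_quot f y"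
proof -
  have mem: "y * s \<in> {-e<..<1}" if "s \<in> {0..1}" for s
  proof -
    have "closed_segment 0 y \<subseteq> {-e<..<1}"
      using y \<open>0 < e\<close> by (intro closed_segment_subset) auto
    moreover have "y * s \<in> closed_segment 0 y"
      using that by (auto simp: in_segment intro!: exI[of _ s])
    ultimately show ?thesis by blast
  qed
  have "((\<lambda>s. y * deriv f (y * s)) has_integral f (y * 1) - f (y * 0)) {0..1}"
  proof (rule fundamental_theorem_of_calculus)
    fix s :: real assume s: "s \<in> {0..1}"
    have "((\<lambda>s. f (y * s)) has_real_derivative deriv f (y * s) * y) (at s)"
      by (rule DERIV_chain2[where g = "\<lambda>s. y * s", OF smooth_fun_deriv(2)[OF f mem[OF s]]])
        (auto intro!: derivative_eq_intros)
    then show "((\<lambda>s. f (y * s)) has_vector_derivative y * deriv f (y * s)) (at s within {0..1})"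
      by (simp add: has_real_derivative_iff_has_vector_derivative mult.commute has_vector_derivative_at_within)
  qed simp
  then have "integral {0..1} (\<lambda>s. y * deriv f (y * s)) = f (y * 1) - f (y * 0)"
    by (rule integral_unique)
  then show ?thesis
    by (simp add: diff_quot_def)
qed

section \<open>The profile of the solution\<close>

text \<open>The coefficients are functions of \<open>y = sin\<^sup>2 (\<theta> / 2)\<close>, where \<open>W = 1/2 - y\<close>; the arc length
  from the singular orbit is \<open>sqrt y * kappa y\<close>, and \<open>speed\<close> is its derivative with respect to
  \<open>sqrt y\<close>.  Unlike \<open>\<theta>\<close>, the variable \<open>y\<close> is a smooth function of the square of the arc length.\<close>

locale scale =
  fixes lam :: real
  assumes lam_pos: "0 < lam"
begin

text \<open>With x = sin (theta/2) and y = x^2 one has cos theta = 1 - 2 y, which turns 4 - cos^2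
  theta and 7 - cos^2 theta into the two quadratics; the factor 1 - y = cos^2 (theta/2) comes from
  dx / dtheta.\<close>

definition speed :: "real \<Rightarrow> real" where
  "speed y = 4 / lam * sqrt ((3 + 4 * y - 4 * y\<^sup>2) / ((6 + 4 * y - 4 * y\<^sup>2) * (1 - y)))"

text \<open>The arc length is the integral of speed (u^2) over 0 <= u <= x. Substituting u = x s
  makes it x times this average, which depends on y = x^2 only.\<close>

definition kappa :: "real \<Rightarrow> real" where
  "kappa y = integral {0..1} (\<lambda>s. 1 * speed (y * s\<^sup>2))"

text \<open>The interval reaches below 0, where y has no geometric meaning, so that the singular
  orbit y = 0 is an interior point. At -1/2 the numerator of \<open>speed\<close> vanishes; y = 1 is
  the other singular orbit.\<close>

abbreviation "U \<equiv> {-(1/2)<..<1::real}"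

lemma num_pos: "y \<in> U \<Longrightarrow> 0 < 3 + 4 * y - 4 * y\<^sup>2"
proof -
  assume "y \<in> U"
  then have "0 < (3 - 2 * y) * (1 + 2 * y)" by (intro mult_pos_pos) auto
  then show ?thesis by (simp add: algebra_simps power2_eq_square)
qed

lemma den_pos: "y \<in> U \<Longrightarrow> 0 < (6 + 4 * y - 4 * y\<^sup>2) * (1 - y)"
  using num_pos[of y] by (intro mult_pos_pos) auto

lemma speed_pos: "y \<in> U \<Longrightarrow> 0 < speed y"
  unfolding speed_def using num_pos den_pos lam_pos by simp

lemma speed_square:
  "y \<in> U \<Longrightarrow> (speed y)\<^sup>2 = 16 / lam\<^sup>2 * ((3 + 4 * y - 4 * y\<^sup>2) / ((6 + 4 * y - 4 * y\<^sup>2) * (1 - y)))"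
  unfolding speed_def power_mult_distrib using num_pos den_pos
  by (subst real_sqrt_pow2) (auto simp: power_divide less_imp_le)

lemma speed_smooth: "smooth_fun speed U"
proof -
  have o: "open U" by simp
  note i = smooth_fun_const[OF o] smooth_fun_id[OF o]
  show ?thesis
    unfolding speed_def
    by (intro smooth_fun_mult smooth_fun_sqrt smooth_fun_divide smooth_fun_add smooth_fun_diff
        smooth_fun_power i num_pos den_pos divide_pos_pos)
qed

text \<open>Half the logarithmic derivative of the quotient under the root; in this form the
  quotient of \<open>deriv speed\<close> by \<open>speed\<close> is a rational function.\<close>

lemma speed_deriv:
  assumes y: "y \<in> U"
  shows "deriv speed y = speed y / 2 *
    ((4 - 8 * y) / (3 + 4 * y - 4 * y\<^sup>2) - (12 * y\<^sup>2 - 16 * y - 2) / ((6 + 4 * y - 4 * y\<^sup>2) * (1 - y)))"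
proof -
  let ?N = "3 + 4 * y - 4 * y\<^sup>2" and ?D = "(6 + 4 * y - 4 * y\<^sup>2) * (1 - y)"
  have N: "0 < ?N" and D: "0 < ?D" using num_pos den_pos y by auto
  have N': "((\<lambda>y. 3 + 4 * y - 4 * y\<^sup>2) has_real_derivative 4 - 8 * y) (at y)"
    by (auto intro!: derivative_eq_intros)
  have D': "((\<lambda>y. (6 + 4 * y - 4 * y\<^sup>2) * (1 - y)) has_real_derivative 12 * y\<^sup>2 - 16 * y - 2) (at y)"
    by (auto intro!: derivative_eq_intros simp: algebra_simps power2_eq_square)
  have Q: "((\<lambda>y. (3 + 4 * y - 4 * y\<^sup>2) / ((6 + 4 * y - 4 * y\<^sup>2) * (1 - y))) has_real_derivative
      ((4 - 8 * y) * ?D - ?N * (12 * y\<^sup>2 - 16 * y - 2)) / (?D * ?D)) (at y)"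
    by (intro DERIV_divide N' D') (use D in linarith)
  have "(speed has_real_derivative 4 / lam * (inverse (sqrt (?N / ?D)) / 2 *
      (((4 - 8 * y) * ?D - ?N * (12 * y\<^sup>2 - 16 * y - 2)) / (?D * ?D)))) (at y)"
    unfolding speed_def
    by (intro DERIV_cmult DERIV_chain2[OF DERIV_real_sqrt Q] divide_pos_pos N D)
  then have "deriv speed y = 4 / lam * (inverse (sqrt (?N / ?D)) / 2 *
      (((4 - 8 * y) * ?D - ?N * (12 * y\<^sup>2 - 16 * y - 2)) / (?D * ?D)))"
    by (rule DERIV_imp_deriv)
  also have "inverse (sqrt (?N / ?D)) = sqrt (?N / ?D) * (?D / ?N)"
  proof -
    have "inverse (sqrt q) = sqrt q * inverse q" if "0 < q" for q :: real
      using that by (simp add: field_simps)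
    from this[of "?N / ?D"] show ?thesis using divide_pos_pos[OF N D] by (simp only: inverse_divide)
  qed
  also have "((4 - 8 * y) * ?D - ?N * (12 * y\<^sup>2 - 16 * y - 2)) / (?D * ?D)
      = ?N / ?D * ((4 - 8 * y) / ?N - (12 * y\<^sup>2 - 16 * y - 2) / ?D)"
  proof -
    have "(A * d - n * B) / (d * d) = n / d * (A / n - B / d)" if "0 < n" "0 < d" for n d A B :: real
      using that by (simp add: field_simps)
    then show ?thesis using N D by blast
  qed
  also have "4 / lam * (sqrt (?N / ?D) * (?D / ?N) / 2 *
      (?N / ?D * ((4 - 8 * y) / ?N - (12 * y\<^sup>2 - 16 * y - 2) / ?D)))
    = speed y / 2 * ((4 - 8 * y) / ?N - (12 * y\<^sup>2 - 16 * y - 2) / ?D)"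
  proof -
    have "a * (r * (d / n) / 2 * (n / d * x)) = a * r / 2 * x" if "0 < n" "0 < d" for a r n d x :: real
      using that by simp
    then show ?thesis unfolding speed_def using N D by blast
  qed
  finally show ?thesis .
qed

lemma kappa_smooth: "smooth_fun kappa U"
  unfolding kappa_def
  by (rule smooth_fun_average(1)[where p = "\<lambda>s. s\<^sup>2"])
    (auto intro!: continuous_intros speed_smooth power_le_one)

lemma mem_U_scale: "y \<in> U \<Longrightarrow> s \<in> {0..1} \<Longrightarrow> y * s \<in> U"
proof -
  assume y: "y \<in> U" and s: "s \<in> {0..1}"
  have "closed_segment 0 y \<subseteq> U" using y by (intro closed_segment_subset) auto
  moreover have "y * s \<in> closed_segment 0 y"
    using s by (auto simp: in_segment intro!: exI[of _ s])
  ultimately show ?thesis by blast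
qed

lemma mem_U_scale2: "y \<in> U \<Longrightarrow> s \<in> {0..1} \<Longrightarrow> y * s\<^sup>2 \<in> U"
  by (rule mem_U_scale) (auto intro: power_le_one)

lemma speed_scale_continuous: "y \<in> U \<Longrightarrow> continuous_on {0..1} (\<lambda>s. speed (y * s\<^sup>2))"
  by (rule continuous_on_compose2[OF smooth_fun_imp_continuous_on[OF speed_smooth]])
    (use mem_U_scale2 in \<open>auto intro!: continuous_intros\<close>)

lemma kappa_pos:
  assumes y: "y \<in> U"
  shows "0 < kappa y"
proof -
  have pos: "0 < speed (y * s\<^sup>2)" if "s \<in> {0..1}" for s
    using speed_pos mem_U_scale2[OF y that] by blast
  obtain s0 where s0: "s0 \<in> {0..1}" "\<And>s. s \<in> {0..1} \<Longrightarrow> speed (y * s0\<^sup>2) \<le> speed (y * s\<^sup>2)"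
    using continuous_attains_inf[OF compact_Icc _ speed_scale_continuous[OF y]] by auto
  have "integral {0..1} (\<lambda>s::real. speed (y * s0\<^sup>2)) \<le> integral {0..1} (\<lambda>s. speed (y * s\<^sup>2))"
    by (rule integral_le) (use s0 speed_scale_continuous[OF y] in \<open>auto intro: integrable_continuous_real\<close>)
  then show ?thesis unfolding kappa_def using pos[OF s0(1)] by simp
qed

text \<open>For y = x^2 both sides are the derivative of x * kappa (x^2) in x. The proof integrates
  the derivative of s * speed (y * s^2) over [0, 1] instead, which takes no root of y and so covers
  negative y.\<close>

lemma kappa_deriv:
  assumes y: "y \<in> U"
  shows "kappa y + 2 * y * deriv kappa y = speed y"
proof -
  have "((\<lambda>y. kappa y) has_real_derivative integral {0..1} (\<lambda>s. 1 * s\<^sup>2 * deriv speed (y * s\<^sup>2))) (at y)"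
    unfolding kappa_def
    by (rule smooth_fun_average(2)[OF speed_smooth _ _ _ _ y])
      (auto intro!: continuous_intros power_le_one)
  then have k': "deriv kappa y = integral {0..1} (\<lambda>s. s\<^sup>2 * deriv speed (y * s\<^sup>2))"
    by (auto dest: DERIV_imp_deriv)
  have ci: "continuous_on {0..1} (\<lambda>s. deriv speed (y * s\<^sup>2))"
    by (rule continuous_on_compose2[OF smooth_fun_imp_continuous_on[OF smooth_fun_deriv(1)[OF speed_smooth]]])
      (use mem_U_scale2[OF y] in \<open>auto intro!: continuous_intros\<close>)
  have "((\<lambda>s. speed (y * s\<^sup>2) + 2 * y * (s\<^sup>2 * deriv speed (y * s\<^sup>2))) has_integral
      1 * speed (y * 1\<^sup>2) - 0 * speed (y * 0\<^sup>2)) {0..1}"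
  proof (rule fundamental_theorem_of_calculus)
    fix s :: real assume s: "s \<in> {0..1}"
    have "((\<lambda>s. speed (y * s\<^sup>2)) has_real_derivative deriv speed (y * s\<^sup>2) * (y * (2 * s))) (at s)"
      by (rule DERIV_chain2[where g = "\<lambda>s. y * s\<^sup>2", OF smooth_fun_deriv(2)[OF speed_smooth mem_U_scale2[OF y s]]])
        (auto intro!: derivative_eq_intros)
    from DERIV_mult[OF DERIV_ident this]
    have "((\<lambda>s. s * speed (y * s\<^sup>2)) has_real_derivative
        speed (y * s\<^sup>2) + 2 * y * (s\<^sup>2 * deriv speed (y * s\<^sup>2))) (at s)"
      by (simp add: algebra_simps power2_eq_square)
    then show "((\<lambda>s. s * speed (y * s\<^sup>2)) has_vector_derivative
        speed (y * s\<^sup>2) + 2 * y * (s\<^sup>2 * deriv speed (y * s\<^sup>2))) (at s within {0..1})"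
      by (simp add: has_real_derivative_iff_has_vector_derivative has_vector_derivative_at_within)
  qed simp
  from integral_unique[OF this]
  have "integral {0..1} (\<lambda>s. speed (y * s\<^sup>2) + 2 * y * (s\<^sup>2 * deriv speed (y * s\<^sup>2))) = speed y"
    by simp
  moreover have "integral {0..1} (\<lambda>s. speed (y * s\<^sup>2) + 2 * y * (s\<^sup>2 * deriv speed (y * s\<^sup>2)))
     = integral {0..1} (\<lambda>s. speed (y * s\<^sup>2)) + 2 * y * integral {0..1} (\<lambda>s. s\<^sup>2 * deriv speed (y * s\<^sup>2))"
    unfolding integral_mult_right[symmetric]
    by (intro integral_add integrable_continuous_real continuous_on_mult continuous_on_const
        continuous_on_power continuous_on_id speed_scale_continuous[OF y] ci)
  ultimately show ?thesis by (simp add: k' kappa_def)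
qed

section \<open>The squared arc length as a coordinate\<close>

definition arc2 :: "real \<Rightarrow> real" where "arc2 y = y * (kappa y)\<^sup>2"

definition "J = arc2 ` U"
definition "Y = the_inv_into U arc2"

lemma arc2_deriv:
  assumes y: "y \<in> U"
  shows "(arc2 has_real_derivative kappa y * speed y) (at y)"
proof -
  have "(arc2 has_real_derivative (kappa y)\<^sup>2 + y * (2 * kappa y * deriv kappa y)) (at y)"
    unfolding arc2_def
    by (auto intro!: derivative_eq_intros smooth_fun_deriv(2)[OF kappa_smooth] y)
  moreover have "(kappa y)\<^sup>2 + y * (2 * kappa y * deriv kappa y) = kappa y * speed y"
    unfolding kappa_deriv[OF y, symmetric] by (simp add: algebra_simps power2_eq_square)
  ultimately show ?thesis by simp
qed

lemma arc2_continuous: "continuous_on U arc2"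
  by (intro continuous_at_imp_continuous_on ballI DERIV_isCont[OF arc2_deriv])

lemma arc2_inj: "inj_on arc2 U"
proof (rule linorder_inj_onI)
  fix x y assume xy: "x < y" "x \<in> U" "y \<in> U"
  have "arc2 x < arc2 y"
  proof (rule DERIV_pos_imp_increasing[OF xy(1)])
    fix z assume "x \<le> z" "z \<le> y"
    then have "z \<in> U" using xy by auto
    then show "\<exists>d. (arc2 has_real_derivative d) (at z) \<and> 0 < d"
      using arc2_deriv kappa_pos speed_pos by (metis mult_pos_pos)
  qed
  then show "arc2 x \<noteq> arc2 y" by simp
qed auto

lemma J_open: "open J"
  unfolding J_def
  using injective_into_1d_imp_open_map_UNIV[OF _ arc2_continuous arc2_inj] by auto

lemma Y_arc2: "y \<in> U \<Longrightarrow> Y (arc2 y) = y"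
  unfolding Y_def by (rule the_inv_into_f_f[OF arc2_inj])

lemma Y_mem: "r \<in> J \<Longrightarrow> Y r \<in> U"
  unfolding J_def using Y_arc2 by auto

lemma arc2_Y: "r \<in> J \<Longrightarrow> arc2 (Y r) = r"
  unfolding J_def using Y_arc2 by auto

lemma Y_deriv0:
  assumes "r \<in> J"
  shows "(Y has_real_derivative inverse (kappa (Y r) * speed (Y r))) (at r)"
proof -
  have y: "Y r \<in> U" by (rule Y_mem[OF assms])
  have "(Y has_derivative (*) (inverse (kappa (Y r) * speed (Y r)))) (at (arc2 (Y r)))"
  proof (rule has_derivative_inverse_strong[OF _ y arc2_continuous])
    show "(arc2 has_derivative (*) (kappa (Y r) * speed (Y r))) (at (Y r))"
      using arc2_deriv[OF y] by (simp add: has_field_derivative_def)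
  qed (use kappa_pos[OF y] speed_pos[OF y] Y_arc2 in \<open>auto simp: fun_eq_iff field_simps\<close>)
  then show ?thesis by (simp add: arc2_Y assms has_field_derivative_def)
qed

lemma Y_smooth: "smooth_fun Y J"
  by (rule smooth_fun_inverse_function[OF J_open _ Y_mem Y_deriv0],
      rule smooth_fun_inverse, rule smooth_fun_mult[OF kappa_smooth speed_smooth])
    (use kappa_pos speed_pos in auto)

text \<open>A multiple of the derivative of \<open>Y\<close>. On the section z = t the function t *
  cfun is C = - 2 W' / lambda^2; as W' is odd in t, \<open>cfun\<close> is its smooth even
  factor.\<close>

definition cfun :: "real \<Rightarrow> real" where "cfun y = 4 / lam\<^sup>2 * inverse (kappa y * speed y)"

lemma cfun_smooth: "smooth_fun cfun U"
  unfolding cfun_def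
  by (intro smooth_fun_mult smooth_fun_const smooth_fun_inverse kappa_smooth speed_smooth)
    (use kappa_pos speed_pos in auto)

lemma cfun_pos: "y \<in> U \<Longrightarrow> 0 < cfun y"
  unfolding cfun_def using kappa_pos speed_pos lam_pos by simp

lemma Y_deriv: "r \<in> J \<Longrightarrow> (Y has_real_derivative lam\<^sup>2 * cfun (Y r) / 4) (at r)"
  using Y_deriv0[of r] lam_pos by (simp add: cfun_def)

lemma cfun_deriv:
  assumes y: "y \<in> U"
  shows "deriv cfun y = - cfun y * (deriv kappa y / kappa y + deriv speed y / speed y)"
proof -
  have k: "kappa y \<noteq> 0" "speed y \<noteq> 0" using kappa_pos speed_pos y by (auto simp: less_le)
  have "(cfun has_real_derivative
      4 / lam\<^sup>2 * (- (inverse (kappa y * speed y) * (deriv kappa y * speed y + deriv speed y * kappa y)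
        * inverse (kappa y * speed y)))) (at y)"
    unfolding cfun_def
    by (intro DERIV_cmult DERIV_inverse' DERIV_mult smooth_fun_deriv(2)[OF kappa_smooth y]
        smooth_fun_deriv(2)[OF speed_smooth y]) (use k in auto)
  then have "deriv cfun y = 4 / lam\<^sup>2 * (- (inverse (kappa y * speed y) *
      (deriv kappa y * speed y + deriv speed y * kappa y) * inverse (kappa y * speed y)))"
    by (rule DERIV_imp_deriv)
  then show ?thesis unfolding cfun_def using k by (simp add: field_simps)
qed

text \<open>The equation (C S)' = S W in the variable r = t^2, which needs no division by t and
  holds on the singular orbit as well. After eliminating the derivatives of \<open>kappa\<close> and
  \<open>speed\<close> it comes down to (y D)' = 4 W N, where N / D is the quotient under the root
  in \<open>speed\<close>.\<close>

lemma profile_equation: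
  assumes r: "r \<in> J"
  defines "y \<equiv> Y r"
  defines "W \<equiv> 1 / 2 - y"
  shows "2 * r * (deriv cfun y * (lam\<^sup>2 * cfun y / 4) + cfun y * W * (lam\<^sup>2 * cfun y / 4) / (1 - W\<^sup>2)) + cfun y = W"
proof -
  have y: "y \<in> U" unfolding y_def by (rule Y_mem[OF r])
  define k K k' K' where "k = kappa y" and "K = speed y" and "k' = deriv kappa y" and "K' = deriv speed y"
  define N D D' where "N = 3 + 4 * y - 4 * y\<^sup>2" and "D = (6 + 4 * y - 4 * y\<^sup>2) * (1 - y)"
    and "D' = 12 * y\<^sup>2 - 16 * y - 2"
  have pos: "0 < k" "0 < K" "0 < N" "0 < D"
    using y kappa_pos speed_pos num_pos den_pos by (auto simp: k_def K_def N_def D_def)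
  have rk: "r = y * k\<^sup>2" using arc2_Y[OF r] by (simp add: arc2_def y_def k_def)
  have kk: "2 * y * k' = K - k" using kappa_deriv[OF y] by (simp add: k_def K_def k'_def)
  have K': "K' = K / 2 * (8 * W / N - D' / D)"
    using speed_deriv[OF y] by (simp add: K_def K'_def N_def D_def D'_def W_def)
  have W2: "1 - W\<^sup>2 = N / 4" by (simp add: W_def N_def power2_eq_square algebra_simps)
  have K2: "K\<^sup>2 = 16 / lam\<^sup>2 * (N / D)" using speed_square[OF y] by (simp add: K_def N_def D_def)
  have D: "D + y * D' = 4 * W * N"
    by (simp add: W_def N_def D_def D'_def power2_eq_square algebra_simps)
  have c: "cfun y = 4 / (lam\<^sup>2 * k * K)" by (simp add: cfun_def k_def K_def field_simps)
  have c': "deriv cfun y = - cfun y * (k' / k + K' / K)"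
    using cfun_deriv[OF y] by (simp add: k_def K_def k'_def K'_def)
  have q: "lam\<^sup>2 * cfun y / 4 = 1 / (k * K)" using lam_pos by (simp add: c)
  have "2 * r * (deriv cfun y * (lam\<^sup>2 * cfun y / 4) + cfun y * W * (lam\<^sup>2 * cfun y / 4) / (1 - W\<^sup>2)) + cfun y
      = cfun y * (k / K) * (- (2 * y * k') / k - 2 * y * (K' / K) + 8 * y * W / N + K / k)"
    unfolding q c' W2 rk using pos by (simp add: field_simps power2_eq_square)
  also have "\<dots> = cfun y * (k / K) * (1 + y * D' / D)"
    unfolding kk K' using pos by (simp add: field_simps)
  also have "1 + y * D' / D = 4 * W * N / D"
    unfolding D[symmetric] using pos by (simp add: field_simps)
  also have "cfun y * (k / K) * (4 * W * N / D) = W * (16 / lam\<^sup>2 * (N / D)) / K\<^sup>2"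
    using pos lam_pos by (simp add: c field_simps power2_eq_square)
  also have "\<dots> = W" unfolding K2[symmetric] using pos by simp
  finally show ?thesis .
qed

lemma arc2_0: "arc2 0 = 0" by (simp add: arc2_def)

lemma Y_0: "Y 0 = 0" using Y_arc2[of 0] by (simp add: arc2_0)

text \<open>The condition for the circle to collapse smoothly: it makes 2 c - 1 divisible by |z|^2
  (see \<open>mfun\<close>), so that the coframe extends over z = 0.\<close>

lemma cfun_0: "2 * cfun 0 = 1"
proof -
  have "kappa 0 = speed 0" using kappa_deriv[of 0] by simp
  then have "cfun 0 = 4 / lam\<^sup>2 * inverse ((speed 0)\<^sup>2)" by (simp add: cfun_def power2_eq_square)
  also have "\<dots> = 1 / 2" using lam_pos by (simp add: speed_square)
  finally show ?thesis by simp
qed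

section \<open>Arc length as a function of the angle, and the reflection\<close>

definition arc :: "real \<Rightarrow> real" where "arc \<theta> = sin (\<theta> / 2) * kappa ((sin (\<theta> / 2))\<^sup>2)"

text \<open>Half the distance between the singular orbits, taken at the midpoint because at theta =
  pi the argument of \<open>kappa\<close> would be 1, outside \<open>U\<close>.\<close>

definition "T = arc (pi / 2)"

lemma sin_half_mem: "\<theta> \<in> {-pi<..<pi} \<Longrightarrow> (sin (\<theta> / 2))\<^sup>2 \<in> U"
proof -
  assume "\<theta> \<in> {-pi<..<pi}"
  then have "0 < cos (\<theta> / 2)" by (intro cos_gt_zero_pi) auto
  then have "0 < (cos (\<theta> / 2))\<^sup>2" by simp
  then have "(sin (\<theta> / 2))\<^sup>2 < 1" using sin_cos_squared_add[of "\<theta> / 2"] by linarith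
  then show ?thesis by (auto intro: less_le_trans[of _ 0])
qed

lemma arc2_arc: "arc2 ((sin (\<theta> / 2))\<^sup>2) = (arc \<theta>)\<^sup>2"
  by (simp add: arc2_def arc_def power_mult_distrib)

lemma arc_deriv:
  assumes th: "\<theta> \<in> {-pi<..<pi}"
  shows "(arc has_real_derivative 2 / lam * sqrt ((4 - (cos \<theta>)\<^sup>2) / (7 - (cos \<theta>)\<^sup>2))) (at \<theta>)"
proof -
  define x y where "x = sin (\<theta> / 2)" and "y = x\<^sup>2"
  have y: "y \<in> U" unfolding y_def x_def by (rule sin_half_mem[OF th])
  have cp: "0 < cos (\<theta> / 2)" using th by (intro cos_gt_zero_pi) auto
  have d: "((\<lambda>\<theta>. (sin (\<theta> / 2))\<^sup>2) has_real_derivative x * cos (\<theta> / 2)) (at \<theta>)"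
    by (auto intro!: derivative_eq_intros simp: x_def)
  have "(kappa has_real_derivative deriv kappa y) (at ((sin (\<theta> / 2))\<^sup>2))"
    using smooth_fun_deriv(2)[OF kappa_smooth y] by (simp add: y_def x_def)
  from DERIV_chain2[where g = "\<lambda>\<theta>. (sin (\<theta> / 2))\<^sup>2", OF this d]
  have "((\<lambda>\<theta>. kappa ((sin (\<theta> / 2))\<^sup>2)) has_real_derivative deriv kappa y * (x * cos (\<theta> / 2))) (at \<theta>)" .
  then have "(arc has_real_derivative cos (\<theta> / 2) / 2 * kappa y + deriv kappa y * (x * cos (\<theta> / 2)) * x) (at \<theta>)"
    unfolding arc_def by (auto intro!: derivative_eq_intros simp: y_def x_def)
  also have "cos (\<theta> / 2) / 2 * kappa y + deriv kappa y * (x * cos (\<theta> / 2)) * x = cos (\<theta> / 2) / 2 * speed y"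
    unfolding kappa_deriv[OF y, symmetric] by (simp add: y_def algebra_simps power2_eq_square)
  also have "cos (\<theta> / 2) / 2 * speed y = 2 / lam * sqrt ((4 - (cos \<theta>)\<^sup>2) / (7 - (cos \<theta>)\<^sup>2))"
  proof -
    have ct: "cos \<theta> = 1 - 2 * y" using cos_double_sin[of "\<theta> / 2"] by (simp add: y_def x_def)
    have c2: "1 - y = (cos (\<theta> / 2))\<^sup>2" by (simp add: y_def x_def cos_squared_eq)
    have e: "3 + 4 * y - 4 * y\<^sup>2 = 4 - (cos \<theta>)\<^sup>2" "6 + 4 * y - 4 * y\<^sup>2 = 7 - (cos \<theta>)\<^sup>2"
      by (simp_all add: ct power2_eq_square algebra_simps)
    have "speed y = 4 / lam * (sqrt ((4 - (cos \<theta>)\<^sup>2) / (7 - (cos \<theta>)\<^sup>2)) / cos (\<theta> / 2))"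
      unfolding speed_def e c2 using cp by (simp add: real_sqrt_divide real_sqrt_mult)
    then show ?thesis using cp by simp
  qed
  finally show ?thesis .
qed

lemma arc_continuous: "continuous_on {-pi<..<pi} arc"
  by (intro continuous_at_imp_continuous_on ballI DERIV_isCont[OF arc_deriv])

text \<open>The integrand depends on cos^2 theta only, so the sum has derivative zero; its value is
  read off at pi/2.\<close>

lemma arc_symmetric:
  assumes "\<theta> \<in> {0<..<pi}"
  shows "arc \<theta> + arc (pi - \<theta>) = 2 * T"
proof -
  have "\<exists>c. \<forall>\<theta>\<in>{0<..<pi}. arc \<theta> + arc (pi - \<theta>) = c"
  proof (rule has_field_derivative_zero_constant)
    fix \<theta> :: real assume th: "\<theta> \<in> {0<..<pi}"
    let ?g = "\<lambda>\<theta>. 2 / lam * sqrt ((4 - (cos \<theta>)\<^sup>2) / (7 - (cos \<theta>)\<^sup>2))"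
    have "((\<lambda>\<theta>. arc (pi - \<theta>)) has_real_derivative ?g (pi - \<theta>) * (- 1)) (at \<theta>)"
      by (rule DERIV_chain2[where g = "\<lambda>\<theta>. pi - \<theta>", OF arc_deriv])
        (use th in \<open>auto intro!: derivative_eq_intros\<close>)
    from DERIV_add[OF arc_deriv this]
    have "((\<lambda>\<theta>. arc \<theta> + arc (pi - \<theta>)) has_real_derivative 0) (at \<theta>)"
      using th by simp
    then show "((\<lambda>\<theta>. arc \<theta> + arc (pi - \<theta>)) has_real_derivative 0) (at \<theta> within {0<..<pi})"
      by (rule has_field_derivative_at_within)
  qed auto
  then obtain c where c: "\<And>\<theta>. \<theta> \<in> {0<..<pi} \<Longrightarrow> arc \<theta> + arc (pi - \<theta>) = c" by blast
  from c[of "pi / 2"] c[OF assms] show ?thesis by (simp add: T_def)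
qed

lemma arc_0: "arc 0 = 0" by (simp add: arc_def)

lemma arc_pos: "\<theta> \<in> {0<..<pi} \<Longrightarrow> 0 < arc \<theta>"
  unfolding arc_def using kappa_pos[OF sin_half_mem, of \<theta>] sin_gt_zero[of "\<theta> / 2"] by auto

lemma arc_onto:
  assumes "0 \<le> t" "t < 2 * T"
  obtains \<theta> where "0 \<le> \<theta>" "\<theta> < pi" "arc \<theta> = t"
proof -
  have low: "\<exists>\<theta>. 0 \<le> \<theta> \<and> \<theta> \<le> pi / 2 \<and> arc \<theta> = t" if "0 \<le> t" "t \<le> T" for t
  proof (rule IVT')
    show "continuous_on {0..pi / 2} arc"
      by (rule continuous_on_subset[OF arc_continuous]) (use pi_gt_zero in \<open>auto simp del: pi_gt_zero\<close>)
  qed (use that in \<open>auto simp: arc_0 T_def\<close>)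
  show ?thesis
  proof (cases "t \<le> T")
    case True
    then obtain \<theta> where "0 \<le> \<theta>" "\<theta> \<le> pi / 2" "arc \<theta> = t" using low[of t] assms by blast
    then show ?thesis using that[of \<theta>] pi_gt_zero by linarith
  next
    case False
    then obtain \<theta> where th: "0 \<le> \<theta>" "\<theta> \<le> pi / 2" "arc \<theta> = 2 * T - t"
      using low[of "2 * T - t"] assms by auto
    then have "\<theta> \<noteq> 0" using assms by (auto simp: arc_0)
    then show ?thesis using arc_symmetric[of \<theta>] th that[of "pi - \<theta>"] by auto
  qed
qed

lemma square_mem_J: "0 \<le> t \<Longrightarrow> t < 2 * T \<Longrightarrow> t\<^sup>2 \<in> J"
  by (erule (1) arc_onto) (auto simp: J_def simp flip: arc2_arc intro!: imageI sin_half_mem)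

lemma Y_arc: "0 \<le> \<theta> \<Longrightarrow> \<theta> < pi \<Longrightarrow> Y ((arc \<theta>)\<^sup>2) = (sin (\<theta> / 2))\<^sup>2"
  by (subst arc2_arc[symmetric], rule Y_arc2, rule sin_half_mem) auto

lemma Y_symmetric:
  assumes "0 < t" "t < 2 * T"
  shows "Y ((2 * T - t)\<^sup>2) = 1 - Y (t\<^sup>2)"
proof -
  obtain \<theta> where th: "0 \<le> \<theta>" "\<theta> < pi" "arc \<theta> = t" using arc_onto assms by (metis less_imp_le)
  then have "\<theta> \<noteq> 0" using assms by (auto simp: arc_0)
  then have "2 * T - t = arc (pi - \<theta>)" using arc_symmetric[of \<theta>] th by auto
  then have "Y ((2 * T - t)\<^sup>2) = (sin ((pi - \<theta>) / 2))\<^sup>2"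
    using Y_arc[of "pi - \<theta>"] th \<open>\<theta> \<noteq> 0\<close> by simp
  also have "sin ((pi - \<theta>) / 2) = cos (\<theta> / 2)" by (simp add: sin_diff diff_divide_distrib)
  finally show ?thesis using Y_arc[OF th(1,2)] th(3) by (simp add: cos_squared_eq)
qed

lemma Y_bounds:
  assumes "0 < t" "t < 2 * T"
  shows "0 < Y (t\<^sup>2)" "Y (t\<^sup>2) < 1"
proof -
  have *: "0 \<le> Y (t\<^sup>2)" "Y (t\<^sup>2) < 1" if t: "0 < t" "t < 2 * T" for t
  proof -
    obtain \<theta> where th: "0 \<le> \<theta>" "\<theta> < pi" "arc \<theta> = t" using arc_onto t by (metis less_imp_le)
    show "0 \<le> Y (t\<^sup>2)" using Y_arc[OF th(1,2)] th(3) by simp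
    show "Y (t\<^sup>2) < 1" using Y_mem[OF square_mem_J] t by auto
  qed
  show "Y (t\<^sup>2) < 1" using * assms by blast
  \<comment> \<open>Positivity is the upper bound Y < 1 at the reflected time.\<close>
  show "0 < Y (t\<^sup>2)" using *[of "2 * T - t"] Y_symmetric[OF assms] assms by simp
qed

text \<open>The energy integral lambda^2 (C S)^2 = (1/4 - W^2) (7/4 - W^2), solved for C = t * cfun.
  It is needed because the right-hand side is visibly invariant under y -> 1 - y, while
  \<open>cfun\<close> itself is not.\<close>

lemma first_integral:
  assumes "0 \<le> t" "t < 2 * T"
  defines "y \<equiv> Y (t\<^sup>2)"
  shows "t * cfun y = 1 / lam * sqrt (y * (1 - y) * (6 + 4 * y - 4 * y\<^sup>2) / (3 + 4 * y - 4 * y\<^sup>2))"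
proof -
  have m: "t\<^sup>2 \<in> J" by (rule square_mem_J[OF assms(1,2)])
  have y: "y \<in> U" unfolding y_def by (rule Y_mem[OF m])
  have y0: "0 \<le> y"
    using Y_bounds[of t] assms Y_0 by (cases "t = 0") (auto simp: y_def)
  have k: "0 < kappa y" and K: "0 < speed y" using kappa_pos speed_pos y by auto
  have "t\<^sup>2 = y * (kappa y)\<^sup>2" using arc2_Y[OF m] by (simp add: arc2_def y_def)
  then have "sqrt (t\<^sup>2) = sqrt (y * (kappa y)\<^sup>2)" by (rule arg_cong)
  then have t: "t = sqrt y * kappa y" using assms(1) k by (simp add: real_sqrt_mult)
  have "t * cfun y = 4 / lam\<^sup>2 * (sqrt y / speed y)"
    using k K by (simp add: t cfun_def field_simps)
  also have "\<dots> = 1 / lam * (sqrt y / sqrt ((3 + 4 * y - 4 * y\<^sup>2) / ((6 + 4 * y - 4 * y\<^sup>2) * (1 - y))))"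
    using lam_pos by (simp add: speed_def power2_eq_square field_simps)
  also have "\<dots> = 1 / lam * sqrt (y / ((3 + 4 * y - 4 * y\<^sup>2) / ((6 + 4 * y - 4 * y\<^sup>2) * (1 - y))))"
    by (simp only: real_sqrt_divide)
  finally show ?thesis by (simp add: ac_simps)
qed

lemma T_pos: "0 < T"
  unfolding T_def by (rule arc_pos) (auto simp: pi_gt_zero)

end

section \<open>The value of T\<close>

lemma cos_multiples:
  fixes \<theta> :: real
  defines "X \<equiv> cos (2 * \<theta>)"
  shows "cos (4 * \<theta>) = 2 * X ^ 2 - 1" "cos (6 * \<theta>) = 4 * X ^ 3 - 3 * X"
    "cos (8 * \<theta>) = 8 * X ^ 4 - 8 * X ^ 2 + 1"
    "cos (10 * \<theta>) = 16 * X ^ 5 - 20 * X ^ 3 + 5 * X"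
    "cos (12 * \<theta>) = 32 * X ^ 6 - 48 * X ^ 4 + 18 * X ^ 2 - 1"
proof -
  have step: "cos (a + 2 * \<theta>) = 2 * X * cos a - cos (a - 2 * \<theta>)" for a
    by (simp add: X_def cos_add cos_diff)
  show c4: "cos (4 * \<theta>) = 2 * X ^ 2 - 1"
    using step[of "2 * \<theta>"] by (simp add: X_def power2_eq_square)
  show c6: "cos (6 * \<theta>) = 4 * X ^ 3 - 3 * X"
    using step[of "4 * \<theta>"] unfolding c4 by (simp add: X_def algebra_simps eval_nat_numeral)
  show c8: "cos (8 * \<theta>) = 8 * X ^ 4 - 8 * X ^ 2 + 1"
    using step[of "6 * \<theta>"] c4 unfolding c6 by (simp add: algebra_simps eval_nat_numeral)
  show c10: "cos (10 * \<theta>) = 16 * X ^ 5 - 20 * X ^ 3 + 5 * X"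
    using step[of "8 * \<theta>"] c6 unfolding c8 by (simp add: algebra_simps eval_nat_numeral)
  show "cos (12 * \<theta>) = 32 * X ^ 6 - 48 * X ^ 4 + 18 * X ^ 2 - 1"
    using step[of "10 * \<theta>"] c8 unfolding c10 by (simp add: algebra_simps eval_nat_numeral)
qed

text \<open>The coefficients come from the Chebyshev expansion of the square root on \<open>[-1, 1]\<close>.\<close>

lemma chebyshev_approximation:
  fixes X :: real
  defines "p \<equiv> (7337993857 * X ^ 0 + (-241911916) * X ^ 1 + (-22596172) * X ^ 2 + (-2176120) * X ^ 3
    + (-216616) * X ^ 4 + (-22784) * X ^ 5 + (-2432) * X ^ 6) / 10 ^ 10"
  assumes "\<bar>X\<bar> \<le> 1"
  shows "\<bar>sqrt ((7 - X) / (13 - X)) - p\<bar> \<le> (3.5 / 10 ^ 7)"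
proof -
  have X: "-1 \<le> X" "X \<le> 1" using assms by auto
  have b: "- a \<le> a * X ^ n" "a * X ^ n \<le> a" if "0 \<le> a" for a :: real and n
  proof -
    have "\<bar>X ^ n\<bar> \<le> 1" using assms by (simp add: power_abs power_le_one)
    then have "\<bar>a * X ^ n\<bar> \<le> a" using that by (simp add: abs_mult mult_left_le)
    then show "- a \<le> a * X ^ n" "a * X ^ n \<le> a" by auto
  qed
  \<comment> \<open>The residual is a polynomial in X, and |X| <= 1 bounds it by the sum of the
    moduli of its coefficients.\<close>
  have R: "(7 - X) - p\<^sup>2 * (13 - X) = (10193426163 * X ^ 0 + 5837490336761 * X ^ 1 + 671098116752 * X ^ 2 + (-45897390598264) * X ^ 3
      + (-1239230583376) * X ^ 4 + 90378796043392 * X ^ 5 + 638042310144 * X ^ 6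
      + (-51081804574336) * X ^ 7 + (-178805461952) * X ^ 8 + (-9928564160) * X ^ 9
      + 9904128 * X ^ 10 + 132052992 * X ^ 11 + 33931264 * X ^ 12 + 5914624 * X ^ 13) / 10 ^ 20"
    unfolding p_def by (simp add: field_simps eval_nat_numeral)
  have "\<bar>(7 - X) - p\<^sup>2 * (13 - X)\<bar> \<le> 2.5 / 10 ^ 6"
    unfolding R abs_le_iff using b[of 10193426163 0]
      b[of 5837490336761 1]
      b[of 671098116752 2]
      b[of 45897390598264 3]
      b[of 1239230583376 4]
      b[of 90378796043392 5]
      b[of 638042310144 6]
      b[of 51081804574336 7]
      b[of 178805461952 8]
      b[of 9928564160 9]
      b[of 9904128 10]
      b[of 132052992 11]
      b[of 33931264 12]
      b[of 5914624 13]
    by (simp add: field_simps)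
  moreover have p: "0.6 \<le> p"
    unfolding p_def using b[of 7337993857 0]
      b[of 241911916 1]
      b[of 22596172 2]
      b[of 2176120 3]
      b[of 216616 4]
      b[of 22784 5]
      b[of 2432 6] by (simp add: field_simps)
  define s where "s = sqrt ((7 - X) / (13 - X))"
  have s: "0 \<le> s" "s\<^sup>2 * (13 - X) = 7 - X" using X by (auto simp: s_def)
  \<comment> \<open>The residual contains the factor s - p. The other factor is at least 0.6 * 12 =
    7.2, and 2.5 / 7.2 < 0.35.\<close>
  have "(7 - X) - p\<^sup>2 * (13 - X) = (s - p) * ((s + p) * (13 - X))"
    unfolding s(2)[symmetric] by (simp add: algebra_simps power2_eq_square)
  ultimately have "\<bar>s - p\<bar> * \<bar>(s + p) * (13 - X)\<bar> \<le> 2.5 / 10 ^ 6" by (simp add: abs_mult)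
  moreover have "\<bar>s - p\<bar> * 7.2 \<le> \<bar>s - p\<bar> * \<bar>(s + p) * (13 - X)\<bar>"
  proof (rule mult_left_mono)
    have "0.6 * 12 \<le> (s + p) * (13 - X)" using s p X by (intro mult_mono) auto
    then show "7.2 \<le> \<bar>(s + p) * (13 - X)\<bar>" by simp
  qed simp
  ultimately show ?thesis unfolding s_def by simp
qed

lemma sqrt_5_bounds: "2.2360679774 \<le> sqrt 5" "sqrt 5 \<le> 2.2360679775"
  by (rule real_le_rsqrt, simp add: power2_eq_square)
    (rule real_le_lsqrt, simp_all add: power2_eq_square)

lemma T_bounds:
  assumes "lam = 6 / sqrt 5"
  shows "\<bar>scale.T lam - 0.8578017401911906\<bar> \<le> 5 / 10 ^ 7"
proof -
  interpret scale lam by unfold_locales (simp add: assms)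
  \<comment> \<open>The approximating polynomial in Fourier form, integrated: the k-th Chebyshev
    polynomial of cos (2 theta) is cos (2 k theta). At pi/2 all the sines vanish, so only the mean
    value 0.7326613780 contributes to T.\<close>
  define A where "A \<theta> = 2 / lam * ((7326613780 * \<theta> + (-243558246) * (sin (2 * \<theta>) / 2)
      + (-11407534) * (sin (4 * \<theta>) / 4) + (-551150) * (sin (6 * \<theta>) / 6)
      + (-27533) * (sin (8 * \<theta>) / 8) + (-1424) * (sin (10 * \<theta>) / 10)
      + (-76) * (sin (12 * \<theta>) / 12)) / 10 ^ 10)" for \<theta> :: real
  define G where "G \<theta> = (7326613780 + (-243558246) * cos (2 * \<theta>) + (-11407534) * cos (4 * \<theta>)
      + (-551150) * cos (6 * \<theta>) + (-27533) * cos (8 * \<theta>) + (-1424) * cos (10 * \<theta>)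
      + (-76) * cos (12 * \<theta>)) / 10 ^ 10" for \<theta> :: real
  have dA: "(A has_real_derivative 2 / lam * G \<theta>) (at \<theta>)" for \<theta>
    unfolding A_def G_def by (intro DERIV_cmult DERIV_cdivide) (auto intro!: derivative_eq_intros)
  have bound: "norm (2 / lam * sqrt ((4 - (cos \<theta>)\<^sup>2) / (7 - (cos \<theta>)\<^sup>2)) - 2 / lam * G \<theta>)
      \<le> 2 / lam * (3.5 / 10 ^ 7)" for \<theta>
  proof -
    define X where "X = cos (2 * \<theta>)"
    have "(cos \<theta>)\<^sup>2 = (1 + X) / 2" unfolding X_def cos_double_cos by simp
    then have "4 - (cos \<theta>)\<^sup>2 = (7 - X) / 2" "7 - (cos \<theta>)\<^sup>2 = (13 - X) / 2"
      by (simp_all add: field_simps)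
    then have e: "(4 - (cos \<theta>)\<^sup>2) / (7 - (cos \<theta>)\<^sup>2) = (7 - X) / (13 - X)"
      by (simp only: divide_divide_eq_right)
    have t: "G \<theta> = (7337993857 * X ^ 0 + (-241911916) * X ^ 1 + (-22596172) * X ^ 2 + (-2176120) * X ^ 3
      + (-216616) * X ^ 4 + (-22784) * X ^ 5 + (-2432) * X ^ 6) / 10 ^ 10"
      unfolding G_def cos_multiples X_def[symmetric] by (simp add: algebra_simps)
    have scale: "norm (2 / lam * u - 2 / lam * w) \<le> 2 / lam * \<epsilon>" if "\<bar>u - w\<bar> \<le> \<epsilon>" for u w \<epsilon>
    proof -
      have "norm (2 / lam * u - 2 / lam * w) = 2 / lam * \<bar>u - w\<bar>"
        using lam_pos by (simp add: right_diff_distrib[symmetric] abs_mult del: times_divide_eq_left)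
      then show ?thesis using that lam_pos by (simp add: divide_right_mono)
    qed
    show ?thesis
      unfolding e t by (rule scale, rule chebyshev_approximation) (simp add: X_def)
  qed
  have "norm ((\<lambda>\<theta>. arc \<theta> - A \<theta>) (pi / 2) - (\<lambda>\<theta>. arc \<theta> - A \<theta>) 0) \<le> 2 / lam * (3.5 / 10 ^ 7) * norm (pi / 2 - 0)"
  proof (rule field_differentiable_bound[of "{0..pi / 2}"])
    fix \<theta> assume "\<theta> \<in> {0..pi / 2}"
    then have "\<theta> \<in> {-pi<..<pi}" using pi_gt_zero by (auto simp del: pi_gt_zero)
    from DERIV_diff[OF arc_deriv[OF this] dA]
    show "((\<lambda>\<theta>. arc \<theta> - A \<theta>) has_real_derivative 2 / lam * sqrt ((4 - (cos \<theta>)\<^sup>2) / (7 - (cos \<theta>)\<^sup>2))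
        - 2 / lam * G \<theta>) (at \<theta> within {0..pi / 2})"
      by (rule has_field_derivative_at_within)
    show "norm (2 / lam * sqrt ((4 - (cos \<theta>)\<^sup>2) / (7 - (cos \<theta>)\<^sup>2)) - 2 / lam * G \<theta>)
      \<le> 2 / lam * (3.5 / 10 ^ 7)" by (rule bound)
  qed (use pi_gt_zero in \<open>auto simp del: pi_gt_zero\<close>)
  moreover have "A (pi / 2) = 2 / lam * (7326613780 * (pi / 2) / 10 ^ 10)"
  proof -
    have "sin (real n * pi) = 0" for n by (rule sin_npi)
    from this[of 1] this[of 2] this[of 3] this[of 4] this[of 5] this[of 6]
    show ?thesis unfolding A_def by simp
  qed
  moreover have "A 0 = 0" by (simp add: A_def)
  ultimately have main: "\<bar>T - 2 / lam * (7326613780 * (pi / 2) / 10 ^ 10)\<bar> \<le> 2 / lam * (3.5 / 10 ^ 7) * (pi / 2)"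
    by (simp add: T_def arc_0)
  define v where "v = sqrt 5 * pi"
  have v: "2.2360679774 * 3.141592653588 \<le> v" "v \<le> 2.2360679775 * 3.1415926535899"
    unfolding v_def using mult_mono[OF sqrt_5_bounds(1) pi_approx(1)] mult_mono[OF sqrt_5_bounds(2) pi_approx(2)] by simp_all
  have e: "2 / lam * (pi / 2) = v / 6"
    by (simp add: assms v_def)
  have e': "2 / lam * (7326613780 * (pi / 2) / 10 ^ 10) = 7326613780 / 10 ^ 10 * (v / 6)"
    "2 / lam * (3.5 / 10 ^ 7) * (pi / 2) = 3.5 / 10 ^ 7 * (v / 6)"
    unfolding e[symmetric] by simp_all
  from main have "\<bar>T - 7326613780 / 10 ^ 10 * (v / 6)\<bar> \<le> 3.5 / 10 ^ 7 * (v / 6)"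
    unfolding e' .
  with v show ?thesis unfolding abs_le_iff by (auto simp: field_simps)
qed

section \<open>The standard forms in complex coordinates\<close>

type_synonym triple = "complex \<times> complex \<times> complex"
type_synonym covec7 = "real \<times> triple"

text \<open>The splitting R^7 = R + C^3 with its group SU(3) inside G_2: \<open>kform\<close> is the
  Kaehler form omega of C^3, and \<open>vform\<close> the complex volume form Omega.\<close>

fun kform :: "triple \<Rightarrow> triple \<Rightarrow> real" where
  "kform (z, g, f) (z', g', f') = Im (cnj z * z') + Im (cnj g * g') + Im (cnj f * f')"

fun vform :: "triple \<Rightarrow> triple \<Rightarrow> triple \<Rightarrow> complex" where
  "vform (z1, g1, f1) (z2, g2, f2) (z3, g3, f3) =
     z1 * (g2 * f3 - g3 * f2) - z2 * (g1 * f3 - g3 * f1) + z3 * (g1 * f2 - g2 * f1)"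

definition pack :: "covec7 \<Rightarrow> real^7" where
  "pack a = (case a of (h, z, g, f) \<Rightarrow>
     \<chi> i. if i = 1 then h else if i = 2 then Re z else if i = 3 then Im z else if i = 4 then Re g
         else if i = 5 then Im g else if i = 6 then Re f else Im f)"

lemma exhaust_7:
  fixes x :: 7
  shows "x = 1 \<or> x = 2 \<or> x = 3 \<or> x = 4 \<or> x = 5 \<or> x = 6 \<or> x = 7"
proof (induct x)
  case (of_int z)
  then have "z = 0 \<or> z = 1 \<or> z = 2 \<or> z = 3 \<or> z = 4 \<or> z = 5 \<or> z = 6" by fastforce
  then show ?case by auto
qed

lemma forall_7: "(\<forall>i::7. P i) \<longleftrightarrow> P 1 \<and> P 2 \<and> P 3 \<and> P 4 \<and> P 5 \<and> P 6 \<and> P 7"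
  by (metis exhaust_7)

lemma pack_nth [simp]:
  "pack (h, z, g, f) $ 1 = h" "pack (h, z, g, f) $ 2 = Re z" "pack (h, z, g, f) $ 3 = Im z"
  "pack (h, z, g, f) $ 4 = Re g" "pack (h, z, g, f) $ 5 = Im g" "pack (h, z, g, f) $ 6 = Re f"
  "pack (h, z, g, f) $ 7 = Im f"
  by (simp_all add: pack_def)

lemma pack_linear: "linear pack"
  by (rule linearI) (auto simp: vec_eq_iff forall_7)

lemma pack_onto: "\<exists>h z g f. x = pack (h, z, g, f)"
proof (intro exI)
  show "x = pack (x $ 1, Complex (x $ 2) (x $ 3), Complex (x $ 4) (x $ 5), Complex (x $ 6) (x $ 7))"
    by (simp add: vec_eq_iff forall_7)
qed

text \<open>Here phi is h wedge omega + Re Omega; correspondingly its dual in the next lemma is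
  omega^2 / 2 - h wedge Im Omega.\<close>

lemma phi0_pack:
  "phi0 (pack (h1, u1)) (pack (h2, u2)) (pack (h3, u3)) =
     h1 * kform u2 u3 - h2 * kform u1 u3 + h3 * kform u1 u2 + Re (vform u1 u2 u3)"
  by (cases u1; cases u2; cases u3) (simp add: phi0_def wedge3_def algebra_simps)

lemma psi0_pack:
  "psi0 (pack (h0, u0)) (pack (h1, u1)) (pack (h2, u2)) (pack (h3, u3)) =
     kform u0 u1 * kform u2 u3 - kform u0 u2 * kform u1 u3 + kform u0 u3 * kform u1 u2
     - (h0 * Im (vform u1 u2 u3) - h1 * Im (vform u0 u2 u3) + h2 * Im (vform u0 u1 u3) - h3 * Im (vform u0 u1 u2))"
  by (cases u0; cases u1; cases u2; cases u3) (simp add: psi0_def wedge3_def wedge4_def algebra_simps)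

lemma phi0_linear: "linear (\<lambda>x. phi0 x v w)" "linear (\<lambda>x. phi0 u x w)" "linear (\<lambda>x. phi0 u v x)"
  by (rule linearI; simp add: phi0_def wedge3_def algebra_simps)+

lemma phi0_swap: "phi0 v u w = - phi0 u v w" "phi0 u w v = - phi0 u v w"
  by (simp_all add: phi0_def wedge3_def algebra_simps)

lemma phi0_same: "phi0 u u v = 0" "phi0 u v v = 0" "phi0 u v u = 0"
  by (simp_all add: phi0_def wedge3_def algebra_simps)

lemmas phi0_simps =
  linear_add[OF phi0_linear(1)] linear_add[OF phi0_linear(2)] linear_add[OF phi0_linear(3)]
  linear_diff[OF phi0_linear(1)] linear_diff[OF phi0_linear(2)] linear_diff[OF phi0_linear(3)]

lemma DERIV_wedge3:
  fixes A B C :: "real \<Rightarrow> real^'n"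
  assumes "(A has_vector_derivative A') (at s)" "(B has_vector_derivative B') (at s)"
    "(C has_vector_derivative C') (at s)"
  shows "((\<lambda>s. wedge3 (\<lambda>x. x $ i) (\<lambda>x. x $ j) (\<lambda>x. x $ k) (A s) (B s) (C s)) has_real_derivative
    wedge3 (\<lambda>x. x $ i) (\<lambda>x. x $ j) (\<lambda>x. x $ k) A' (B s) (C s)
    + wedge3 (\<lambda>x. x $ i) (\<lambda>x. x $ j) (\<lambda>x. x $ k) (A s) B' (C s)
    + wedge3 (\<lambda>x. x $ i) (\<lambda>x. x $ j) (\<lambda>x. x $ k) (A s) (B s) C') (at s)"
proof -
  have n: "((\<lambda>s. D s $ i) has_real_derivative D' $ i) (at s)"
    if "(D has_vector_derivative D') (at s)" for D :: "real \<Rightarrow> real^'n" and D' i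
    using bounded_linear.has_vector_derivative[OF bounded_linear_vec_nth that]
    by (simp add: has_real_derivative_iff_has_vector_derivative)
  show ?thesis
    unfolding wedge3_def
    by (rule DERIV_cong, (rule DERIV_add DERIV_diff DERIV_mult n[OF assms(1)] n[OF assms(2)] n[OF assms(3)])+)
      (simp add: algebra_simps)
qed

lemma DERIV_phi0:
  assumes "(A has_vector_derivative A') (at s)" "(B has_vector_derivative B') (at s)"
    "(C has_vector_derivative C') (at s)"
  shows "((\<lambda>s. phi0 (A s) (B s) (C s)) has_real_derivative
    phi0 A' (B s) (C s) + phi0 (A s) B' (C s) + phi0 (A s) (B s) C') (at s)"
  unfolding phi0_def Let_def
  by (rule DERIV_cong, (rule DERIV_add DERIV_diff DERIV_wedge3[OF assms])+) simp

lemma smooth_fun_phi0: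
  assumes "\<And>i. smooth_fun (\<lambda>x. A x $ i) U" "\<And>i. smooth_fun (\<lambda>x. B x $ i) U"
    "\<And>i. smooth_fun (\<lambda>x. C x $ i) U"
  shows "smooth_fun (\<lambda>x. phi0 (A x) (B x) (C x)) U"
  unfolding phi0_def Let_def wedge3_def
  by (intro smooth_fun_add smooth_fun_diff smooth_fun_mult assms)

text \<open>Here \<open>d i j\<close> are the values of the exterior derivatives of the three complex covectors on the
  \<open>i\<close>-th and \<open>j\<close>-th vector, with connection forms \<open>\<theta>\<close>, \<open>\<sigma>\<close>, \<open>\<rho>\<close>.  The terms with \<open>p\<close> and
  \<open>q\<close> drop out of \<open>d vform\<close>; in \<open>d kform\<close> they cancel the real parts of \<open>\<sigma>\<close> and \<open>\<rho>\<close>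
  (lemma \<open>kform_closing\<close>).\<close>

lemma vform_closing:
  fixes Z G F cG cF \<theta> \<sigma> \<rho> :: "nat \<Rightarrow> complex" and p q :: complex
  defines "d \<equiv> \<lambda>i j. (\<theta> i * Z j - \<theta> j * Z i + p * (cG i * G j - cG j * G i) + q * (cF i * F j - cF j * F i),
      \<sigma> i * G j - \<sigma> j * G i, \<rho> i * F j - \<rho> j * F i)"
    and "u \<equiv> \<lambda>i. (Z i, G i, F i)" and "t \<equiv> \<lambda>i. \<theta> i + \<sigma> i + \<rho> i"
  shows "vform (d 0 1) (u 2) (u 3) - vform (d 0 2) (u 1) (u 3) + vform (d 0 3) (u 1) (u 2)
    + vform (d 1 2) (u 0) (u 3) - vform (d 1 3) (u 0) (u 2) + vform (d 2 3) (u 0) (u 1)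
    = t 0 * vform (u 1) (u 2) (u 3) - t 1 * vform (u 0) (u 2) (u 3)
      + t 2 * vform (u 0) (u 1) (u 3) - t 3 * vform (u 0) (u 1) (u 2)"
  unfolding d_def u_def t_def vform.simps by algebra

text \<open>The sum is Z wedge Z wedge G wedge F. So a multiple of Z in the total connection form
  does not affect d Omega, which disposes of the last term of
  \<open>total_connection\<close>.\<close>

lemma vform_dependent:
  fixes Z G F :: "nat \<Rightarrow> complex"
  defines "u \<equiv> \<lambda>i. (Z i, G i, F i)"
  shows "Z 0 * vform (u 1) (u 2) (u 3) - Z 1 * vform (u 0) (u 2) (u 3)
      + Z 2 * vform (u 0) (u 1) (u 3) - Z 3 * vform (u 0) (u 1) (u 2) = 0"
  unfolding u_def vform.simps by algebra

lemma kform_closing: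
  fixes Z G F :: "nat \<Rightarrow> complex" and \<beta> e1 e2 :: "nat \<Rightarrow> real" and \<kappa> \<gamma>1 \<gamma>2 :: real and z :: complex
  defines "\<theta> \<equiv> \<lambda>i. - \<i> * \<beta> i + \<kappa> * z * cnj (Z i)"
    and "\<sigma> \<equiv> \<lambda>i. \<gamma>1 * Re (cnj z * Z i) - \<i> * e1 i"
    and "\<rho> \<equiv> \<lambda>i. - \<gamma>2 * Re (cnj z * Z i) + \<i> * e2 i"
  defines "d \<equiv> \<lambda>i j. (\<theta> i * Z j - \<theta> j * Z i
      + \<gamma>1 * z * (cnj (G i) * G j - cnj (G j) * G i) + - \<gamma>2 * z * (cnj (F i) * F j - cnj (F j) * F i),
      \<sigma> i * G j - \<sigma> j * G i, \<rho> i * F j - \<rho> j * F i)"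
    and "u \<equiv> \<lambda>i. (Z i, G i, F i)"
  shows "kform (d i j) (u k) - kform (d i k) (u j) + kform (d j k) (u i) = 0"
proof -
  \<comment> \<open>The unitary connection - i beta drops out, and what remains is a 3-form in the
    two real covectors Re Z and Im Z.\<close>
  have Z: "Im (cnj (\<theta> i * Z j - \<theta> j * Z i) * Z k) - Im (cnj (\<theta> i * Z k - \<theta> k * Z i) * Z j)
      + Im (cnj (\<theta> j * Z k - \<theta> k * Z j) * Z i) = 0"
    unfolding \<theta>_def by (simp add: algebra_simps)
  \<comment> \<open>The first three terms, which come from d Z, compensate for the change in the
    length of G caused by Re sigma.\<close>
  have G: "Im (cnj (\<gamma>1 * z * (cnj (G i) * G j - cnj (G j) * G i)) * Z k)
      - Im (cnj (\<gamma>1 * z * (cnj (G i) * G k - cnj (G k) * G i)) * Z j)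
      + Im (cnj (\<gamma>1 * z * (cnj (G j) * G k - cnj (G k) * G j)) * Z i)
      + Im (cnj (\<sigma> i * G j - \<sigma> j * G i) * G k) - Im (cnj (\<sigma> i * G k - \<sigma> k * G i) * G j)
      + Im (cnj (\<sigma> j * G k - \<sigma> k * G j) * G i) = 0"
    unfolding \<sigma>_def by (simp add: algebra_simps)
  have F: "Im (cnj (- \<gamma>2 * z * (cnj (F i) * F j - cnj (F j) * F i)) * Z k)
      - Im (cnj (- \<gamma>2 * z * (cnj (F i) * F k - cnj (F k) * F i)) * Z j)
      + Im (cnj (- \<gamma>2 * z * (cnj (F j) * F k - cnj (F k) * F j)) * Z i)
      + Im (cnj (\<rho> i * F j - \<rho> j * F i) * F k) - Im (cnj (\<rho> i * F k - \<rho> k * F i) * F j)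
      + Im (cnj (\<rho> j * F k - \<rho> k * F j) * F i) = 0"
    unfolding \<rho>_def by (simp add: algebra_simps)
  have split: "Im (cnj (a + b + c) * w) = Im (cnj a * w) + Im (cnj b * w) + Im (cnj c * w)" for a b c w
    by (simp add: algebra_simps)
  show ?thesis
    using Z G F unfolding d_def u_def kform.simps split by linarith
qed

section \<open>The adapted coframe on the tubes\<close>

text \<open>The two tubes are exchanged by swapping the factors of \<open>Sp(1) \<times> Sp(1)\<close>, so one formula serves both.\<close>

definition fac1 :: "orbit_end \<Rightarrow> tvec \<Rightarrow> real^3" where
  "fac1 b X = (if b = Start then fst (fst X) else snd (fst X))"

definition fac2 :: "orbit_end \<Rightarrow> tvec \<Rightarrow> real^3" where
  "fac2 b X = (if b = Start then snd (fst X) else fst (fst X))"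

definition "ea b X = fac1 b X $ 1"
definition "eb b X = fac2 b X $ 1"
definition "eE b X = Complex (fac1 b X $ 2) (fac1 b X $ 3)"
definition "eF b X = Complex (fac2 b X $ 2) (fac2 b X $ 3)"

lemmas e_defs = ea_def eb_def eE_def eF_def fac1_def fac2_def

text \<open>The structure equations in complex form: at \<open>Start\<close> they read d E = i e^1
  wedge E and d F = i e^2 wedge F. Exchanging the two factors leaves them unchanged, so both ends
  are covered.\<close>

lemma e_vbracket:
  "ea b (vbracket X Y) = - Im (cnj (eE b X) * eE b Y)"
  "eb b (vbracket X Y) = - Im (cnj (eF b X) * eF b Y)"
  "eE b (vbracket X Y) = - \<i> * (ea b X * eE b Y - ea b Y * eE b X)"
  "eF b (vbracket X Y) = - \<i> * (eb b X * eF b Y - eb b Y * eF b X)"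
proof -
  obtain x y v where X: "X = ((x, y), v)" by (metis surj_pair)
  obtain x' y' v' where Y: "Y = ((x', y'), v')" by (metis surj_pair)
  note br = bracket_structure_equations[of x y x' y']
  have br': "fst (bracket (x, y) (x', y')) $ 1 = - (x $ 2 * x' $ 3 - x $ 3 * x' $ 2)"
    "fst (bracket (x, y) (x', y')) $ 2 = x $ 1 * x' $ 3 - x $ 3 * x' $ 1"
    "fst (bracket (x, y) (x', y')) $ 3 = - (x $ 1 * x' $ 2 - x $ 2 * x' $ 1)"
    "snd (bracket (x, y) (x', y')) $ 1 = - (y $ 2 * y' $ 3 - y $ 3 * y' $ 2)"
    "snd (bracket (x, y) (x', y')) $ 2 = y $ 1 * y' $ 3 - y $ 3 * y' $ 1"
    "snd (bracket (x, y) (x', y')) $ 3 = - (y $ 1 * y' $ 2 - y $ 2 * y' $ 1)"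
    using br by linarith+
  show "ea b (vbracket X Y) = - Im (cnj (eE b X) * eE b Y)"
    "eb b (vbracket X Y) = - Im (cnj (eF b X) * eF b Y)"
    "eE b (vbracket X Y) = - \<i> * (ea b X * eE b Y - ea b Y * eE b X)"
    "eF b (vbracket X Y) = - \<i> * (eb b X * eF b Y - eb b Y * eF b X)"
    by (cases b; simp add: X Y e_defs vbracket_def br' complex_eq_iff)+
qed

lemma e_linear: "linear (ea b)" "linear (eb b)" "linear (eE b)" "linear (eF b)"
  by (rule linearI; simp add: e_defs complex_eq_iff)+

lemma snd_vbracket: "snd (vbracket X Y) = 0"
  by (simp add: vbracket_def)

context scale
begin

text \<open>With r = |z|^2, \<open>bfun\<close> and \<open>mfun\<close> are the smooth extensions
  over z = 0 of 2 y / r and (2 c - 1) / r. Both use r = y * kappa^2; the second also uses the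
  Hadamard quotient of 2 c at 0.\<close>

definition bfun :: "real \<Rightarrow> real" where "bfun y = 2 * inverse ((kappa y)\<^sup>2)"
definition mfun :: "real \<Rightarrow> real" where
  "mfun y = diff_quot (\<lambda>y. 2 * cfun y) y * inverse ((kappa y)\<^sup>2)"

lemma bfun_smooth: "smooth_fun bfun U"
  unfolding bfun_def
  by (intro smooth_fun_mult smooth_fun_const smooth_fun_inverse smooth_fun_power kappa_smooth)
    (use kappa_pos in \<open>auto simp: less_le\<close>)

lemma mfun_smooth: "smooth_fun mfun U"
  unfolding mfun_def
  by (intro smooth_fun_mult smooth_fun_diff_quot smooth_fun_inverse smooth_fun_power kappa_smooth
      smooth_fun_const cfun_smooth) (use kappa_pos in \<open>auto simp: less_le\<close>)

lemma mult_bfun: "r \<in> J \<Longrightarrow> r * bfun (Y r) = 2 * Y r"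
  using kappa_pos[OF Y_mem, of r] arc2_Y[of r] by (simp add: bfun_def arc2_def field_simps)

lemma mult_mfun:
  assumes r: "r \<in> J"
  shows "r * mfun (Y r) = 2 * cfun (Y r) - 1"
proof -
  have "smooth_fun (\<lambda>y. 2 * cfun y) U"
    by (intro smooth_fun_mult smooth_fun_const cfun_smooth) simp
  from diff_quot[OF this _ Y_mem[OF r]]
  have "2 * cfun (Y r) = 1 + Y r * diff_quot (\<lambda>y. 2 * cfun y) (Y r)" by (simp add: cfun_0)
  moreover have "r = Y r * (kappa (Y r))\<^sup>2" using arc2_Y[OF r] by (simp add: arc2_def)
  then have "r * mfun (Y r) = Y r * diff_quot (\<lambda>y. 2 * cfun y) (Y r)"
    using kappa_pos[OF Y_mem[OF r]] by (simp add: mfun_def field_simps)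
  ultimately show ?thesis by simp
qed

definition Yp :: "real \<Rightarrow> real" where "Yp y = lam\<^sup>2 * cfun y / 4"

lemma Y_deriv': "r \<in> J \<Longrightarrow> (Y has_real_derivative Yp (Y r)) (at r)"
  unfolding Yp_def by (rule Y_deriv)

lemma radial_deriv:
  assumes "smooth_fun f U" "r \<in> J"
  shows "((\<lambda>r. f (Y r)) has_real_derivative deriv f (Y r) * Yp (Y r)) (at r)"
  by (rule DERIV_chain2[OF smooth_fun_deriv(2)[OF assms(1) Y_mem[OF assms(2)]] Y_deriv'[OF assms(2)]])

text \<open>Differentiating r * f instead of f gives f + r f', the combination that occurs in the
  structure equations, and avoids differentiating the Hadamard quotient inside
  \<open>mfun\<close>.\<close>

lemma radial_product_deriv:
  assumes f: "smooth_fun f U" and g: "smooth_fun g U"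
    and eq: "\<And>r. r \<in> J \<Longrightarrow> r * f (Y r) = g (Y r)" and r: "r \<in> J"
  shows "f (Y r) + r * (deriv f (Y r) * Yp (Y r)) = deriv g (Y r) * Yp (Y r)"
proof -
  have "((\<lambda>r. r * f (Y r)) has_real_derivative 1 * f (Y r) + deriv f (Y r) * Yp (Y r) * r) (at r)"
    by (rule DERIV_mult[OF DERIV_ident radial_deriv[OF f r]])
  then have "((\<lambda>r. g (Y r)) has_real_derivative 1 * f (Y r) + deriv f (Y r) * Yp (Y r) * r) (at r)"
    by (rule has_field_derivative_transform_within_open[OF _ J_open r eq])
  from DERIV_unique[OF this radial_deriv[OF g r]] show ?thesis by (simp add: ac_simps)
qed

lemma bfun_deriv: "r \<in> J \<Longrightarrow> bfun (Y r) + r * (deriv bfun (Y r) * Yp (Y r)) = 2 * Yp (Y r)"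
proof -
  assume r: "r \<in> J"
  have s: "smooth_fun (\<lambda>y. 2 * y) U" by (intro smooth_fun_mult smooth_fun_const smooth_fun_id) auto
  have "deriv (\<lambda>y::real. 2 * y) (Y r) = 2" by (rule DERIV_imp_deriv) (auto intro!: derivative_eq_intros)
  with radial_product_deriv[OF bfun_smooth s mult_bfun r] show ?thesis by simp
qed

lemma mfun_deriv:
  "r \<in> J \<Longrightarrow> mfun (Y r) + r * (deriv mfun (Y r) * Yp (Y r)) = 2 * (deriv cfun (Y r) * Yp (Y r))"
proof -
  assume r: "r \<in> J"
  have s: "smooth_fun (\<lambda>y. 2 * cfun y - 1) U"
    by (intro smooth_fun_mult smooth_fun_const smooth_fun_diff cfun_smooth) auto
  have "deriv (\<lambda>y. 2 * cfun y - 1) (Y r) = 2 * deriv cfun (Y r)"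
    by (rule DERIV_imp_deriv) (auto intro!: derivative_eq_intros smooth_fun_deriv(2)[OF cfun_smooth Y_mem[OF r]])
  with radial_product_deriv[OF mfun_smooth s mult_mfun r] show ?thesis by simp
qed

text \<open>On the section \<open>z = t > 0\<close> the real part of the second component is \<open>dt\<close>; the terms with
  \<open>bfun\<close> and \<open>mfun\<close> make the covectors vanish on the tangent vectors of the \<open>K\<close>-orbits.\<close>

definition covec :: "orbit_end \<Rightarrow> complex \<Rightarrow> tvec \<Rightarrow> covec7" where
  "covec b z X = (let y = Y ((cmod z)\<^sup>2); \<omega> = Im (cnj z * snd X) in
    (- (1 / lam) * ((1 / 2 + y) * ea b X - (3 / 2 - y) * eb b X - bfun y * \<omega>),
     snd X + \<i> * z * of_real (mfun y * \<omega> - cfun y * (ea b X + eb b X)),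
     of_real (sqrt 2 / lam * sqrt (1 / 2 + y)) * cnj (eE b X),
     of_real (sqrt 2 / lam * sqrt (3 / 2 - y)) * eF b X))"

definition dcovec :: "orbit_end \<Rightarrow> complex \<Rightarrow> complex \<Rightarrow> tvec \<Rightarrow> covec7" where
  "dcovec b z w X = (let y = Y ((cmod z)\<^sup>2); \<omega> = Im (cnj z * snd X); y' = Yp y * (2 * Re (cnj z * w)) in
    (- (1 / lam) * (y' * ea b X + y' * eb b X - (deriv bfun y * y' * \<omega> + bfun y * Im (cnj w * snd X))),
     \<i> * w * of_real (mfun y * \<omega> - cfun y * (ea b X + eb b X))
       + \<i> * z * of_real (deriv mfun y * y' * \<omega> + mfun y * Im (cnj w * snd X)
           - deriv cfun y * y' * (ea b X + eb b X)),
     of_real (sqrt 2 / lam * (y' / (2 * (1 / 2 + y)) * sqrt (1 / 2 + y))) * cnj (eE b X),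
     of_real (sqrt 2 / lam * (- y' / (2 * (3 / 2 - y)) * sqrt (3 / 2 - y))) * eF b X))"

lemma covec_has_derivative:
  assumes r: "(cmod z)\<^sup>2 \<in> J"
  shows "((\<lambda>s. covec b (z + s *\<^sub>R w) X) has_vector_derivative dcovec b z w X) (at 0)"
proof -
  define r y y' \<omega> where "r = (cmod z)\<^sup>2" and "y = Y r" and "y' = Yp y * (2 * Re (cnj z * w))"
    and "\<omega> = Im (cnj z * snd X)"
  have rJ: "r \<in> J" using assms by (simp add: r_def)
  have yU: "y \<in> U" unfolding y_def by (rule Y_mem[OF rJ])
  let ?y = "\<lambda>s. Y ((cmod (z + s *\<^sub>R w))\<^sup>2)"
  let ?om = "\<lambda>s. Im (cnj (z + s *\<^sub>R w) * snd X)"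
  have dr: "((\<lambda>s. (cmod (z + s *\<^sub>R w))\<^sup>2) has_real_derivative 2 * Re (cnj z * w)) (at 0)"
    unfolding cmod_power2 by (auto intro!: derivative_eq_intros simp: algebra_simps)
  have dy: "(?y has_real_derivative y') (at 0)"
    unfolding y'_def y_def
    by (rule DERIV_chain2[where g = "\<lambda>s. (cmod (z + s *\<^sub>R w))\<^sup>2", OF _ dr])
      (use Y_deriv'[OF rJ] in \<open>simp add: r_def\<close>)
  have y0: "?y 0 = y" by (simp add: y_def r_def)
  have df: "((\<lambda>s. f (?y s)) has_real_derivative deriv f y * y') (at 0)" if "smooth_fun f U" for f
    by (rule DERIV_chain2[OF _ dy]) (use smooth_fun_deriv(2)[OF that yU] y0 in simp)
  have dom: "(?om has_real_derivative Im (cnj w * snd X)) (at 0)"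
    by (auto intro!: derivative_eq_intros simp: algebra_simps)
  have om0: "?om 0 = \<omega>" by (simp add: \<omega>_def)
  have vec: "((\<lambda>s. complex_of_real (f s)) has_vector_derivative of_real f') (at 0)"
    if "(f has_real_derivative f') (at 0)" for f f'
    using bounded_linear.has_vector_derivative[OF bounded_linear_of_real
        that[unfolded has_real_derivative_iff_has_vector_derivative]] .
  have dsq: "((\<lambda>s. sqrt 2 / lam * sqrt (a + \<epsilon> * ?y s)) has_real_derivative
      sqrt 2 / lam * (\<epsilon> * y' / (2 * (a + \<epsilon> * y)) * sqrt (a + \<epsilon> * y))) (at 0)"
    if pos: "0 < a + \<epsilon> * y" for a \<epsilon>
  proof -
    have "((\<lambda>s. sqrt (a + \<epsilon> * ?y s)) has_real_derivative inverse (sqrt (a + \<epsilon> * y)) / 2 * (\<epsilon> * y')) (at 0)"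
      by (rule DERIV_chain2[where g = "\<lambda>s. a + \<epsilon> * ?y s"], rule DERIV_cong[OF DERIV_real_sqrt])
        (use pos y0 in \<open>auto intro!: derivative_eq_intros dy\<close>)
    moreover have "inverse (sqrt (a + \<epsilon> * y)) / 2 * (\<epsilon> * y') = \<epsilon> * y' / (2 * (a + \<epsilon> * y)) * sqrt (a + \<epsilon> * y)"
      using pos by (simp add: field_simps)
    ultimately show ?thesis by (intro DERIV_cmult) (simp only:)
  qed
  have d1: "((\<lambda>s. - (1 / lam) * ((1 / 2 + ?y s) * ea b X - (3 / 2 - ?y s) * eb b X - bfun (?y s) * ?om s))
      has_real_derivative
      - (1 / lam) * (y' * ea b X + y' * eb b X - (deriv bfun y * y' * \<omega> + bfun y * Im (cnj w * snd X)))) (at 0)"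
    by (rule DERIV_cmult, rule DERIV_cong,
        rule DERIV_diff[OF DERIV_diff[OF DERIV_cmult_right[OF DERIV_add[OF DERIV_const dy]]
          DERIV_cmult_right[OF DERIV_diff[OF DERIV_const dy]]] DERIV_mult[OF df[OF bfun_smooth] dom]])
      (simp add: y_def r_def \<omega>_def algebra_simps)
  have d2: "((\<lambda>s. mfun (?y s) * ?om s - cfun (?y s) * (ea b X + eb b X)) has_real_derivative
      deriv mfun y * y' * \<omega> + mfun y * Im (cnj w * snd X) - deriv cfun y * y' * (ea b X + eb b X)) (at 0)"
    by (rule DERIV_cong, rule DERIV_diff[OF DERIV_mult[OF df[OF mfun_smooth] dom]
          DERIV_cmult_right[OF df[OF cfun_smooth]]])
      (simp add: y_def r_def \<omega>_def algebra_simps)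
  have d2': "((\<lambda>s. snd X + \<i> * (z + s *\<^sub>R w) *
        of_real (mfun (?y s) * ?om s - cfun (?y s) * (ea b X + eb b X))) has_vector_derivative
      \<i> * w * of_real (mfun y * \<omega> - cfun y * (ea b X + eb b X))
       + \<i> * z * of_real (deriv mfun y * y' * \<omega> + mfun y * Im (cnj w * snd X)
           - deriv cfun y * y' * (ea b X + eb b X))) (at 0)"
  proof -
    have "((\<lambda>s. \<i> * (z + s *\<^sub>R w)) has_vector_derivative \<i> * w) (at 0)"
      by (auto intro!: derivative_eq_intros)
    from has_vector_derivative_add[OF has_vector_derivative_const has_vector_derivative_mult[OF this vec[OF d2]]]
    show ?thesis by (simp add: y_def r_def \<omega>_def add.commute)
  qed
  have d3: "((\<lambda>s. of_real (sqrt 2 / lam * sqrt (1 / 2 + ?y s)) * cnj (eE b X)) has_vector_derivative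
      of_real (sqrt 2 / lam * (y' / (2 * (1 / 2 + y)) * sqrt (1 / 2 + y))) * cnj (eE b X)) (at 0)"
    using has_vector_derivative_mult_left[OF vec[OF dsq[of "1 / 2" 1]]] yU by simp
  have d4: "((\<lambda>s. of_real (sqrt 2 / lam * sqrt (3 / 2 - ?y s)) * eF b X) has_vector_derivative
      of_real (sqrt 2 / lam * (- y' / (2 * (3 / 2 - y)) * sqrt (3 / 2 - y))) * eF b X) (at 0)"
    using has_vector_derivative_mult_left[OF vec[OF dsq[of "3 / 2" "-1"]]] yU by simp
  show ?thesis
    unfolding covec_def dcovec_def Let_def
    using has_vector_derivative_Pair[OF d1[unfolded has_real_derivative_iff_has_vector_derivative]
        has_vector_derivative_Pair[OF d2' has_vector_derivative_Pair[OF d3 d4]]]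
    unfolding y'_def y_def r_def \<omega>_def .
qed

lemma covec_linear: "linear (covec b z)"
proof -
  note l = linear_add[OF e_linear(1)] linear_add[OF e_linear(2)] linear_add[OF e_linear(3)] linear_add[OF e_linear(4)]
    linear_scale[OF e_linear(1)] linear_scale[OF e_linear(2)] linear_scale[OF e_linear(3)] linear_scale[OF e_linear(4)]
  have lin: "linear (\<lambda>X. (k * (p * ea b X - q * eb b X - B * Im (cnj z * snd X)),
      snd X + \<i> * z * of_real (m * Im (cnj z * snd X) - c * (ea b X + eb b X)),
      of_real n * cnj (eE b X), of_real n' * eF b X))" for k p q B m c n n'
    by (rule linearI) (simp_all add: l complex_eq_iff algebra_simps)
  show ?thesis unfolding covec_def Let_def by (rule lin)
qed

end

section \<open>The structure equations\<close>

context scale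
begin

definition "hC b z X = fst (covec b z X)"
definition "zC b z X = fst (snd (covec b z X))"
definition "gC b z X = fst (snd (snd (covec b z X)))"
definition "fC b z X = snd (snd (snd (covec b z X)))"

definition "yC z = Y ((cmod z)\<^sup>2)"
definition "betaC b z X = mfun (yC z) * Im (cnj z * snd X) - cfun (yC z) * (ea b X + eb b X)"
text \<open>Logarithmic derivatives in r = |z|^2: of c, of 1/2 + y and, with the opposite sign, of
  3/2 - y. The last two govern the squared lengths of G and F, so the root factors in G and F grow
  at the rates g1C and - g2C times Re (cnj z * dz).\<close>

definition "kC z = deriv cfun (yC z) * Yp (yC z) / cfun (yC z)"
definition "g1C z = Yp (yC z) / (1 / 2 + yC z)"
definition "g2C z = Yp (yC z) / (3 / 2 - yC z)"

text \<open>The connection forms are shaped to fit \<open>vform_closing\<close> and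
  \<open>kform_closing\<close>. Apart from - i beta, d Z consists of multiples of the area forms of
  Z, G and F; the first of these is absorbed into theta as a multiple of cnj Z.\<close>

definition "thetaC b z X = - \<i> * of_real (betaC b z X) + of_real (kC z) * z * cnj (zC b z X)"
definition "sigmaC b z X = of_real (g1C z) * of_real (Re (cnj z * zC b z X)) - \<i> * of_real (ea b X)"
definition "rhoC b z X = - of_real (g2C z) * of_real (Re (cnj z * zC b z X)) + \<i> * of_real (eb b X)"

lemma covec_split: "covec b z X = (hC b z X, zC b z X, gC b z X, fC b z X)"
  by (simp add: hC_def zC_def gC_def fC_def)

lemma components:
  "hC b z X = - (1 / lam) * ((1 / 2 + yC z) * ea b X - (3 / 2 - yC z) * eb b X - bfun (yC z) * Im (cnj z * snd X))"
  "zC b z X = snd X + \<i> * z * of_real (betaC b z X)"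
  "gC b z X = of_real (sqrt 2 / lam * sqrt (1 / 2 + yC z)) * cnj (eE b X)"
  "fC b z X = of_real (sqrt 2 / lam * sqrt (3 / 2 - yC z)) * eF b X"
  by (simp_all add: hC_def zC_def gC_def fC_def covec_def Let_def betaC_def yC_def)

definition dform :: "orbit_end \<Rightarrow> complex \<Rightarrow> tvec \<Rightarrow> tvec \<Rightarrow> covec7" where
  "dform b z X X' = dcovec b z (snd X) X' - dcovec b z (snd X') X - covec b z (vbracket X X')"

lemma radial: "Re (cnj z * zC b z X) = Re (cnj z * snd X)"
  by (simp add: components algebra_simps)

context
  fixes z :: complex
  assumes r: "(cmod z)\<^sup>2 \<in> J"
begin

lemma yC_mem: "yC z \<in> U"
  unfolding yC_def by (rule Y_mem[OF r])

lemma area_z: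
  "Im (cnj (zC b z X) * zC b z X') = 2 * cfun (yC z) * Im (cnj (snd X) * snd X')
     - cfun (yC z) * (Re (cnj z * snd X) * (ea b X' + eb b X') - Re (cnj z * snd X') * (ea b X + eb b X))"
proof -
  have I: "Re (cnj z * v) * Im (cnj z * v') - Re (cnj z * v') * Im (cnj z * v) = (cmod z)\<^sup>2 * Im (cnj v * v')" for v v'
    unfolding cmod_power2 by (simp add: algebra_simps power2_eq_square)
  have "Im (cnj (v + \<i> * z * of_real \<beta>) * (v' + \<i> * z * of_real \<beta>'))
      = Im (cnj v * v') + Re (cnj z * v) * \<beta>' - Re (cnj z * v') * \<beta>" for v v' \<beta> \<beta>'
    by (simp add: algebra_simps)
  then have "Im (cnj (zC b z X) * zC b z X') = Im (cnj (snd X) * snd X')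
      + Re (cnj z * snd X) * betaC b z X' - Re (cnj z * snd X') * betaC b z X"
    unfolding components by blast
  also have "\<dots> = (1 + (cmod z)\<^sup>2 * mfun (yC z)) * Im (cnj (snd X) * snd X')
     - cfun (yC z) * (Re (cnj z * snd X) * (ea b X' + eb b X') - Re (cnj z * snd X') * (ea b X + eb b X))"
    unfolding betaC_def distrib_right mult.assoc mult.left_commute[of "(cmod z)\<^sup>2"] I[symmetric]
    by (simp add: algebra_simps)
  also have "1 + (cmod z)\<^sup>2 * mfun (yC z) = 2 * cfun (yC z)"
    using mult_mfun[OF r] by (simp add: yC_def)
  finally show ?thesis .
qed

lemma area_gf:
  "Im (cnj (gC b z X) * gC b z X') = - (2 / lam\<^sup>2 * (1 / 2 + yC z)) * Im (cnj (eE b X) * eE b X')"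
  "Im (cnj (fC b z X) * fC b z X') = 2 / lam\<^sup>2 * (3 / 2 - yC z) * Im (cnj (eF b X) * eF b X')"
proof -
  have n: "(sqrt 2 / lam * sqrt a)\<^sup>2 = 2 / lam\<^sup>2 * a" if "0 < a" for a
    using that by (simp add: power_mult_distrib power_divide)
  have e: "Im (cnj (of_real k * cnj w) * (of_real k * cnj w')) = - k\<^sup>2 * Im (cnj w * w')"
    "Im (cnj (of_real k * w) * (of_real k * w')) = k\<^sup>2 * Im (cnj w * w')" for k w w'
    by (simp_all add: algebra_simps power2_eq_square)
  show "Im (cnj (gC b z X) * gC b z X') = - (2 / lam\<^sup>2 * (1 / 2 + yC z)) * Im (cnj (eE b X) * eE b X')"
    unfolding components e(1) by (subst n) (use yC_mem in auto)
  show "Im (cnj (fC b z X) * fC b z X') = 2 / lam\<^sup>2 * (3 / 2 - yC z) * Im (cnj (eF b X) * eF b X')"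
    unfolding components e(2) by (subst n) (use yC_mem in auto)
qed

text \<open>The coefficient c of e^1 + e^2 in Z and the lengths of G and F are tied together by y' =
  lambda^2 c / 4. This is why the rates g1C and g2C of sigma and rho reappear as the coefficients of
  the area forms in d Z, as \<open>kform_closing\<close> requires, and why d eta is lambda/2 times
  omega.\<close>

lemma structure_equations:
  "dform b z X X' =
     (lam / 2 * kform (snd (covec b z X)) (snd (covec b z X')),
      thetaC b z X * zC b z X' - thetaC b z X' * zC b z X
        + of_real (g1C z) * z * (cnj (gC b z X) * gC b z X' - cnj (gC b z X') * gC b z X)
        + - of_real (g2C z) * z * (cnj (fC b z X) * fC b z X' - cnj (fC b z X') * fC b z X),
      sigmaC b z X * gC b z X' - sigmaC b z X' * gC b z X,
      rhoC b z X * fC b z X' - rhoC b z X' * fC b z X)"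
proof -
  define y c m B c' m' B' y' where "y = yC z" and "c = cfun y" and "m = mfun y" and "B = bfun y"
    and "c' = deriv cfun y * Yp y" and "m' = deriv mfun y * Yp y" and "B' = deriv bfun y * Yp y" and "y' = Yp y"
  define v v' \<omega> \<omega>' \<tau> \<tau>' where "v = snd X" and "v' = snd X'" and "\<omega> = Im (cnj z * v)" and "\<omega>' = Im (cnj z * v')"
    and "\<tau> = Re (cnj z * v)" and "\<tau>' = Re (cnj z * v')"
  define \<epsilon> \<epsilon>' I A A' where "\<epsilon> = ea b X + eb b X" and "\<epsilon>' = ea b X' + eb b X'" and "I = Im (cnj v * v')"
    and "A = Im (cnj (eE b X) * eE b X')" and "A' = Im (cnj (eF b X) * eF b X')"
  define \<beta> \<beta>' where "\<beta> = betaC b z X" and "\<beta>' = betaC b z X'"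
  have y: "0 < 1 / 2 + y" "0 < 3 / 2 - y" using yC_mem by (auto simp: y_def)
  have c: "0 < c" using cfun_pos[OF yC_mem] by (simp add: c_def y_def)
  \<comment> \<open>The wedge of the radial and the angular form is |z|^2 times the area form, so
    \<open>bfun\<close> and \<open>mfun\<close> enter only through f + r f', known from
    differentiating r * bfun = 2 y and r * mfun = 2 c - 1.\<close>
  have rI: "\<tau> * \<omega>' - \<tau>' * \<omega> = (cmod z)\<^sup>2 * I"
    unfolding \<tau>_def \<tau>'_def \<omega>_def \<omega>'_def I_def cmod_power2 by (simp add: algebra_simps power2_eq_square)
  have B: "B + (cmod z)\<^sup>2 * B' = 2 * y'" and m: "m + (cmod z)\<^sup>2 * m' = 2 * c'"
    using bfun_deriv[OF r] mfun_deriv[OF r]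
    by (simp_all add: B_def B'_def m_def m'_def c'_def y'_def y_def yC_def)
  have y': "y' = lam\<^sup>2 * c / 4" by (simp add: y'_def Yp_def c_def)
  have \<beta>: "\<beta> = m * \<omega> - c * \<epsilon>" and \<beta>': "\<beta>' = m * \<omega>' - c * \<epsilon>'"
    by (simp_all add: \<beta>_def \<beta>'_def betaC_def m_def c_def y_def \<omega>_def \<omega>'_def \<epsilon>_def \<epsilon>'_def v_def v'_def)
  have I': "Im (cnj v' * v) = - I" by (simp add: I_def algebra_simps)
  have Z: "Im (cnj (zC b z X) * zC b z X') = 2 * c * I - c * (\<tau> * \<epsilon>' - \<tau>' * \<epsilon>)"
    unfolding area_z by (simp add: c_def y_def I_def \<tau>_def \<tau>'_def \<epsilon>_def \<epsilon>'_def v_def v'_def)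
  note gf = area_gf[of b X X', folded A_def A'_def y_def]
  have bracket: "covec b z (vbracket X X') =
      (- (1 / lam) * ((3 / 2 - y) * A' - (1 / 2 + y) * A), \<i> * z * of_real (c * (A + A')),
       of_real (sqrt 2 / lam * sqrt (1 / 2 + y)) * cnj (- \<i> * (ea b X * eE b X' - ea b X' * eE b X)),
       of_real (sqrt 2 / lam * sqrt (3 / 2 - y)) * (- \<i> * (eb b X * eF b X' - eb b X' * eF b X)))"
    unfolding covec_def Let_def snd_vbracket e_vbracket A_def A'_def
    by (simp add: yC_def y_def c_def algebra_simps)
  have D: "dcovec b z w0 X0 = (- (1 / lam) * (y' * (2 * t) * (ea b X0 + eb b X0) - (B' * (2 * t) * w + B * K)),
      \<i> * w0 * of_real (betaC b z X0)
        + \<i> * z * of_real (m' * (2 * t) * w + m * K - c' * (2 * t) * (ea b X0 + eb b X0)),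
      of_real (g1C z * t) * gC b z X0, of_real (- g2C z * t) * fC b z X0)"
    if t: "t = Re (cnj z * w0)" and w: "w = Im (cnj z * snd X0)" and K: "K = Im (cnj w0 * snd X0)" for w0 X0 t w K
  proof -
    have q: "y' * (2 * t) / (2 * a) * k = y' / a * t * k" "- (y' * (2 * t)) / (2 * a) * k = - (y' / a) * t * k"
      for a k by simp_all
    have q': "sqrt 2 / lam * (a * t * k) = a * t * (sqrt 2 / lam * k)" for a k by simp
    show ?thesis
      unfolding dcovec_def Let_def betaC_def components(3,4) g1C_def g2C_def yC_def[of z, symmetric]
        y_def[symmetric] y'_def[symmetric] t[symmetric] w[symmetric] K[symmetric] q q'
        B_def[symmetric] m_def[symmetric] c_def[symmetric]
      by (simp add: B'_def m'_def c'_def y'_def algebra_simps)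
  qed
  have d: "dcovec b z (snd X) X' = (- (1 / lam) * (y' * (2 * \<tau>) * \<epsilon>' - (B' * (2 * \<tau>) * \<omega>' + B * I)),
      \<i> * v * of_real \<beta>' + \<i> * z * of_real (m' * (2 * \<tau>) * \<omega>' + m * I - c' * (2 * \<tau>) * \<epsilon>'),
      of_real (g1C z * \<tau>) * gC b z X', of_real (- g2C z * \<tau>) * fC b z X')"
    unfolding v_def[symmetric] \<epsilon>'_def \<beta>'_def by (rule D) (simp_all only: \<tau>_def \<omega>'_def I_def v'_def)
  have d': "dcovec b z (snd X') X = (- (1 / lam) * (y' * (2 * \<tau>') * \<epsilon> - (B' * (2 * \<tau>') * \<omega> + B * (- I))),
      \<i> * v' * of_real \<beta> + \<i> * z * of_real (m' * (2 * \<tau>') * \<omega> + m * (- I) - c' * (2 * \<tau>') * \<epsilon>),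
      of_real (g1C z * \<tau>') * gC b z X, of_real (- g2C z * \<tau>') * fC b z X)"
    unfolding v'_def[symmetric] \<epsilon>_def \<beta>_def by (rule D) (simp_all only: \<tau>'_def \<omega>_def I'[symmetric] v_def)
  show ?thesis
  proof (unfold dform_def d d' bracket, simp only: diff_Pair prod.inject, intro conjI)
    have "- (1 / lam) * (y' * (2 * \<tau>) * \<epsilon>' - (B' * (2 * \<tau>) * \<omega>' + B * I))
        - - (1 / lam) * (y' * (2 * \<tau>') * \<epsilon> - (B' * (2 * \<tau>') * \<omega> + B * (- I)))
        - - (1 / lam) * ((3 / 2 - y) * A' - (1 / 2 + y) * A)
      = (1 / lam) * (2 * (B * I + B' * (\<tau> * \<omega>' - \<tau>' * \<omega>)) - 2 * y' * (\<tau> * \<epsilon>' - \<tau>' * \<epsilon>)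
          + (3 / 2 - y) * A' - (1 / 2 + y) * A)"
      by (simp add: algebra_simps)
    also have "B * I + B' * (\<tau> * \<omega>' - \<tau>' * \<omega>) = 2 * y' * I"
      unfolding rI B[symmetric] by (simp add: algebra_simps)
    also have "(1 / lam) * (2 * (2 * y' * I) - 2 * y' * (\<tau> * \<epsilon>' - \<tau>' * \<epsilon>) + (3 / 2 - y) * A' - (1 / 2 + y) * A)
      = lam / 2 * (2 * c * I - c * (\<tau> * \<epsilon>' - \<tau>' * \<epsilon>)
          + - (2 / lam\<^sup>2 * (1 / 2 + y)) * A + 2 / lam\<^sup>2 * (3 / 2 - y) * A')"
      unfolding y' using lam_pos by (simp add: field_simps power2_eq_square)
    finally show "- (1 / lam) * (y' * (2 * \<tau>) * \<epsilon>' - (B' * (2 * \<tau>) * \<omega>' + B * I))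
        - - (1 / lam) * (y' * (2 * \<tau>') * \<epsilon> - (B' * (2 * \<tau>') * \<omega> + B * (- I)))
        - - (1 / lam) * ((3 / 2 - y) * A' - (1 / 2 + y) * A)
      = lam / 2 * kform (snd (covec b z X)) (snd (covec b z X'))"
      unfolding covec_split snd_conv kform.simps Z gf .
  next
    have conn: "- \<i> * of_real \<beta> * zC b z X' - - \<i> * of_real \<beta>' * zC b z X
        = \<i> * v * of_real \<beta>' - \<i> * v' * of_real \<beta>"
      unfolding components(2) by (simp add: \<beta>_def \<beta>'_def v_def v'_def algebra_simps)
    have area: "cnj w * w' - cnj w' * w = 2 * \<i> * of_real (Im (cnj w * w'))" for w w'
      by (simp add: complex_eq_iff)
    have gen2: "a + k * z * (2 * \<i> * p) + g * z * (2 * \<i> * q) + - g' * z * (2 * \<i> * s)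
        = a + 2 * \<i> * z * (k * p) + 2 * \<i> * z * (g * q) - 2 * \<i> * z * (g' * s)" for a k g g' p q s :: complex
      by (simp add: algebra_simps)
    have k: "complex_of_real (kC z) * of_real (2 * c * I - c * (\<tau> * \<epsilon>' - \<tau>' * \<epsilon>))
        = of_real (c' * (2 * I - (\<tau> * \<epsilon>' - \<tau>' * \<epsilon>)))"
      unfolding of_real_mult[symmetric] of_real_eq_iff kC_def y_def[symmetric] c_def[symmetric] c'_def[symmetric]
      using c by (simp add: field_simps)
    have gen: "lam\<^sup>2 * c / 4 / a * (- (2 / lam\<^sup>2 * a) * x) = - (c * x / 2)"
      "lam\<^sup>2 * c / 4 / a * (2 / lam\<^sup>2 * a * x) = c * x / 2" if "0 < a" for a x
      using that lam_pos by (simp_all add: field_simps)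
    have g1: "complex_of_real (g1C z) * of_real (- (2 / lam\<^sup>2 * (1 / 2 + y)) * A) = - of_real (c * A / 2)"
      unfolding of_real_mult[symmetric] of_real_minus[symmetric] of_real_eq_iff g1C_def y_def[symmetric] y'_def[symmetric] y'
      by (rule gen(1)[OF y(1)])
    have g2: "complex_of_real (g2C z) * of_real (2 / lam\<^sup>2 * (3 / 2 - y) * A') = of_real (c * A' / 2)"
      unfolding of_real_mult[symmetric] of_real_eq_iff g2C_def y_def[symmetric] y'_def[symmetric] y'
      by (rule gen(2)[OF y(2)])
    have rad: "complex_of_real (m' * (2 * \<tau>) * \<omega>' + m * I - c' * (2 * \<tau>) * \<epsilon>')
        - of_real (m' * (2 * \<tau>') * \<omega> + m * (- I) - c' * (2 * \<tau>') * \<epsilon>)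
        = 2 * of_real (c' * (2 * I - (\<tau> * \<epsilon>' - \<tau>' * \<epsilon>)))"
    proof -
      have "m' * (2 * \<tau>) * \<omega>' + m * I - c' * (2 * \<tau>) * \<epsilon>' - (m' * (2 * \<tau>') * \<omega> + m * (- I) - c' * (2 * \<tau>') * \<epsilon>)
        = 2 * (m * I + m' * (\<tau> * \<omega>' - \<tau>' * \<omega>)) - 2 * c' * (\<tau> * \<epsilon>' - \<tau>' * \<epsilon>)"
        by (simp add: algebra_simps)
      also have "m * I + m' * (\<tau> * \<omega>' - \<tau>' * \<omega>) = 2 * c' * I"
        unfolding rI m[symmetric] by (simp add: algebra_simps)
      also have "2 * (2 * c' * I) - 2 * c' * (\<tau> * \<epsilon>' - \<tau>' * \<epsilon>) = 2 * (c' * (2 * I - (\<tau> * \<epsilon>' - \<tau>' * \<epsilon>)))"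
        by (simp add: algebra_simps)
      finally show ?thesis unfolding of_real_diff[symmetric] by simp
    qed
    have "thetaC b z X * zC b z X' - thetaC b z X' * zC b z X
        + of_real (g1C z) * z * (cnj (gC b z X) * gC b z X' - cnj (gC b z X') * gC b z X)
        + - of_real (g2C z) * z * (cnj (fC b z X) * fC b z X' - cnj (fC b z X') * fC b z X)
      = (- \<i> * of_real \<beta> * zC b z X' - - \<i> * of_real \<beta>' * zC b z X)
        + of_real (kC z) * z * (cnj (zC b z X) * zC b z X' - cnj (zC b z X') * zC b z X)
        + of_real (g1C z) * z * (cnj (gC b z X) * gC b z X' - cnj (gC b z X') * gC b z X)
        + - of_real (g2C z) * z * (cnj (fC b z X) * fC b z X' - cnj (fC b z X') * fC b z X)"
      unfolding thetaC_def \<beta>_def \<beta>'_def by (simp add: algebra_simps)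
    also have "\<dots> = (\<i> * v * of_real \<beta>' - \<i> * v' * of_real \<beta>)
        + 2 * \<i> * z * (of_real (kC z) * of_real (2 * c * I - c * (\<tau> * \<epsilon>' - \<tau>' * \<epsilon>)))
        + 2 * \<i> * z * (of_real (g1C z) * of_real (- (2 / lam\<^sup>2 * (1 / 2 + y)) * A))
        - 2 * \<i> * z * (of_real (g2C z) * of_real (2 / lam\<^sup>2 * (3 / 2 - y) * A'))"
      unfolding conn area Z gf by (rule gen2)
    also have "\<dots> = \<i> * v * of_real \<beta>' - \<i> * v' * of_real \<beta>
        + \<i> * z * (2 * of_real (c' * (2 * I - (\<tau> * \<epsilon>' - \<tau>' * \<epsilon>))))
        - \<i> * z * of_real (c * (A + A'))"
      unfolding k g1 g2 by (simp add: algebra_simps)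
    finally show "\<i> * v * of_real \<beta>' + \<i> * z * of_real (m' * (2 * \<tau>) * \<omega>' + m * I - c' * (2 * \<tau>) * \<epsilon>')
        - (\<i> * v' * of_real \<beta> + \<i> * z * of_real (m' * (2 * \<tau>') * \<omega> + m * (- I) - c' * (2 * \<tau>') * \<epsilon>))
        - \<i> * z * of_real (c * (A + A'))
      = thetaC b z X * zC b z X' - thetaC b z X' * zC b z X
        + of_real (g1C z) * z * (cnj (gC b z X) * gC b z X' - cnj (gC b z X') * gC b z X)
        + - of_real (g2C z) * z * (cnj (fC b z X) * fC b z X' - cnj (fC b z X') * fC b z X)"
      unfolding rad[symmetric] by (simp only: ring_distribs) (simp only: algebra_simps)
  next
    show "of_real (g1C z * \<tau>) * gC b z X' - of_real (g1C z * \<tau>') * gC b z X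
        - of_real (sqrt 2 / lam * sqrt (1 / 2 + y)) * cnj (- \<i> * (ea b X * eE b X' - ea b X' * eE b X))
      = sigmaC b z X * gC b z X' - sigmaC b z X' * gC b z X"
      unfolding sigmaC_def radial components(3) y_def \<tau>_def \<tau>'_def v_def v'_def by (simp add: algebra_simps)
  next
    show "of_real (- g2C z * \<tau>) * fC b z X' - of_real (- g2C z * \<tau>') * fC b z X
        - of_real (sqrt 2 / lam * sqrt (3 / 2 - y)) * (- \<i> * (eb b X * eF b X' - eb b X' * eF b X))
      = rhoC b z X * fC b z X' - rhoC b z X' * fC b z X"
    proof -
      have "complex_of_real (- g * t) * (N * f') - of_real (- g * t') * (N * f)
          - N * (- \<i> * (of_real e * f' - of_real e' * f))
        = (- of_real g * of_real t + \<i> * of_real e) * (N * f')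
          - (- of_real g * of_real t' + \<i> * of_real e') * (N * f)" for g t t' e e' N f f'
        by (simp add: algebra_simps)
      then show ?thesis
        unfolding rhoC_def radial components(4) y_def \<tau>_def \<tau>'_def v_def v'_def .
    qed
  qed
qed

text \<open>This is where the second-order equation for the profile enters.\<close>

lemma total_connection:
  "thetaC b z X + sigmaC b z X + rhoC b z X
     = \<i> * of_real (lam * hC b z X) + of_real (g1C z - g2C z + kC z) * cnj z * zC b z X"
proof -
  define y c m B c' \<mu> h where "y = yC z" and "c = cfun y" and "m = mfun y" and "B = bfun y"
    and "c' = deriv cfun y * Yp y" and "\<mu> = g1C z - g2C z" and "h = 2 * c' + c * \<mu>"
  define rr \<omega> \<tau> \<epsilon> Q where "rr = (cmod z)\<^sup>2" and "\<omega> = Im (cnj z * snd X)" and "\<tau> = Re (cnj z * snd X)"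
    and "\<epsilon> = ea b X + eb b X" and "Q = \<omega> + rr * betaC b z X"
  have y: "0 < 1 / 2 + y" "0 < 3 / 2 - y" using yC_mem by (auto simp: y_def)
  have c: "0 < c" using cfun_pos[OF yC_mem] by (simp add: c_def y_def)
  have \<beta>: "betaC b z X = m * \<omega> - c * \<epsilon>"
    by (simp add: betaC_def m_def c_def y_def \<omega>_def \<epsilon>_def)
  have rm: "rr * m = 2 * c - 1" and rB: "rr * B = 2 * y"
    using mult_mfun[OF r] mult_bfun[OF r] by (simp_all add: rr_def m_def c_def B_def y_def yC_def)
  have W: "1 - (1 / 2 - y)\<^sup>2 = (1 / 2 + y) * (3 / 2 - y)" by (simp add: power2_eq_square algebra_simps)
  have \<mu>: "\<mu> = Yp y * (1 - 2 * y) / ((1 / 2 + y) * (3 / 2 - y))"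
    unfolding \<mu>_def g1C_def g2C_def y_def[symmetric] using y by (simp add: diff_frac_eq) (simp add: algebra_simps)
  have ode0: "2 * rr * (c' + c * (1 / 2 - y) * Yp y / ((1 / 2 + y) * (3 / 2 - y))) + c = 1 / 2 - y"
    using profile_equation[OF r] unfolding W[symmetric]
    by (simp add: rr_def c'_def c_def y_def yC_def Yp_def)
  have \<mu>': "c * (1 / 2 - y) * Yp y / ((1 / 2 + y) * (3 / 2 - y)) = c * \<mu> / 2"
  proof -
    have "c * (1 / 2 - y) * P / D = c * (P * (1 - 2 * y) / D) / 2" for P D
      by (cases "D = 0") (simp_all add: field_simps)
    then show ?thesis unfolding \<mu> .
  qed
  have ode: "rr * h = 1 / 2 - y - c" using ode0[unfolded \<mu>'] by (simp add: h_def algebra_simps)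
  \<comment> \<open>Multiplying by r gives m + B + 2 h = 0 away from z = 0. At z = 0 the factor
    \<omega> vanishes, so the product form avoids a limit.\<close>
  have mB: "(m + B + 2 * h) * \<omega> = 0"
  proof (cases "z = 0")
    case True
    then show ?thesis by (simp add: \<omega>_def)
  next
    case False
    then have "rr \<noteq> 0" by (simp add: rr_def)
    moreover have "rr * (m + B + 2 * h) = 0"
      using rm rB ode by (simp add: algebra_simps)
    ultimately show ?thesis by simp
  qed
  have "c * (- betaC b z X - ea b X + eb b X - lam * hC b z X) = h * Q"
  proof -
    have l: "lam * hC b z X = - ((1 / 2 + y) * ea b X - (3 / 2 - y) * eb b X - B * \<omega>)"
      using lam_pos by (simp add: components(1) y_def B_def \<omega>_def)
    have "- betaC b z X - ea b X + eb b X - lam * hC b z X = (c - (1 / 2 - y)) * \<epsilon> - (m + B) * \<omega>"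
      unfolding l \<beta> by (simp add: \<epsilon>_def algebra_simps)
    also have "\<dots> = - (rr * h) * \<epsilon> + 2 * h * \<omega>"
      unfolding ode using mB by (simp add: algebra_simps)
    finally have "c * (- betaC b z X - ea b X + eb b X - lam * hC b z X) = c * (- (rr * h) * \<epsilon> + 2 * h * \<omega>)"
      by (rule arg_cong)
    also have "\<dots> = h * (2 * c * \<omega> - rr * c * \<epsilon>)" by (simp add: algebra_simps)
    also have "2 * c * \<omega> = \<omega> + rr * m * \<omega>" unfolding rm by (simp add: algebra_simps)
    finally show ?thesis by (simp add: Q_def \<beta> algebra_simps)
  qed
  then have im: "- betaC b z X - ea b X + eb b X - lam * hC b z X = (2 * kC z + \<mu>) * Q"
    using c by (simp add: h_def kC_def c_def c'_def y_def field_simps)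
  have zz: "cnj z * zC b z X = of_real \<tau> + \<i> * of_real Q"
    unfolding components(2) Q_def rr_def cmod_power2 \<tau>_def \<omega>_def
    by (simp add: complex_eq_iff algebra_simps power2_eq_square)
  have zz': "z * cnj (zC b z X) = of_real \<tau> - \<i> * of_real Q"
    using arg_cong[OF zz, of cnj] by simp
  have "thetaC b z X + sigmaC b z X + rhoC b z X
      = of_real (kC z) * (z * cnj (zC b z X)) + of_real (\<mu> * \<tau>)
        + \<i> * of_real (- betaC b z X - ea b X + eb b X)"
    unfolding thetaC_def sigmaC_def rhoC_def radial \<mu>_def \<tau>_def by (simp add: algebra_simps)
  also have "- betaC b z X - ea b X + eb b X = lam * hC b z X + (2 * kC z + \<mu>) * Q"
    using im by linarith
  also have "of_real (kC z) * (z * cnj (zC b z X)) + of_real (\<mu> * \<tau>)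
        + \<i> * of_real (lam * hC b z X + (2 * kC z + \<mu>) * Q)
      = \<i> * of_real (lam * hC b z X) + of_real (\<mu> + kC z) * (cnj z * zC b z X)"
    unfolding zz zz' by (simp add: algebra_simps)
  finally show ?thesis by (simp add: \<mu>_def mult.assoc)
qed

end

end

section \<open>The nearly parallel structure\<close>

text \<open>Moving each differentiated vector to the first slot, the twelve product-rule terms and
  the six bracket terms of the Koszul formula group into six differentials of the coframe.\<close>

lemma koszul_phi0:
  fixes a :: "nat \<Rightarrow> real^7" and d br :: "nat \<Rightarrow> nat \<Rightarrow> real^7"
  shows "(phi0 (d 0 1) (a 2) (a 3) + phi0 (a 1) (d 0 2) (a 3) + phi0 (a 1) (a 2) (d 0 3))
    - (phi0 (d 1 0) (a 2) (a 3) + phi0 (a 0) (d 1 2) (a 3) + phi0 (a 0) (a 2) (d 1 3))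
    + (phi0 (d 2 0) (a 1) (a 3) + phi0 (a 0) (d 2 1) (a 3) + phi0 (a 0) (a 1) (d 2 3))
    - (phi0 (d 3 0) (a 1) (a 2) + phi0 (a 0) (d 3 1) (a 2) + phi0 (a 0) (a 1) (d 3 2))
    - phi0 (br 0 1) (a 2) (a 3) + phi0 (br 0 2) (a 1) (a 3) - phi0 (br 0 3) (a 1) (a 2)
    - phi0 (br 1 2) (a 0) (a 3) + phi0 (br 1 3) (a 0) (a 2) - phi0 (br 2 3) (a 0) (a 1)
    = phi0 (d 0 1 - d 1 0 - br 0 1) (a 2) (a 3) - phi0 (d 0 2 - d 2 0 - br 0 2) (a 1) (a 3)
      + phi0 (d 0 3 - d 3 0 - br 0 3) (a 1) (a 2) + phi0 (d 1 2 - d 2 1 - br 1 2) (a 0) (a 3)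
      - phi0 (d 1 3 - d 3 1 - br 1 3) (a 0) (a 2) + phi0 (d 2 3 - d 3 2 - br 2 3) (a 0) (a 1)"
proof -
  have m2: "phi0 (a i) (d j k) w = - phi0 (d j k) (a i) w" for i j k w
    by (rule phi0_swap(1))
  have m3: "phi0 (a i) (a j) (d k l) = phi0 (d k l) (a i) (a j)" for i j k l
    using phi0_swap(1)[of "d k l" "a i" "a j"] phi0_swap(2)[of "a i" "d k l" "a j"] by simp
  show ?thesis
    by (simp add: m2 m3 phi0_simps)
qed

lemma pack_has_vector_derivative:
  "(f has_vector_derivative f') F \<Longrightarrow> ((\<lambda>s. pack (f s)) has_vector_derivative pack f') F"
  by (rule bounded_linear.has_vector_derivative) (simp add: linear_conv_bounded_linear[symmetric] pack_linear)

section \<open>Symmetries of the standard form and the slice representation\<close>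

lemma Im_cnj_mult_unit:
  assumes "cmod p = 1"
  shows "Im (cnj (p * a) * (p * b)) = Im (cnj a * b)"
proof -
  have "cnj (p * a) * (p * b) = (p * cnj p) * (cnj a * b)" by simp
  also have "p * cnj p = 1" using assms by (simp add: complex_norm_square[symmetric])
  finally show ?thesis by (simp only: mult_1)
qed

text \<open>The three phases form a diagonal element of SU(3), which preserves both omega and
  Omega.\<close>

lemma phi0_invariant:
  assumes "cmod p = 1" "cmod q = 1" "cmod r = 1" "p * q * r = 1"
  shows "phi0 (pack (h1, p * z1, q * g1, r * f1)) (pack (h2, p * z2, q * g2, r * f2)) (pack (h3, p * z3, q * g3, r * f3))
    = phi0 (pack (h1, z1, g1, f1)) (pack (h2, z2, g2, f2)) (pack (h3, z3, g3, f3))"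
proof -
  have "vform (p * z1, q * g1, r * f1) (p * z2, q * g2, r * f2) (p * z3, q * g3, r * f3)
      = p * q * r * vform (z1, g1, f1) (z2, g2, f2) (z3, g3, f3)"
    by (simp add: algebra_simps)
  then show ?thesis
    unfolding phi0_pack kform.simps Im_cnj_mult_unit[OF assms(1)] Im_cnj_mult_unit[OF assms(2)]
      Im_cnj_mult_unit[OF assms(3)] assms(4) by simp
qed

text \<open>The weights of Z, G and F under the singular circle are 4, - 6 and 2 and add up to 0;
  this is what the conjugate of E in G achieves. The number \<open>a\<close> is the contribution of
  Delta Q_8.\<close>

lemma cis_product:
  assumes "cnj a * a = 1"
  shows "cis (4 * \<theta>) * cnj (a * cis (6 * \<theta>)) * (a * cis (2 * \<theta>)) = 1"
proof -
  have "cis (4 * \<theta>) * cnj (a * cis (6 * \<theta>)) * (a * cis (2 * \<theta>))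
      = (cnj a * a) * (cis (4 * \<theta>) * cis (- (6 * \<theta>)) * cis (2 * \<theta>))"
    by (simp add: cis_cnj ac_simps)
  also have "cis (4 * \<theta>) * cis (- (6 * \<theta>)) * cis (2 * \<theta>) = 1"
    unfolding cis_mult by simp
  finally show ?thesis by (simp only: assms mult_1_right)
qed

text \<open>Conjugation preserves Re Omega and reverses omega, which the sign of h compensates. This
  symmetry accounts for (j,j) and (k,k).\<close>

lemma phi0_conjugate:
  "phi0 (pack (- h1, cnj z1, cnj g1, cnj f1)) (pack (- h2, cnj z2, cnj g2, cnj f2)) (pack (- h3, cnj z3, cnj g3, cnj f3))
    = phi0 (pack (h1, z1, g1, f1)) (pack (h2, z2, g2, f2)) (pack (h3, z3, g3, f3))"
  unfolding phi0_pack by (simp add: algebra_simps)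

lemma unit_complex_scale: "cmod p = 1 \<Longrightarrow> Re p * (Re p * a) + Im p * (Im p * a) = a"
  using cmod_power2[of p] by (simp add: mult.assoc[symmetric] distrib_right[symmetric] power2_eq_square)

lemma Ad_diagonal:
  assumes "cmod p = 1" "cmod q = 1"
  shows "fst (Ad ((p, 0), (q, 0)) (x, y)) $ 1 = x $ 1" "snd (Ad ((p, 0), (q, 0)) (x, y)) $ 1 = y $ 1"
    "Complex (fst (Ad ((p, 0), (q, 0)) (x, y)) $ 2) (fst (Ad ((p, 0), (q, 0)) (x, y)) $ 3) = p\<^sup>2 * Complex (x $ 2) (x $ 3)"
    "Complex (snd (Ad ((p, 0), (q, 0)) (x, y)) $ 2) (snd (Ad ((p, 0), (q, 0)) (x, y)) $ 3) = (cnj q)\<^sup>2 * Complex (y $ 2) (y $ 3)"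
proof -
  show "fst (Ad ((p, 0), (q, 0)) (x, y)) $ 1 = x $ 1" "snd (Ad ((p, 0), (q, 0)) (x, y)) $ 1 = y $ 1"
    using unit_complex_scale[OF assms(1), of "x $ 1"] unit_complex_scale[OF assms(2), of "y $ 1"]
    by (simp_all add: Ad_def frame_def coords_def gmult_def ginv_def qi_def qj_def qk_def algebra_simps)
  show "Complex (fst (Ad ((p, 0), (q, 0)) (x, y)) $ 2) (fst (Ad ((p, 0), (q, 0)) (x, y)) $ 3) = p\<^sup>2 * Complex (x $ 2) (x $ 3)"
    "Complex (snd (Ad ((p, 0), (q, 0)) (x, y)) $ 2) (snd (Ad ((p, 0), (q, 0)) (x, y)) $ 3) = (cnj q)\<^sup>2 * Complex (y $ 2) (y $ 3)"
    by (simp_all add: Ad_def frame_def coords_def gmult_def ginv_def qi_def qj_def qk_def complex_eq_iff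
        power2_eq_square algebra_simps)
qed

lemma Ad_antidiagonal:
  assumes "cmod p = 1" "cmod q = 1"
  shows "fst (Ad ((0, p), (0, q)) (x, y)) $ 1 = - x $ 1" "snd (Ad ((0, p), (0, q)) (x, y)) $ 1 = - y $ 1"
    "Complex (fst (Ad ((0, p), (0, q)) (x, y)) $ 2) (fst (Ad ((0, p), (0, q)) (x, y)) $ 3) = - p\<^sup>2 * cnj (Complex (x $ 2) (x $ 3))"
    "Complex (snd (Ad ((0, p), (0, q)) (x, y)) $ 2) (snd (Ad ((0, p), (0, q)) (x, y)) $ 3) = - (cnj q)\<^sup>2 * cnj (Complex (y $ 2) (y $ 3))"
proof -
  show "fst (Ad ((0, p), (0, q)) (x, y)) $ 1 = - x $ 1" "snd (Ad ((0, p), (0, q)) (x, y)) $ 1 = - y $ 1"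
    using unit_complex_scale[OF assms(1), of "x $ 1"] unit_complex_scale[OF assms(2), of "y $ 1"]
    by (simp_all add: Ad_def frame_def coords_def gmult_def ginv_def qi_def qj_def qk_def algebra_simps)
  show "Complex (fst (Ad ((0, p), (0, q)) (x, y)) $ 2) (fst (Ad ((0, p), (0, q)) (x, y)) $ 3) = - p\<^sup>2 * cnj (Complex (x $ 2) (x $ 3))"
    "Complex (snd (Ad ((0, p), (0, q)) (x, y)) $ 2) (snd (Ad ((0, p), (0, q)) (x, y)) $ 3) = - (cnj q)\<^sup>2 * cnj (Complex (y $ 2) (y $ 3))"
    by (simp_all add: Ad_def frame_def coords_def gmult_def ginv_def qi_def qj_def qk_def complex_eq_iff
        power2_eq_square algebra_simps)
qed

lemma slice_rep_cases:
  assumes "(k, \<sigma>) \<in> slice_rep b"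
  obtains (diagonal) \<theta> \<omega> where "\<omega> \<in> {1, -1, \<i>, -\<i>}"
      "k = ((cis (of_int (fst (slope b)) * \<theta>) * \<omega>, 0), (cis (of_int (snd (slope b)) * \<theta>) * \<omega>, 0))"
      "\<sigma> = (\<lambda>z. cis (4 * \<theta>) * z)"
    | (antidiagonal) \<theta> \<omega> where "\<omega> \<in> {1, -1, \<i>, -\<i>}"
      "k = ((0, cis (of_int (fst (slope b)) * \<theta>) * \<omega>), (0, cis (of_int (snd (slope b)) * \<theta>) * \<omega>))"
      "\<sigma> = (\<lambda>z. cis (4 * \<theta>) * cnj z)"
proof -
  obtain \<theta> h where h: "h \<in> DeltaQ8" "k = gmult (circ_at b \<theta>) h"
    "\<sigma> = (\<lambda>z. cis (4 * \<theta>) * (if h \<in> {(u, u) | u. u \<in> {qone, - qone, qi, - qi}} then z else cnj z))"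
    using assms unfolding slice_rep_def by blast
  obtain u where u: "h = (u, u)" "u \<in> {qone, - qone, qi, - qi, qj, - qj, qk, - qk}"
    using h(1) unfolding DeltaQ8_def by blast
  show ?thesis
  proof (cases "u \<in> {qone, - qone, qi, - qi}")
    case True
    then obtain \<omega> where \<omega>: "\<omega> \<in> {1, -1, \<i>, -\<i>}" "u = (\<omega>, 0)"
      by (auto simp: qone_def qi_def)
    show ?thesis
      by (rule diagonal[OF \<omega>(1), of \<theta>]) (use True \<omega>(2) u h in \<open>auto simp: gmult_def circ_at_def circ_def\<close>)
  next
    case False
    then obtain \<omega> where \<omega>: "\<omega> \<in> {1, -1, \<i>, -\<i>}" "u = (0, \<omega>)"
      using u(2) by (auto simp: qj_def qk_def)
    show ?thesis
      by (rule antidiagonal[OF \<omega>(1), of \<theta>]) (use False \<omega>(2) u h in \<open>auto simp: gmult_def circ_at_def circ_def\<close>)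
  qed
qed

text \<open>The frame of the second factor has the i- and k-directions reversed, so q rotates its
  plane by the square of cnj q. The slopes (3, -1) and (1, -3) then give E and F the same weights 6
  and 2 at both ends.\<close>

lemma e_diagonal:
  assumes "\<omega> \<in> {1, -1, \<i>, -\<i>}"
    and k: "k = ((cis (of_int (fst (slope b)) * \<theta>) * \<omega>, 0), (cis (of_int (snd (slope b)) * \<theta>) * \<omega>, 0))"
  shows "ea b (Ad k \<xi>, w) = ea b (\<xi>, v)" "eb b (Ad k \<xi>, w) = eb b (\<xi>, v)"
    "eE b (Ad k \<xi>, w) = \<omega>\<^sup>2 * cis (6 * \<theta>) * eE b (\<xi>, v)"
    "eF b (Ad k \<xi>, w) = \<omega>\<^sup>2 * cis (2 * \<theta>) * eF b (\<xi>, v)"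
proof -
  obtain x y where \<xi>: "\<xi> = (x, y)" by (cases \<xi>)
  have n: "cmod (cis a * \<omega>) = 1" for a using assms(1) by (auto simp: norm_mult)
  have cw: "(cnj \<omega>)\<^sup>2 = \<omega>\<^sup>2" using assms(1) by auto
  have c: "(cis (a * \<theta>) * \<omega>)\<^sup>2 = \<omega>\<^sup>2 * cis (2 * a * \<theta>)" "(cnj (cis (a * \<theta>) * \<omega>))\<^sup>2 = \<omega>\<^sup>2 * cis (- 2 * a * \<theta>)" for a
    by (simp_all add: power_mult_distrib cis_cnj Complex.DeMoivre cw mult.assoc)
  note A = Ad_diagonal[OF n n, of "of_int (fst (slope b)) * \<theta>" "of_int (snd (slope b)) * \<theta>" x y, folded k \<xi>]
  show "ea b (Ad k \<xi>, w) = ea b (\<xi>, v)" "eb b (Ad k \<xi>, w) = eb b (\<xi>, v)"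
    "eE b (Ad k \<xi>, w) = \<omega>\<^sup>2 * cis (6 * \<theta>) * eE b (\<xi>, v)"
    "eF b (Ad k \<xi>, w) = \<omega>\<^sup>2 * cis (2 * \<theta>) * eF b (\<xi>, v)"
    using A unfolding c by (cases b; simp add: e_defs \<xi>)+
qed

lemma e_antidiagonal:
  assumes "\<omega> \<in> {1, -1, \<i>, -\<i>}"
    and k: "k = ((0, cis (of_int (fst (slope b)) * \<theta>) * \<omega>), (0, cis (of_int (snd (slope b)) * \<theta>) * \<omega>))"
  shows "ea b (Ad k \<xi>, w) = - ea b (\<xi>, v)" "eb b (Ad k \<xi>, w) = - eb b (\<xi>, v)"
    "eE b (Ad k \<xi>, w) = - \<omega>\<^sup>2 * cis (6 * \<theta>) * cnj (eE b (\<xi>, v))"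
    "eF b (Ad k \<xi>, w) = - \<omega>\<^sup>2 * cis (2 * \<theta>) * cnj (eF b (\<xi>, v))"
proof -
  obtain x y where \<xi>: "\<xi> = (x, y)" by (cases \<xi>)
  have n: "cmod (cis a * \<omega>) = 1" for a using assms(1) by (auto simp: norm_mult)
  have cw: "(cnj \<omega>)\<^sup>2 = \<omega>\<^sup>2" using assms(1) by auto
  have c: "(cis (a * \<theta>) * \<omega>)\<^sup>2 = \<omega>\<^sup>2 * cis (2 * a * \<theta>)" "(cnj (cis (a * \<theta>) * \<omega>))\<^sup>2 = \<omega>\<^sup>2 * cis (- 2 * a * \<theta>)" for a
    by (simp_all add: power_mult_distrib cis_cnj Complex.DeMoivre cw mult.assoc)
  note A = Ad_antidiagonal[OF n n, of "of_int (fst (slope b)) * \<theta>" "of_int (snd (slope b)) * \<theta>" x y, folded k \<xi>]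
  show "ea b (Ad k \<xi>, w) = - ea b (\<xi>, v)" "eb b (Ad k \<xi>, w) = - eb b (\<xi>, v)"
    "eE b (Ad k \<xi>, w) = - \<omega>\<^sup>2 * cis (6 * \<theta>) * cnj (eE b (\<xi>, v))"
    "eF b (Ad k \<xi>, w) = - \<omega>\<^sup>2 * cis (2 * \<theta>) * cnj (eF b (\<xi>, v))"
    using A unfolding c by (cases b; simp add: e_defs \<xi>)+
qed

context scale
begin

definition phi :: "orbit_end \<Rightarrow> pt \<Rightarrow> form3" where
  "phi b x X X' X'' = phi0 (pack (covec b (snd x) X)) (pack (covec b (snd x) X')) (pack (covec b (snd x) X''))"

lemma tube_J:
  assumes "x \<in> tube R" "R \<le> 2 * T"
  shows "(cmod (snd x))\<^sup>2 \<in> J"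
  by (rule square_mem_J) (use assms in \<open>auto simp: tube_def\<close>)

lemma dir_deriv_phi:
  assumes "(cmod (snd x))\<^sup>2 \<in> J"
  shows "dir_deriv X (\<lambda>x. phi b x X1 X2 X3) x =
     phi0 (pack (dcovec b (snd x) (snd X) X1)) (pack (covec b (snd x) X2)) (pack (covec b (snd x) X3))
   + phi0 (pack (covec b (snd x) X1)) (pack (dcovec b (snd x) (snd X) X2)) (pack (covec b (snd x) X3))
   + phi0 (pack (covec b (snd x) X1)) (pack (covec b (snd x) X2)) (pack (dcovec b (snd x) (snd X) X3))"
  unfolding dir_deriv_def phi_def snd_conv
  by (rule DERIV_imp_deriv)
    (use DERIV_phi0[OF covec_has_derivative[OF assms, THEN pack_has_vector_derivative]
      covec_has_derivative[OF assms, THEN pack_has_vector_derivative]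
      covec_has_derivative[OF assms, THEN pack_has_vector_derivative]] in simp)

lemma ext_deriv_phi:
  fixes X :: "nat \<Rightarrow> tvec" and b :: orbit_end
  assumes r: "(cmod (snd x))\<^sup>2 \<in> J"
  defines "a \<equiv> \<lambda>i. pack (covec b (snd x) (X i))" and "d \<equiv> \<lambda>i j. pack (dform b (snd x) (X i) (X j))"
  shows "ext_deriv (phi b) x (X 0) (X 1) (X 2) (X 3) =
    phi0 (d 0 1) (a 2) (a 3) - phi0 (d 0 2) (a 1) (a 3) + phi0 (d 0 3) (a 1) (a 2)
    + phi0 (d 1 2) (a 0) (a 3) - phi0 (d 1 3) (a 0) (a 2) + phi0 (d 2 3) (a 0) (a 1)"
proof -
  have d: "d i j = pack (dcovec b (snd x) (snd (X i)) (X j)) - pack (dcovec b (snd x) (snd (X j)) (X i))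
      - pack (covec b (snd x) (vbracket (X i) (X j)))" for i j
    unfolding d_def dform_def by (simp add: linear_diff[OF pack_linear])
  show ?thesis
    unfolding ext_deriv_def dir_deriv_phi[OF r] d a_def
    unfolding phi_def
    by (rule koszul_phi0[of "\<lambda>i j. pack (dcovec b (snd x) (snd (X i)) (X j))"
          "\<lambda>i. pack (covec b (snd x) (X i))" "\<lambda>i j. pack (covec b (snd x) (vbracket (X i) (X j)))"])
qed

text \<open>From d eta = lambda/2 omega and d omega = 0 the first summand of phi contributes
  lambda/2 omega^2; from d Omega = i lambda eta wedge Omega the second contributes - lambda eta
  wedge Im Omega. Together they are lambda times the dual form.\<close>

lemma ext_deriv_phi_eq:
  fixes X :: "nat \<Rightarrow> tvec"
  assumes r: "(cmod (snd x))\<^sup>2 \<in> J"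
  shows "ext_deriv (phi b) x (X 0) (X 1) (X 2) (X 3) =
    lam * psi0 (pack (covec b (snd x) (X 0))) (pack (covec b (snd x) (X 1)))
      (pack (covec b (snd x) (X 2))) (pack (covec b (snd x) (X 3)))"
proof -
  define z h Z G F where "z = snd x" and "h = (\<lambda>i. hC b z (X i))" and "Z = (\<lambda>i. zC b z (X i))"
    and "G = (\<lambda>i. gC b z (X i))" and "F = (\<lambda>i. fC b z (X i))"
  define \<theta> \<sigma> \<rho> where "\<theta> = (\<lambda>i. thetaC b z (X i))" and "\<sigma> = (\<lambda>i. sigmaC b z (X i))" and "\<rho> = (\<lambda>i. rhoC b z (X i))"
  define u where "u = (\<lambda>i. (Z i, G i, F i))"
  define d where "d = (\<lambda>i j. (\<theta> i * Z j - \<theta> j * Z i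
      + of_real (g1C z) * z * (cnj (G i) * G j - cnj (G j) * G i)
      + - of_real (g2C z) * z * (cnj (F i) * F j - cnj (F j) * F i),
      \<sigma> i * G j - \<sigma> j * G i, \<rho> i * F j - \<rho> j * F i))"
  note r' = r[folded z_def]
  have cov: "covec b z (X i) = (h i, u i)" for i
    by (simp add: covec_split h_def u_def Z_def G_def F_def)
  have dd: "dform b z (X i) (X j) = (lam / 2 * kform (u i) (u j), d i j)" for i j
    unfolding structure_equations[OF r'] by (simp add: cov d_def \<theta>_def \<sigma>_def \<rho>_def Z_def G_def F_def)
  have k: "kform (d i j) (u k) - kform (d i k) (u j) + kform (d j k) (u i) = 0" for i j k
    unfolding d_def u_def \<theta>_def thetaC_def \<sigma>_def sigmaC_def \<rho>_def rhoC_def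
    using kform_closing[where \<beta> = "\<lambda>i. betaC b z (X i)" and \<kappa> = "kC z" and z = z and Z = Z and ?\<gamma>1.0 = "g1C z"
        and ?e1.0 = "\<lambda>i. ea b (X i)" and ?\<gamma>2.0 = "g2C z" and ?e2.0 = "\<lambda>i. eb b (X i)" and G = G and F = F
        and i = i and j = j and k = k]
    unfolding Z_def by simp
  have "vform (d 0 1) (u 2) (u 3) - vform (d 0 2) (u 1) (u 3) + vform (d 0 3) (u 1) (u 2)
    + vform (d 1 2) (u 0) (u 3) - vform (d 1 3) (u 0) (u 2) + vform (d 2 3) (u 0) (u 1)
    = (\<theta> 0 + \<sigma> 0 + \<rho> 0) * vform (u 1) (u 2) (u 3) - (\<theta> 1 + \<sigma> 1 + \<rho> 1) * vform (u 0) (u 2) (u 3)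
      + (\<theta> 2 + \<sigma> 2 + \<rho> 2) * vform (u 0) (u 1) (u 3) - (\<theta> 3 + \<sigma> 3 + \<rho> 3) * vform (u 0) (u 1) (u 2)"
    unfolding d_def u_def by (rule vform_closing)
  also have "\<dots> = \<i> * of_real lam * (h 0 * vform (u 1) (u 2) (u 3) - h 1 * vform (u 0) (u 2) (u 3)
        + h 2 * vform (u 0) (u 1) (u 3) - h 3 * vform (u 0) (u 1) (u 2))
      + of_real (g1C z - g2C z + kC z) * cnj z * (Z 0 * vform (u 1) (u 2) (u 3) - Z 1 * vform (u 0) (u 2) (u 3)
        + Z 2 * vform (u 0) (u 1) (u 3) - Z 3 * vform (u 0) (u 1) (u 2))"
  proof -
    have t: "\<theta> i + \<sigma> i + \<rho> i = \<i> * of_real (lam * h i) + of_real (g1C z - g2C z + kC z) * cnj z * Z i" for i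
      unfolding \<theta>_def \<sigma>_def \<rho>_def h_def Z_def by (rule total_connection[OF r'])
    have gen: "(\<i> * of_real (lam * h0) + k * c * z0) * v0 - (\<i> * of_real (lam * h1) + k * c * z1) * v1
        + (\<i> * of_real (lam * h2) + k * c * z2) * v2 - (\<i> * of_real (lam * h3) + k * c * z3) * v3
      = \<i> * of_real lam * (h0 * v0 - h1 * v1 + h2 * v2 - h3 * v3) + k * c * (z0 * v0 - z1 * v1 + z2 * v2 - z3 * v3)"
      for h0 h1 h2 h3 :: real and k c z0 z1 z2 z3 v0 v1 v2 v3 :: complex
      by (simp add: algebra_simps)
    show ?thesis unfolding t by (rule gen)
  qed
  also have "Z 0 * vform (u 1) (u 2) (u 3) - Z 1 * vform (u 0) (u 2) (u 3)
        + Z 2 * vform (u 0) (u 1) (u 3) - Z 3 * vform (u 0) (u 1) (u 2) = 0"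
    unfolding u_def by (rule vform_dependent)
  finally have v: "Re (vform (d 0 1) (u 2) (u 3)) - Re (vform (d 0 2) (u 1) (u 3)) + Re (vform (d 0 3) (u 1) (u 2))
    + Re (vform (d 1 2) (u 0) (u 3)) - Re (vform (d 1 3) (u 0) (u 2)) + Re (vform (d 2 3) (u 0) (u 1))
    = - lam * (h 0 * Im (vform (u 1) (u 2) (u 3)) - h 1 * Im (vform (u 0) (u 2) (u 3))
        + h 2 * Im (vform (u 0) (u 1) (u 3)) - h 3 * Im (vform (u 0) (u 1) (u 2)))"
    (is "?l = _")
  proof -
    assume e: "vform (d 0 1) (u 2) (u 3) - vform (d 0 2) (u 1) (u 3) + vform (d 0 3) (u 1) (u 2)
    + vform (d 1 2) (u 0) (u 3) - vform (d 1 3) (u 0) (u 2) + vform (d 2 3) (u 0) (u 1)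
    = \<i> * of_real lam * (h 0 * vform (u 1) (u 2) (u 3) - h 1 * vform (u 0) (u 2) (u 3)
        + h 2 * vform (u 0) (u 1) (u 3) - h 3 * vform (u 0) (u 1) (u 2))
      + of_real (g1C z - g2C z + kC z) * cnj z * 0"
    show ?thesis using arg_cong[OF e, of Re] by simp
  qed
  have "lam / 2 * (kform (u 0) (u 1) * kform (u 2) (u 3) - kform (u 0) (u 2) * kform (u 1) (u 3) + kform (u 0) (u 3) * kform (u 1) (u 2)
       + kform (u 1) (u 2) * kform (u 0) (u 3) - kform (u 1) (u 3) * kform (u 0) (u 2) + kform (u 2) (u 3) * kform (u 0) (u 1))
     = lam * (kform (u 0) (u 1) * kform (u 2) (u 3) - kform (u 0) (u 2) * kform (u 1) (u 3) + kform (u 0) (u 3) * kform (u 1) (u 2))"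
    by (simp add: algebra_simps)
  moreover have "h 3 * (kform (d 0 1) (u 2) - kform (d 0 2) (u 1) + kform (d 1 2) (u 0)) = 0"
    "h 2 * (kform (d 0 1) (u 3) - kform (d 0 3) (u 1) + kform (d 1 3) (u 0)) = 0"
    "h 1 * (kform (d 0 2) (u 3) - kform (d 0 3) (u 2) + kform (d 2 3) (u 0)) = 0"
    "h 0 * (kform (d 1 2) (u 3) - kform (d 1 3) (u 2) + kform (d 2 3) (u 1)) = 0"
    by (simp_all only: k mult_zero_right)
  ultimately show ?thesis
    unfolding ext_deriv_phi[OF r] z_def[symmetric] cov dd phi0_pack psi0_pack using v
    by (simp add: algebra_simps)
qed

lemma covec_surj:
  assumes r: "(cmod z)\<^sup>2 \<in> J"
  shows "surj (covec b z)"
proof (rule surjI)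
  define y c m where "y = yC z" and "c = cfun y" and "m = mfun y"
  have y: "0 < 1 / 2 + y" "0 < 3 / 2 - y" using yC_mem[OF r] by (auto simp: y_def)
  have c: "0 < c" using cfun_pos[OF yC_mem[OF r]] by (simp add: c_def y_def)
  have rm: "(cmod z)\<^sup>2 * m = 2 * c - 1" using mult_mfun[OF r] by (simp add: m_def c_def y_def yC_def)
  define n n' where "n = sqrt 2 / lam * sqrt (1 / 2 + y)" and "n' = sqrt 2 / lam * sqrt (3 / 2 - y)"
  have n: "n \<noteq> 0" "n' \<noteq> 0" using y lam_pos by (auto simp: n_def n'_def)
  \<comment> \<open>The preimage is taken with e^1 + e^2 = 0, where c drops out of Z. Then Im (cnj z
    * Z) is 1 + r m = 2 c times Im (cnj z * dz), which determines dz; the common value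
    \<open>?s\<close> follows from h because (1/2 + y) + (3/2 - y) = 2.\<close>
  let ?v = "\<lambda>z0. z0 - \<i> * z * of_real (m * (Im (cnj z * z0) / (2 * c)))"
  let ?s = "\<lambda>h z0. (bfun y * (Im (cnj z * z0) / (2 * c)) - lam * h) / 2"
  let ?x = "\<lambda>h z0 g. vector [?s h z0, Re (cnj g / of_real n), Im (cnj g / of_real n)] :: real^3"
  let ?y = "\<lambda>h z0 f. vector [- ?s h z0, Re (f / of_real n'), Im (f / of_real n')] :: real^3"
  let ?X = "\<lambda>(h, z0, g, f). ((if b = Start then (?x h z0 g, ?y h z0 f) else (?y h z0 f, ?x h z0 g)), ?v z0)"
  fix w :: covec7
  obtain h z0 g f where w: "w = (h, z0, g, f)" by (metis surj_pair)
  have om: "Im (cnj z * ?v z0) = Im (cnj z * z0) / (2 * c)"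
  proof -
    have "Im (cnj z * ?v z0) = Im (cnj z * z0) - (cmod z)\<^sup>2 * m * (Im (cnj z * z0) / (2 * c))"
      unfolding cmod_power2 by (simp add: algebra_simps power2_eq_square)
    also have "\<dots> = Im (cnj z * z0) / (2 * c)" unfolding rm using c by (simp add: field_simps)
    finally show ?thesis .
  qed
  have e: "ea b (?X w) = ?s h z0" "eb b (?X w) = - ?s h z0" "eE b (?X w) = cnj g / of_real n" "eF b (?X w) = f / of_real n'"
    by (cases b; simp add: w e_defs complex_eq_iff)+
  have sn: "snd (?X w) = ?v z0" by (simp add: w)
  have key: "- (1 / lam) * ((1 / 2 + y) * ((q - lam * h) / 2) - (3 / 2 - y) * - ((q - lam * h) / 2) - q) = h" for q
    using lam_pos by (simp add: field_simps)
  show "covec b z (?X w) = w"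
    unfolding covec_def Let_def e sn om yC_def[symmetric] y_def[symmetric] c_def[symmetric] m_def[symmetric]
      n_def[symmetric] n'_def[symmetric] key
    using n by (simp add: w)
qed

lemma phi_adapted:
  assumes "(cmod (snd x))\<^sup>2 \<in> J"
  shows "adapted (phi b x) (\<lambda>X. pack (covec b (snd x) X))"
  unfolding adapted_def
proof (intro conjI allI)
  show "linear (\<lambda>X. pack (covec b (snd x) X))"
    using linear_compose[OF covec_linear pack_linear] by (simp add: o_def)
  have "surj pack" using pack_onto by (auto simp: surj_def)
  then show "surj (\<lambda>X. pack (covec b (snd x) X))"
    using comp_surj[OF covec_surj[OF assms]] by (simp add: o_def)
qed (simp add: phi_def)

lemma phi_positive: "R \<le> 2 * T \<Longrightarrow> positive_form R (phi b)"
  unfolding positive_form_def using phi_adapted tube_J by blast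

lemma phi_nearly_parallel:
  "R \<le> 2 * T \<Longrightarrow> nearly_parallel lam R phi"
  unfolding nearly_parallel_def
proof (intro conjI allI ballI exI)
  fix b x assume R: "R \<le> 2 * T" and x: "x \<in> tube R"
  let ?A = "\<lambda>X. pack (covec b (snd x) X)"
  note J = tube_J[OF x R]
  show "is_hodge_dual (phi b x) (\<lambda>X Y Z W. psi0 (?A X) (?A Y) (?A Z) (?A W))"
    unfolding is_hodge_dual_def using phi_adapted[OF J] by blast
  show "ext_deriv (phi b) x X Y Z W = lam * psi0 (?A X) (?A Y) (?A Z) (?A W)" for X Y Z W
    using ext_deriv_phi_eq[OF J, of b "(!) [X, Y, Z, W]"] by (simp add: numeral_2_eq_2 numeral_3_eq_3)
qed (use lam_pos in auto)

lemma phi_alt: "alt_trilinear (phi b x)"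
proof -
  have l: "linear (\<lambda>X. pack (covec b (snd x) X))"
    using linear_compose[OF covec_linear pack_linear] by (simp add: o_def)
  show ?thesis
    unfolding alt_trilinear_def phi_def
    using linear_compose[OF l phi0_linear(1)] linear_compose[OF l phi0_linear(2)] linear_compose[OF l phi0_linear(3)]
    by (auto simp: phi0_same o_def)
qed

lemma covec_smooth:
  fixes b :: orbit_end and X :: tvec
  defines "V \<equiv> {x::pt. (cmod (snd x))\<^sup>2 \<in> J}"
  shows "smooth_fun (\<lambda>x. pack (covec b (snd x) X) $ i) V"
proof -
  let ?y = "\<lambda>x::pt. Y ((cmod (snd x))\<^sup>2)"
  let ?\<beta> = "\<lambda>X x. mfun (?y x) * Im (cnj (snd x) * snd X) - cfun (?y x) * (ea b X + eb b X)"
  have "open ((\<lambda>x::pt. (cmod (snd x))\<^sup>2) -` J)"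
    by (rule open_vimage[OF J_open]) (intro continuous_intros)
  then have o: "open V" by (simp add: V_def vimage_def)
  have lin: "smooth_fun (\<lambda>x::pt. Re (snd x)) V" "smooth_fun (\<lambda>x::pt. Im (snd x)) V"
    by (intro smooth_fun_bounded_linear[OF o] bounded_linear_compose[OF bounded_linear_Re bounded_linear_snd]
        bounded_linear_compose[OF bounded_linear_Im bounded_linear_snd])+
  have q: "smooth_fun (\<lambda>x::pt. (cmod (snd x))\<^sup>2) V"
    unfolding cmod_power2 by (intro smooth_fun_add smooth_fun_power lin)
  have y: "smooth_fun (\<lambda>x::pt. ?y x) V"
    by (rule smooth_fun_compose[OF Y_smooth q]) (simp add: V_def)
  have f: "smooth_fun (\<lambda>x::pt. f (?y x)) V" if "smooth_fun f U" for f
    by (rule smooth_fun_compose[OF that y]) (use Y_mem in \<open>auto simp: V_def\<close>)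
  have yU: "?y x \<in> U" if "x \<in> V" for x :: pt
    using that Y_mem by (auto simp: V_def)
  have om: "smooth_fun (\<lambda>x::pt. Im (cnj (snd x) * v)) V" for v
    by (simp, intro smooth_fun_add smooth_fun_diff smooth_fun_mult smooth_fun_minus lin smooth_fun_const o)
  have \<beta>: "smooth_fun (\<lambda>x::pt. ?\<beta> X x) V" for X
    by (intro smooth_fun_diff smooth_fun_mult f mfun_smooth cfun_smooth om smooth_fun_const o)
  have s1: "smooth_fun (\<lambda>x::pt. sqrt (1 / 2 + ?y x)) V"
    by (intro smooth_fun_sqrt smooth_fun_add smooth_fun_const y o) (use yU in fastforce)
  have s2: "smooth_fun (\<lambda>x::pt. sqrt (3 / 2 - ?y x)) V"
    by (intro smooth_fun_sqrt smooth_fun_diff smooth_fun_const y o) (use yU in fastforce)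
  have "\<forall>i. smooth_fun (\<lambda>x::pt. pack (covec b (snd x) X) $ i) V"
    unfolding forall_7 covec_def Let_def pack_nth
  proof (intro conjI)
    show "smooth_fun (\<lambda>x::pt. - (1 / lam) * ((1 / 2 + ?y x) * ea b X -
        (3 / 2 - ?y x) * eb b X - bfun (?y x) * Im (cnj (snd x) * snd X))) V"
      by (intro smooth_fun_mult smooth_fun_diff smooth_fun_add smooth_fun_const y o f bfun_smooth om)
    have "smooth_fun (\<lambda>x::pt. Re (snd X) - Im (snd x) * (?\<beta> X x)) V"
      by (intro smooth_fun_diff[OF smooth_fun_const[OF o]] smooth_fun_mult[OF lin(2) \<beta>])
    then show "smooth_fun (\<lambda>x::pt. Re (snd X + \<i> * snd x * of_real (?\<beta> X x))) V"
      by (rule smooth_fun_cong) simp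
    have "smooth_fun (\<lambda>x::pt. Im (snd X) + Re (snd x) * (?\<beta> X x)) V"
      by (intro smooth_fun_add[OF smooth_fun_const[OF o]] smooth_fun_mult[OF lin(1) \<beta>])
    then show "smooth_fun (\<lambda>x::pt. Im (snd X + \<i> * snd x * of_real (?\<beta> X x))) V"
      by (rule smooth_fun_cong) simp
    have c: "smooth_fun (\<lambda>x::pt. Re (of_real (k * g x) * w)) V" "smooth_fun (\<lambda>x::pt. Im (of_real (k * g x) * w)) V"
      if "smooth_fun g V" for g k w
      by (simp; intro smooth_fun_mult smooth_fun_const o that)+
    show "smooth_fun (\<lambda>x::pt. Re (of_real (sqrt 2 / lam * sqrt (1 / 2 + ?y x)) * cnj (eE b X))) V"
      "smooth_fun (\<lambda>x::pt. Im (of_real (sqrt 2 / lam * sqrt (1 / 2 + ?y x)) * cnj (eE b X))) V"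
      "smooth_fun (\<lambda>x::pt. Re (of_real (sqrt 2 / lam * sqrt (3 / 2 - ?y x)) * eF b X)) V"
      "smooth_fun (\<lambda>x::pt. Im (of_real (sqrt 2 / lam * sqrt (3 / 2 - ?y x)) * eF b X)) V"
      by (rule c[OF s1] c[OF s2])+
  qed
  then show ?thesis by blast
qed

lemma phi_smooth:
  assumes R: "R \<le> 2 * T"
  shows "smooth_form R (phi b)"
  unfolding smooth_form_def smooth_on_set_def
proof (intro conjI ballI allI phi_alt)
  fix X1 X2 X3 x assume x: "x \<in> tube R"
  define V :: "pt set" where "V = {x. (cmod (snd x))\<^sup>2 \<in> J}"
  have "smooth_fun (\<lambda>x. phi b x X1 X2 X3) V"
    unfolding phi_def V_def by (intro smooth_fun_phi0 covec_smooth)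
  moreover have "x \<in> V" using tube_J[OF x R] by (simp add: V_def)
  ultimately show "\<exists>W F. open W \<and> x \<in> W \<and> (\<forall>k. Ck_on k F W) \<and> (\<forall>y\<in>W \<inter> tube R. F y = phi b y X1 X2 X3)"
    unfolding smooth_fun_def by blast
qed

text \<open>The scalar coefficients depend on z only through |z|^2 and Im (cnj z * dz), which
  rotations of the disc preserve.\<close>

lemma covec_rotate:
  assumes "cmod p = 1" "ea b X' = ea b X" "eb b X' = eb b X" "snd X' = p * snd X"
    "eE b X' = q * eE b X" "eF b X' = s * eF b X"
  shows "covec b (p * z) X' = (hC b z X, p * zC b z X, cnj q * gC b z X, s * fC b z X)"
  unfolding covec_def Let_def assms Im_cnj_mult_unit[OF assms(1)] norm_mult components betaC_def yC_def
  by (simp add: algebra_simps)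

text \<open>Conjugating the disc reverses Im (cnj z * dz) together with e^1 and e^2, so beta and h
  change sign.\<close>

lemma covec_reflect:
  assumes "cmod p = 1" "ea b X' = - ea b X" "eb b X' = - eb b X" "snd X' = p * cnj (snd X)"
    "eE b X' = q * cnj (eE b X)" "eF b X' = s * cnj (eF b X)"
  shows "covec b (p * cnj z) X' = (- hC b z X, p * cnj (zC b z X), cnj q * cnj (gC b z X), s * cnj (fC b z X))"
proof -
  have u: "Im (cnj (p * cnj a) * (p * cnj c)) = - Im (cnj a * c)" for a c
    unfolding Im_cnj_mult_unit[OF assms(1)] by simp
  show ?thesis
    unfolding covec_def Let_def assms u norm_mult components betaC_def yC_def by (simp add: algebra_simps)
qed

lemma phi_basic:
  assumes R: "R \<le> 2 * T"
  shows "basic_form b R (phi b)"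
  unfolding basic_form_def
proof (intro conjI ballI allI impI)
  fix g k\<sigma> and z :: complex assume z: "z \<in> ball 0 R" and k: "k\<sigma> \<in> slice_rep b"
  obtain k \<sigma> where k\<sigma>: "k\<sigma> = (k, \<sigma>)" by (cases k\<sigma>)
  note split = covec_split
  from k[unfolded k\<sigma>]
  have "phi b (gmult g k, z) (\<xi>, v) (\<eta>, w) (\<zeta>, u) = phi b (g, \<sigma> z) (Ad k \<xi>, \<sigma> v) (Ad k \<eta>, \<sigma> w) (Ad k \<zeta>, \<sigma> u)"
    for \<xi> v \<eta> w \<zeta> u
  proof (cases rule: slice_rep_cases)
    case (diagonal \<theta> \<omega>)
    have w: "cmod \<omega> = 1" "cnj (\<omega>\<^sup>2) * \<omega>\<^sup>2 = 1" using diagonal(1) by (auto simp: norm_power)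
    have c: "covec b (cis (4 * \<theta>) * z) (Ad k \<xi>, cis (4 * \<theta>) * v) = (hC b z (\<xi>, v), cis (4 * \<theta>) * zC b z (\<xi>, v),
        cnj (\<omega>\<^sup>2 * cis (6 * \<theta>)) * gC b z (\<xi>, v), \<omega>\<^sup>2 * cis (2 * \<theta>) * fC b z (\<xi>, v))" for \<xi> v
      by (rule covec_rotate) (use e_diagonal[OF diagonal(1,2)] in auto)
    show ?thesis
      unfolding phi_def snd_conv diagonal(3) c
      by (subst phi0_invariant[OF _ _ _ cis_product[OF w(2)]]) (use w in \<open>auto simp: norm_mult norm_power split[symmetric]\<close>)
  next
    case (antidiagonal \<theta> \<omega>)
    have w: "cmod \<omega> = 1" "cnj (\<omega>\<^sup>2) * \<omega>\<^sup>2 = 1" using antidiagonal(1) by (auto simp: norm_power)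
    have c: "covec b (cis (4 * \<theta>) * cnj z) (Ad k \<xi>, cis (4 * \<theta>) * cnj v) = (- hC b z (\<xi>, v), cis (4 * \<theta>) * cnj (zC b z (\<xi>, v)),
        cnj (- \<omega>\<^sup>2 * cis (6 * \<theta>)) * cnj (gC b z (\<xi>, v)), (- \<omega>\<^sup>2 * cis (2 * \<theta>)) * cnj (fC b z (\<xi>, v)))" for \<xi> v
      by (rule covec_reflect) (use e_antidiagonal[OF antidiagonal(1,2)] in auto)
    show ?thesis
      unfolding phi_def snd_conv antidiagonal(3) c
      by (subst phi0_invariant[OF _ _ _ cis_product[of "- \<omega>\<^sup>2"]])
        (use w in \<open>auto simp: norm_mult norm_power phi0_conjugate split[symmetric]\<close>)
  qed
  then show "case k\<sigma> of (k, \<sigma>) \<Rightarrow> \<forall>\<xi> v \<eta> w \<zeta> u. phi b (gmult g k, z) (\<xi>, v) (\<eta>, w) (\<zeta>, u)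
      = phi b (g, \<sigma> z) (Ad k \<xi>, \<sigma> v) (Ad k \<eta>, \<sigma> w) (Ad k \<zeta>, \<sigma> u)"
    by (simp add: k\<sigma>)
next
  fix g \<xi> Y' Z' and z :: complex assume g: "g \<in> Sp1Sp1" and z: "z \<in> ball 0 R"
    and fr: "frame \<xi> = ((of_int (fst (slope b)) * \<i>, 0), of_int (snd (slope b)) * \<i>, 0)"
  have r: "(cmod z)\<^sup>2 \<in> J" using tube_J[of "(g, z)" R] g z R by (simp add: tube_def)
  have \<xi>: "\<xi> = coords ((of_int (fst (slope b)) * \<i>, 0), of_int (snd (slope b)) * \<i>, 0)"
    unfolding fr[symmetric] by (simp add: coords_frame)
  \<comment> \<open>As e_1 = - i/2 and e_2 = i/2, the vector (3 i, - i) has the coordinates - 6 and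
    - 2, and so has (i, - 3 i) with the factors exchanged. These values, with the normal component -
    4 i z, make beta = 4 and thus Z = 0.\<close>
  have e: "ea b (\<xi>, v) = - 6" "eb b (\<xi>, v) = - 2" "eE b (\<xi>, v) = 0" "eF b (\<xi>, v) = 0" for v
    by (cases b; simp add: \<xi> coords_def e_defs complex_eq_iff)+
  have om: "Im (cnj z * (- 4 * \<i> * z)) = - 4 * (cmod z)\<^sup>2"
    unfolding cmod_power2 by (simp add: power2_eq_square)
  define y where "y = yC z"
  have \<beta>: "betaC b z (\<xi>, - 4 * \<i> * z) = 4"
    using mult_mfun[OF r] unfolding betaC_def e snd_conv om by (simp add: yC_def algebra_simps)
  have h: "hC b z (\<xi>, - 4 * \<i> * z) = 0"
    using mult_bfun[OF r] unfolding components e snd_conv om by (simp add: yC_def algebra_simps)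
  have "covec b z (\<xi>, - 4 * \<i> * z) = 0"
    unfolding covec_split h components(2-4) \<beta> e by (simp add: zero_prod_def)
  then show "phi b (g, z) (\<xi>, - 4 * \<i> * z) Y' Z' = 0"
    unfolding phi_def snd_conv by (simp add: linear_0[OF pack_linear] linear_0[OF phi0_linear(1)])
qed

lemma phi_tube_form: "R \<le> 2 * T \<Longrightarrow> tube_form b R (phi b)"
  unfolding tube_form_def using phi_smooth phi_basic by blast

lemma phi_SO4_invariant: "SO4_invariant R phi" "SO4_invariant R (\<lambda>_. phi b)"
  by (simp_all add: SO4_invariant_def phi_def)

lemma phi_U1_invariant: "U1_invariant R phi"
  unfolding U1_invariant_def
proof (intro allI ballI)
  fix b \<theta> g z \<xi> v \<eta> w \<zeta> u
  let ?k = "circ 1 (- 1) \<theta>"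
  have e: "ea b (Ad ?k \<xi>, v) = ea b (\<xi>, v)" "eb b (Ad ?k \<xi>, v) = eb b (\<xi>, v)"
    "eE b (Ad ?k \<xi>, v) = cis (2 * \<theta>) * eE b (\<xi>, v)" "eF b (Ad ?k \<xi>, v) = cis (2 * \<theta>) * eF b (\<xi>, v)" for \<xi> v
  proof -
    obtain x y where \<xi>: "\<xi> = (x, y)" by (cases \<xi>)
    have c: "(cis \<theta>)\<^sup>2 = cis (2 * \<theta>)" "(cnj (cis (- \<theta>)))\<^sup>2 = cis (2 * \<theta>)"
      by (simp_all add: Complex.DeMoivre cis_cnj)
    note A = Ad_diagonal[of "cis \<theta>" "cis (- \<theta>)" x y, unfolded c, OF norm_cis norm_cis]
    show "ea b (Ad ?k \<xi>, v) = ea b (\<xi>, v)" "eb b (Ad ?k \<xi>, v) = eb b (\<xi>, v)"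
      "eE b (Ad ?k \<xi>, v) = cis (2 * \<theta>) * eE b (\<xi>, v)" "eF b (Ad ?k \<xi>, v) = cis (2 * \<theta>) * eF b (\<xi>, v)"
      using A by (cases b; simp add: e_defs \<xi> circ_def)+
  qed
  have c: "covec b z (Ad ?k \<xi>, v) = (hC b z (\<xi>, v), 1 * zC b z (\<xi>, v),
      cnj (cis (2 * \<theta>)) * gC b z (\<xi>, v), cis (2 * \<theta>) * fC b z (\<xi>, v))" for \<xi> v
    using covec_rotate[of 1 b "(Ad ?k \<xi>, v)" "(\<xi>, v)" "cis (2 * \<theta>)" "cis (2 * \<theta>)" z] e by simp
  have prod: "1 * cnj (cis (2 * \<theta>)) * cis (2 * \<theta>) = 1" by (simp add: cis_cnj cis_mult)
  show "phi b (gmult g ?k, z) (\<xi>, v) (\<eta>, w) (\<zeta>, u) = phi b (g, z) (Ad ?k \<xi>, v) (Ad ?k \<eta>, w) (Ad ?k \<zeta>, u)"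
    unfolding phi_def snd_conv c
    by (subst phi0_invariant[OF _ _ _ prod]) (auto simp: covec_split[symmetric])
qed

text \<open>By \<open>first_integral\<close> the function C is determined by y through an expression
  invariant under y -> 1 - y.\<close>

lemma cfun_symmetric:
  assumes "0 < t" "t < 2 * T"
  shows "(2 * T - t) * cfun (Y ((2 * T - t)\<^sup>2)) = t * cfun (Y (t\<^sup>2))"
proof -
  define y where "y = Y (t\<^sup>2)"
  have s: "Y ((2 * T - t)\<^sup>2) = 1 - y" unfolding y_def by (rule Y_symmetric[OF assms])
  have e: "6 + 4 * (1 - y) - 4 * (1 - y)\<^sup>2 = 6 + 4 * y - 4 * y\<^sup>2" "3 + 4 * (1 - y) - 4 * (1 - y)\<^sup>2 = 3 + 4 * y - 4 * y\<^sup>2"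
    "(1 - y) * (1 - (1 - y)) = y * (1 - y)"
    by (simp_all add: power2_eq_square algebra_simps)
  have "(2 * T - t) * cfun (Y ((2 * T - t)\<^sup>2)) = 1 / lam * sqrt (y * (1 - y) * (6 + 4 * y - 4 * y\<^sup>2) / (3 + 4 * y - 4 * y\<^sup>2))"
    using first_integral[of "2 * T - t"] assms unfolding s e by simp
  also have "\<dots> = t * cfun (Y (t\<^sup>2))"
    using first_integral[of t] assms by (simp add: y_def)
  finally show ?thesis .
qed

lemma covec_real:
  "covec b (of_real t) (\<xi>, of_real r) =
    (- (1 / lam) * ((1 / 2 + Y (t\<^sup>2)) * ea b (\<xi>, 0) - (3 / 2 - Y (t\<^sup>2)) * eb b (\<xi>, 0)),
     Complex r (- (t * cfun (Y (t\<^sup>2))) * (ea b (\<xi>, 0) + eb b (\<xi>, 0))),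
     of_real (sqrt 2 / lam * sqrt (1 / 2 + Y (t\<^sup>2))) * cnj (eE b (\<xi>, 0)),
     of_real (sqrt 2 / lam * sqrt (3 / 2 - Y (t\<^sup>2))) * eF b (\<xi>, 0))"
proof -
  have e: "ea b (\<xi>, v) = ea b (\<xi>, 0)" "eb b (\<xi>, v) = eb b (\<xi>, 0)" "eE b (\<xi>, v) = eE b (\<xi>, 0)" "eF b (\<xi>, v) = eF b (\<xi>, 0)" for v
    by (simp_all add: e_defs)
  show ?thesis
    unfolding covec_def Let_def e[of "of_real r"] snd_conv by (simp add: complex_eq_iff)
qed

text \<open>The swap of G and F and the sign of Z each reverse Omega, so together with the
  conjugation Re Omega is preserved; omega changes sign, and so does h. This is the symmetry of the
  gluing t -> 2 T - t.\<close>

lemma phi0_exchange: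
  "phi0 (pack (- h1, - cnj z1, cnj f1, cnj g1)) (pack (- h2, - cnj z2, cnj f2, cnj g2)) (pack (- h3, - cnj z3, cnj f3, cnj g3))
    = phi0 (pack (h1, z1, g1, f1)) (pack (h2, z2, g2, f2)) (pack (h3, z3, g3, f3))"
  unfolding phi0_pack by (simp add: algebra_simps)

lemma phi_M23_form: "M23_form (2 * T) phi"
  unfolding M23_form_def
proof (intro conjI allI ballI)
  show "tube_form b (2 * T) (phi b)" for b by (rule phi_tube_form) simp
  fix g s \<xi> \<eta> \<zeta> and r1 r2 r3 :: real assume s: "s \<in> {0<..<2 * T}"
  have "covec End (of_real (2 * T - s)) (\<xi>, of_real (- r)) =
      (let (h, z, g, f) = covec Start (of_real s) (\<xi>, of_real r) in (- h, - cnj z, cnj f, cnj g))" for \<xi> r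
  proof -
    have Y': "Y ((2 * T - s)\<^sup>2) = 1 - Y (s\<^sup>2)" using Y_symmetric s by auto
    have c: "(2 * T - s) * cfun (1 - Y (s\<^sup>2)) = s * cfun (Y (s\<^sup>2))"
      using cfun_symmetric[of s] s unfolding Y' by auto
    have e: "ea End X = eb Start X" "eb End X = ea Start X" "eE End X = eF Start X" "eF End X = eE Start X" for X
      by (simp_all add: e_defs)
    show ?thesis
      unfolding covec_real Y' c e using lam_pos by (simp add: complex_eq_iff) (simp add: field_simps)
  qed
  then show "phi Start (g, of_real s) (\<xi>, of_real r1) (\<eta>, of_real r2) (\<zeta>, of_real r3) =
      phi End (g, of_real (2 * T - s)) (\<xi>, of_real (- r1)) (\<eta>, of_real (- r2)) (\<zeta>, of_real (- r3))"
    unfolding phi_def snd_conv by (simp add: case_prod_beta phi0_exchange)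
qed

lemma phi_G2: "G2_structure_M23 (2 * T) phi"
  unfolding G2_structure_M23_def using phi_M23_form phi_positive by auto

end

section \<open>The solution of the nearly parallel system\<close>

text \<open>Only n^2 remains on the right, so that sqrt 2 disappears before the comparison with the
  ansatz.\<close>

lemma phi0_pack_scaled:
  "phi0 (pack (h1, z1, of_real n * g1, of_real n * f1))
     (pack (h2, z2, of_real n * g2, of_real n * f2))
     (pack (h3, z3, of_real n * g3, of_real n * f3))
   = h1 * (Im (cnj z2 * z3) + n\<^sup>2 * (Im (cnj g2 * g3) + Im (cnj f2 * f3)))
     - h2 * (Im (cnj z1 * z3) + n\<^sup>2 * (Im (cnj g1 * g3) + Im (cnj f1 * f3)))
     + h3 * (Im (cnj z1 * z2) + n\<^sup>2 * (Im (cnj g1 * g2) + Im (cnj f1 * f2)))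
     + n\<^sup>2 * Re (vform (z1, g1, f1) (z2, g2, f2) (z3, g3, f3))"
  unfolding phi0_pack by (simp add: algebra_simps power2_eq_square)

lemma nat_1_8: "i \<in> {1..8::nat} \<longleftrightarrow> i = 1 \<or> i = 2 \<or> i = 3 \<or> i = 4 \<or> i = 5 \<or> i = 6 \<or> i = 7 \<or> i = 8"
  by auto

lemma sum_1_4: "(\<Sum>i=1..4. f i) = f 1 + f 2 + f 3 + f (4::nat)"
  by (simp add: eval_nat_numeral)

lemma sum_pairs:
  "(\<Sum>j=1..4. \<Sum>i\<in>{1..<j}. f i j) = f 1 2 + f 1 3 + f 2 3 + f 1 4 + f 2 4 + f (3::nat) (4::nat)"
proof -
  have "{1..<1::nat} = {}" "{1..<2} = {1::nat}" "{1..<3} = {1, 2::nat}" "{1..<4} = {1, 2, 3::nat}" by auto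
  then show ?thesis unfolding sum_1_4 by (simp add: add.assoc del: One_nat_def)
qed

text \<open>On the locus the first and fourth products \<alpha> are v^2 and the other two are u^2,
  so 2 \<alpha> - \<Sigma> is - 2 u^2 or - 2 v^2, and each cubic bracket acquires a factor q1 - v or
  q8 - v.\<close>

lemma rhs_symmetric:
  fixes p q :: "nat \<Rightarrow> real" and lam :: real
  assumes p: "p 3 = p 2" and q: "q 2 = u" "q 3 = u" "q 6 = u" "q 7 = u" "q 4 = v" "q 5 = v" "q 1 * q 8 = v\<^sup>2"
    and c: "lam / (2 * (p 1 * p 2 * p 2)) = c"
  shows "rhs lam p q 1 = - 2 * (c * u\<^sup>2) * (q 1 - v)" "rhs lam p q 8 = 2 * (c * u\<^sup>2) * (q 8 - v)"
    "rhs lam p q 2 = p 2 - 2 * (c * u * v) * (q 1 - v)" "rhs lam p q 3 = p 2 - 2 * (c * u * v) * (q 1 - v)"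
    "rhs lam p q 6 = - p 2 + 2 * (c * u * v) * (q 8 - v)" "rhs lam p q 7 = - p 2 + 2 * (c * u * v) * (q 8 - v)"
    "rhs lam p q 4 = - p 1 + 2 * (c * u\<^sup>2) * (q 8 - v)" "rhs lam p q 5 = p 1 - 2 * (c * u\<^sup>2) * (q 1 - v)"
  unfolding rhs_def Let_def sum_1_4
  by (simp_all add: p q c del: One_nat_def) (simp_all add: algebra_simps power2_eq_square del: One_nat_def)

context scale
begin

text \<open>The functions W, C and S of time; in these terms 1/2 + y is 1 - W and 3/2 - y is 1 +
  W.\<close>

definition "Wt t = 1 / 2 - Y (t\<^sup>2)"
definition "Ct t = t * cfun (Y (t\<^sup>2))"
definition "St t = sqrt ((1 / 2 + Y (t\<^sup>2)) * (3 / 2 - Y (t\<^sup>2)))"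

definition psol :: coeffs where
  "psol i t = (if i = 1 then - (2 / lam) * Ct t else 2 / lam\<^sup>2 * St t)"

definition qsol :: coeffs where
  "qsol i t = (if i = 1 then 2 / lam ^ 3 * (1 - Wt t)\<^sup>2 else if i = 8 then 2 / lam ^ 3 * (1 + Wt t)\<^sup>2
     else if i = 4 \<or> i = 5 then - (2 / lam ^ 3) * (St t)\<^sup>2 else 2 / lam\<^sup>2 * (Ct t * St t))"

definition qsol' :: coeffs where
  "qsol' i t = (if i = 1 then 2 / lam * (Ct t * (1 - Wt t)) else if i = 8 then - (2 / lam * (Ct t * (1 + Wt t)))
     else if i = 4 \<or> i = 5 then - (2 / lam * (Ct t * Wt t)) else 2 / lam\<^sup>2 * (St t * Wt t))"

lemma phi_agrees: "agrees_with_ansatz (phi Start) psol qsol {0..<2 * T}"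
  unfolding agrees_with_ansatz_def
proof (intro ballI allI)
  fix g t \<xi> \<eta> \<zeta> and r1 r2 r3 :: real assume t: "t \<in> {0..<2 * T}"
  define y a b C k n where "y = Y (t\<^sup>2)" and "a = sqrt (1 / 2 + y)" and "b = sqrt (3 / 2 - y)" and "C = Ct t"
    and "k = 1 / lam" and "n = sqrt 2 / lam"
  have y: "y \<in> U" unfolding y_def using Y_mem square_mem_J t by auto
  have ab: "1 / 2 + y = a\<^sup>2" "3 / 2 - y = b\<^sup>2" using y by (auto simp: a_def b_def)
  have ab0: "0 \<le> a" "0 \<le> b" using y by (auto simp: a_def b_def)
  have n: "n\<^sup>2 = 2 * k\<^sup>2" by (simp add: n_def k_def power_divide)
  have W: "1 - Wt t = a\<^sup>2" "1 + Wt t = b\<^sup>2" using ab by (simp_all add: Wt_def y_def)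
  have S: "St t = a * b" by (simp add: St_def a_def b_def y_def real_sqrt_mult)
  \<comment> \<open>Writing the constant 2 as a^2 + b^2 turns the comparison with the ansatz into a
    polynomial identity in a, b, C and k.\<close>
  have k2: "2 * k = (a\<^sup>2 + b\<^sup>2) * k" unfolding ab[symmetric] by simp
  have lam: "2 / lam = (a\<^sup>2 + b\<^sup>2) * k" "2 / lam\<^sup>2 = 2 * k\<^sup>2" "2 / lam ^ 3 = 2 * k ^ 3"
    unfolding k2[symmetric] by (simp_all add: k_def power_divide)
  have c: "covec Start (of_real t) (\<xi>, of_real r) =
      (- k * (a\<^sup>2 * ea Start (\<xi>, 0) - b\<^sup>2 * eb Start (\<xi>, 0)), Complex r (- C * (ea Start (\<xi>, 0) + eb Start (\<xi>, 0))),
       of_real n * (of_real a * cnj (eE Start (\<xi>, 0))),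
       of_real n * (of_real b * eF Start (\<xi>, 0)))" for \<xi> r
    unfolding covec_real y_def[symmetric] a_def[symmetric] b_def[symmetric] ab
    using ab0 by (simp add: C_def Ct_def y_def k_def n_def)
  show "phi Start (g, of_real t) (\<xi>, of_real r1) (\<eta>, of_real r2) (\<zeta>, of_real r3)
     = phi_ansatz psol qsol t (\<xi>, of_real r1) (\<eta>, of_real r2) (\<zeta>, of_real r3)"
    unfolding phi_def snd_conv c phi0_pack_scaled n phi_ansatz_def Let_def wedge3_def coframe_def dt_def
      psol_def qsol_def W S lam C_def[symmetric]
    by (simp add: e_defs) (simp add: algebra_simps power2_eq_square power3_eq_cube power4_eq_xxxx)
qed

lemma St_Ct_symmetric:
  assumes "0 < t" "t < 2 * T"
  shows "St (2 * T - t) = St t" "Ct (2 * T - t) = Ct t" "Wt (2 * T - t) = - Wt t"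
  using cfun_symmetric[OF assms]
  unfolding St_def Ct_def Wt_def Y_symmetric[OF assms] by (simp_all add: mult.commute)

text \<open>About T the functions S and C are even and W is odd. As tau_23 exchanges 1 - W and 1 +
  W, it carries the solution to its own continuation beyond T.\<close>

lemma phi_agrees_reflection:
  "agrees_with_ansatz (phi Start) (reflect_p T psol) (reflect_q T qsol) {0..<2 * T}"
proof -
  have "reflect_p T psol i t = psol i t" "i \<in> {1..8} \<longrightarrow> reflect_q T qsol i t = qsol i t" if "t \<in> {0..<2 * T}" for i t
  proof -
    have "t \<le> T \<or> 0 < t" using T_pos by linarith
    then show "reflect_p T psol i t = psol i t" "i \<in> {1..8} \<longrightarrow> reflect_q T qsol i t = qsol i t"
      using that T_pos St_Ct_symmetric[of t] unfolding nat_1_8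
      by (auto simp: reflect_p_def reflect_q_def psol_def qsol_def)
  qed
  then have "phi_ansatz (reflect_p T psol) (reflect_q T qsol) t = phi_ansatz psol qsol t" if "t \<in> {0..<2 * T}" for t
    using that by (intro ext) (simp add: phi_ansatz_def)
  then show ?thesis using phi_agrees by (simp add: agrees_with_ansatz_def)
qed

lemma sol_mem:
  assumes "0 \<le> t" "t < 2 * T"
  shows "- 1 < Wt t" "Wt t < 1" "0 < St t" "(St t)\<^sup>2 = 1 - (Wt t)\<^sup>2"
proof -
  have y: "Y (t\<^sup>2) \<in> U" using Y_mem square_mem_J assms by auto
  then show "- 1 < Wt t" "Wt t < 1" "0 < St t" by (auto simp: Wt_def St_def)
  have "0 < (1 / 2 + Y (t\<^sup>2)) * (3 / 2 - Y (t\<^sup>2))" using y by auto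
  then have "(St t)\<^sup>2 = (1 / 2 + Y (t\<^sup>2)) * (3 / 2 - Y (t\<^sup>2))" unfolding St_def by simp
  then show "(St t)\<^sup>2 = 1 - (Wt t)\<^sup>2" by (simp add: Wt_def power2_eq_square algebra_simps)
qed

lemma Ct_pos: "0 < t \<Longrightarrow> t < 2 * T \<Longrightarrow> 0 < Ct t"
  unfolding Ct_def using cfun_pos[OF Y_mem[OF square_mem_J]] by simp

lemma sol_derivs:
  assumes t: "0 \<le> t" "t < 2 * T"
  shows "(Wt has_real_derivative - (lam\<^sup>2 / 2 * Ct t)) (at t)"
    "(St has_real_derivative Wt t * (lam\<^sup>2 / 2 * Ct t) / St t) (at t)"
    "((\<lambda>t. Ct t * St t) has_real_derivative St t * Wt t) (at t)"
proof -
  have J: "t\<^sup>2 \<in> J" by (rule square_mem_J[OF t])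
  define y where "y = Y (t\<^sup>2)"
  have sq: "((\<lambda>t::real. t\<^sup>2) has_real_derivative 2 * t) (at t)" by (auto intro!: derivative_eq_intros)
  have dy: "((\<lambda>t. Y (t\<^sup>2)) has_real_derivative lam\<^sup>2 / 2 * Ct t) (at t)"
    using DERIV_chain2[where g = "\<lambda>t. t\<^sup>2", OF Y_deriv[OF J] sq] by (simp add: Ct_def ac_simps)
  show W: "(Wt has_real_derivative - (lam\<^sup>2 / 2 * Ct t)) (at t)"
    unfolding Wt_def using DERIV_diff[OF DERIV_const dy] by simp
  have Ss: "St s = sqrt (1 - (Wt s)\<^sup>2)" for s
    unfolding St_def Wt_def by (rule arg_cong[of _ _ sqrt]) (simp add: power2_eq_square algebra_simps)
  have pos: "0 < 1 - (Wt t)\<^sup>2" using sol_mem(3,4)[OF t] by (metis zero_less_power)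
  have in': "((\<lambda>s. 1 - (Wt s)\<^sup>2) has_real_derivative 2 * Wt t * (lam\<^sup>2 / 2 * Ct t)) (at t)"
    using DERIV_diff[OF DERIV_const DERIV_power[OF W, of 2], of 1] by (simp add: ac_simps)
  have "((\<lambda>s. sqrt (1 - (Wt s)\<^sup>2)) has_real_derivative inverse (sqrt (1 - (Wt t)\<^sup>2)) / 2 * (2 * Wt t * (lam\<^sup>2 / 2 * Ct t))) (at t)"
    by (rule DERIV_chain2[where g = "\<lambda>s. 1 - (Wt s)\<^sup>2", OF DERIV_real_sqrt[OF pos] in'])
  moreover have "inverse r / 2 * (2 * w * x) = w * x / r" for r w x :: real
    by (simp add: inverse_eq_divide)
  ultimately have "((\<lambda>s. sqrt (1 - (Wt s)\<^sup>2)) has_real_derivative Wt t * (lam\<^sup>2 / 2 * Ct t) / sqrt (1 - (Wt t)\<^sup>2)) (at t)"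
    by (simp only:)
  then show S: "(St has_real_derivative Wt t * (lam\<^sup>2 / 2 * Ct t) / St t) (at t)"
    by (simp only: Ss[symmetric])
  have C: "(Ct has_real_derivative Wt t - lam\<^sup>2 / 2 * (Ct t)\<^sup>2 * Wt t / (St t)\<^sup>2) (at t)"
  proof -
    have dc: "((\<lambda>t. cfun (Y (t\<^sup>2))) has_real_derivative deriv cfun y * (lam\<^sup>2 / 2 * Ct t)) (at t)"
      by (rule DERIV_chain2[where g = "\<lambda>t. Y (t\<^sup>2)", OF _ dy])
        (use smooth_fun_deriv(2)[OF cfun_smooth Y_mem[OF J]] in \<open>simp add: y_def\<close>)
    have Cy: "Ct t = t * cfun y" by (simp add: Ct_def y_def)
    from DERIV_mult[OF DERIV_ident dc]
    have d: "(Ct has_real_derivative cfun y + deriv cfun y * (lam\<^sup>2 / 2 * Ct t) * t) (at t)"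
      unfolding Ct_def by (simp add: y_def)
    have "2 * t\<^sup>2 * (deriv cfun y * (lam\<^sup>2 * cfun y / 4) + cfun y * Wt t * (lam\<^sup>2 * cfun y / 4) / (St t)\<^sup>2) + cfun y = Wt t"
      using profile_equation[OF J] sol_mem(4)[OF t] by (simp add: Wt_def y_def)
    then have "cfun y + deriv cfun y * (lam\<^sup>2 / 2 * Ct t) * t = Wt t - lam\<^sup>2 / 2 * (Ct t)\<^sup>2 * Wt t / (St t)\<^sup>2"
      unfolding Cy by (simp add: power2_eq_square algebra_simps)
    with d show ?thesis by simp
  qed
  \<comment> \<open>The two terms with C^2 cancel, which leaves (C S)' = S W.\<close>
  have "(Wt t - lam\<^sup>2 / 2 * (Ct t)\<^sup>2 * Wt t / (St t)\<^sup>2) * St t + Wt t * (lam\<^sup>2 / 2 * Ct t) / St t * Ct t = St t * Wt t"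
    using sol_mem(3)[OF t] by (simp add: power2_eq_square algebra_simps)
  with DERIV_mult[OF C S] show "((\<lambda>t. Ct t * St t) has_real_derivative St t * Wt t) (at t)" by simp
qed

lemma qsol_deriv:
  assumes t: "0 \<le> t" "t < 2 * T"
  shows "(qsol i has_real_derivative qsol' i t) (at t)"
proof -
  note d = sol_derivs[OF t] and S = sol_mem(3)[OF t]
  have d1: "((\<lambda>t. 2 / lam ^ 3 * (1 + \<epsilon> * Wt t)\<^sup>2) has_real_derivative - \<epsilon> * (2 / lam * (Ct t * (1 + \<epsilon> * Wt t)))) (at t)" for \<epsilon>
    by (rule DERIV_cong[OF DERIV_cmult[OF DERIV_power[OF DERIV_add[OF DERIV_const DERIV_cmult[OF d(1)]]]]])
      (use lam_pos in \<open>simp add: field_simps power2_eq_square power3_eq_cube\<close>)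
  have d2: "((\<lambda>t. - (2 / lam ^ 3) * (St t)\<^sup>2) has_real_derivative - (2 / lam * (Ct t * Wt t))) (at t)"
    by (rule DERIV_cong[OF DERIV_cmult[OF DERIV_power[OF d(2)]]])
      (use lam_pos S in \<open>simp add: field_simps power2_eq_square power3_eq_cube\<close>)
  have d3: "((\<lambda>t. 2 / lam\<^sup>2 * (Ct t * St t)) has_real_derivative 2 / lam\<^sup>2 * (St t * Wt t)) (at t)"
    by (rule DERIV_cmult[OF d(3)])
  consider "i = 1" | "i = 8" | "i = 4 \<or> i = 5" | "i \<noteq> 1" "i \<noteq> 8" "i \<noteq> 4" "i \<noteq> 5" by blast
  then show ?thesis
    using d1[of 1] d1[of "-1"] d2 d3 unfolding qsol_def[abs_def] qsol'_def by cases auto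
qed

lemma qsol_solution:
  assumes t: "0 < t" "t < 2 * T"
  shows "i \<in> {1..8} \<Longrightarrow> qsol' i t = rhs lam (\<lambda>j. psol j t) (\<lambda>j. qsol j t) i"
    and "constraints lam (\<lambda>j. psol j t) (\<lambda>j. qsol j t)"
    and "in_chamber (\<lambda>j. psol j t) (\<lambda>j. qsol j t)"
proof -
  define C S W where "C = Ct t" and "S = St t" and "W = Wt t"
  have C: "0 < C" and S: "0 < S" and W: "S\<^sup>2 = 1 - W\<^sup>2"
    using Ct_pos[OF t] sol_mem[of t] t by (auto simp: C_def S_def W_def)
  define p q where "p = (\<lambda>j. psol j t)" and "q = (\<lambda>j. qsol j t)"
  have p: "p 1 = - (2 / lam) * C" "p 2 = 2 / lam\<^sup>2 * S" "p 3 = 2 / lam\<^sup>2 * S"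
    by (simp_all add: p_def psol_def C_def S_def)
  define u v where "u = 2 / lam\<^sup>2 * (C * S)" and "v = - (2 / lam ^ 3) * S\<^sup>2"
  have q: "q 2 = u" "q 3 = u" "q 6 = u" "q 7 = u" "q 4 = v" "q 5 = v"
    "q 1 = 2 / lam ^ 3 * (1 - W)\<^sup>2" "q 8 = 2 / lam ^ 3 * (1 + W)\<^sup>2"
    by (simp_all add: q_def qsol_def C_def S_def W_def u_def v_def)
  have WW: "(1 - W) * (1 + W) = S\<^sup>2" unfolding W by (simp add: power2_eq_square algebra_simps)
  have q18: "q 1 * q 8 = v\<^sup>2"
  proof -
    have "q 1 * q 8 = (2 / lam ^ 3)\<^sup>2 * ((1 - W) * (1 + W))\<^sup>2" unfolding q by (simp add: power2_eq_square)
    then show ?thesis unfolding WW v_def by (simp add: power2_eq_square)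
  qed
  define c where "c = lam / (2 * (p 1 * p 2 * p 2))"
  have c: "c = - (lam ^ 6 / (16 * C * S\<^sup>2))"
    unfolding c_def p using lam_pos C S by (simp add: field_simps eval_nat_numeral)
  have cu: "c * u\<^sup>2 = - (lam\<^sup>2 * C / 4)" "c * u * v = lam * S / 4"
    unfolding c u_def v_def using lam_pos C S by (simp_all add: field_simps eval_nat_numeral)
  have qv: "q 1 - v = 4 / lam ^ 3 * (1 - W)" "q 8 - v = 4 / lam ^ 3 * (1 + W)"
    unfolding q v_def W using lam_pos by (simp_all add: field_simps power2_eq_square)
  have p32: "p 3 = p 2" by (simp add: p)
  note R = rhs_symmetric[where lam = lam and p = p and q = q, OF p32 q(1-6) q18 c_def[symmetric], unfolded cu qv]
  show "qsol' i t = rhs lam (\<lambda>j. psol j t) (\<lambda>j. qsol j t) i" if "i \<in> {1..8}"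
  proof -
    have "rhs lam p q 1 = 2 / lam * (C * (1 - W))" "rhs lam p q 8 = - (2 / lam * (C * (1 + W)))"
      "rhs lam p q 2 = 2 / lam\<^sup>2 * (S * W)" "rhs lam p q 3 = 2 / lam\<^sup>2 * (S * W)"
      "rhs lam p q 6 = 2 / lam\<^sup>2 * (S * W)" "rhs lam p q 7 = 2 / lam\<^sup>2 * (S * W)"
      "rhs lam p q 4 = - (2 / lam * (C * W))" "rhs lam p q 5 = - (2 / lam * (C * W))"
      unfolding R p using lam_pos by (simp_all add: field_simps eval_nat_numeral)
    then show ?thesis
      using that unfolding nat_1_8 p_def[symmetric] q_def[symmetric]
      by (auto simp: qsol'_def C_def S_def W_def)
  qed
  have up: "u + u = - lam * p 1 * p 2" "v + v = - lam * p 2 * p 2"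
    unfolding u_def v_def p using lam_pos by (simp_all add: field_simps eval_nat_numeral)
  \<comment> \<open>On the locus the quartic of the normalisation factors as - 4 u^2 (q1 - v) (q8 -
    v), up to a multiple of q1 q8 - v^2 = 0.\<close>
  have "(v\<^sup>2)\<^sup>2 + (u * u)\<^sup>2 + (u * u)\<^sup>2 + (v * v)\<^sup>2
      - 2 * (v\<^sup>2 * (u * u) + v\<^sup>2 * (u * u) + u * u * (u * u) + v\<^sup>2 * (v * v) + u * u * (v * v) + u * u * (v * v))
      + 4 * (q 1 * v * u * u + u * u * v * q 8) = - 4 * u\<^sup>2 * ((q 1 - v) * (q 8 - v)) + 4 * u\<^sup>2 * (q 1 * q 8 - v\<^sup>2)"
    by (simp add: algebra_simps power2_eq_square)
  also have "\<dots> = - 4 * (p 1 * p 2 * p 3)\<^sup>2"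
  proof -
    have "(q 1 - v) * (q 8 - v) = (4 / lam ^ 3)\<^sup>2 * ((1 - W) * (1 + W))"
      unfolding qv by (simp only: power2_eq_square ac_simps)
    then have "- 4 * u\<^sup>2 * ((q 1 - v) * (q 8 - v)) + 4 * u\<^sup>2 * (q 1 * q 8 - v\<^sup>2) = - 4 * u\<^sup>2 * ((4 / lam ^ 3)\<^sup>2 * S\<^sup>2)"
      unfolding WW q18 by simp
    also have "\<dots> = - 4 * (p 1 * p 2 * p 3)\<^sup>2"
      unfolding u_def p using lam_pos by (simp add: field_simps eval_nat_numeral)
    finally show ?thesis .
  qed
  finally have norm: "(v\<^sup>2)\<^sup>2 + (u * u)\<^sup>2 + (u * u)\<^sup>2 + (v * v)\<^sup>2
      - 2 * (v\<^sup>2 * (u * u) + v\<^sup>2 * (u * u) + u * u * (u * u) + v\<^sup>2 * (v * v) + u * u * (v * v) + u * u * (v * v))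
      + 4 * (q 1 * v * u * u + u * u * v * q 8) = - 4 * (p 1 * p 2 * p 3)\<^sup>2" .
  show "constraints lam (\<lambda>j. psol j t) (\<lambda>j. qsol j t)"
    unfolding p_def[symmetric] q_def[symmetric] constraints_def Let_def sum_pairs unfolding sum_1_4
    using norm up by (simp add: q(1-6) q18 p32 del: One_nat_def)
  show "in_chamber (\<lambda>j. psol j t) (\<lambda>j. qsol j t)"
    unfolding p_def[symmetric] q_def[symmetric] in_chamber_def
    using C S lam_pos by (simp add: q(1-6) p u_def v_def del: One_nat_def)
qed

lemma qsol_is_solution: "is_solution lam psol qsol qsol' T"
  unfolding is_solution_def
proof (intro conjI ballI)
  fix i t assume "t \<in> {0..T}"
  then show "(qsol i has_real_derivative qsol' i t) (at t within {0..T})"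
    using qsol_deriv[of t i] T_pos by (auto intro: has_field_derivative_at_within)
next
  fix t assume "t \<in> {0<..T}"
  then have t: "0 < t" "t < 2 * T" using T_pos by auto
  show "qsol' i t = rhs lam (\<lambda>j. psol j t) (\<lambda>j. qsol j t) i" if "i \<in> {1..8}" for i
    by (rule qsol_solution(1)[OF t that])
  show "constraints lam (\<lambda>j. psol j t) (\<lambda>j. qsol j t)" "in_chamber (\<lambda>j. psol j t) (\<lambda>j. qsol j t)"
    by (rule qsol_solution[OF t])+
qed

lemma sol_0: "Wt 0 = 1 / 2" "Ct 0 = 0" "St 0 = sqrt 3 / 2"
  by (simp_all add: Wt_def Ct_def St_def Y_0 real_sqrt_divide)

lemma qsol_is_eta:
  defines "a \<equiv> 1 / (2 * lam ^ 3)"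
  shows "is_eta lam a (- 3 * a) 0 T psol qsol"
  unfolding is_eta_def
proof (intro conjI exI)
  have a: "0 < a" using lam_pos by (simp add: a_def)
  show "0 < a" "- 3 * a < 0" "0 < T" using a T_pos by auto
  show "3 * a - - 3 * a \<noteq> - (lam ^ 3) * a * (- 3 * a)"
    using lam_pos by (simp add: a_def field_simps)
  show "is_solution lam psol qsol qsol' T" by (rule qsol_is_solution)
  show "qsol 1 0 = a" "qsol 5 0 = - 3 * a" "qsol 4 0 = - 3 * a" "qsol 8 0 = - 3 * (- 3 * a)"
    "qsol 2 0 = 0" "qsol 3 0 = 0" "qsol 6 0 = 0" "qsol 7 0 = 0"
    using lam_pos by (simp_all add: qsol_def sol_0 a_def power2_eq_square)
  have s: "sqrt (- a * (- 3 * a)) = sqrt 3 * a"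
  proof -
    have "sqrt (- a * (- 3 * a)) = sqrt (3 * a\<^sup>2)" by (simp add: power2_eq_square)
    then show ?thesis using a by (simp add: real_sqrt_mult)
  qed
  have s': "sqrt ((3 * a - - 3 * a) / lam) = sqrt 3 / lam\<^sup>2"
  proof -
    have "(3 * a - - 3 * a) / lam = 3 / (lam\<^sup>2)\<^sup>2"
      using lam_pos by (simp add: a_def field_simps eval_nat_numeral)
    then show ?thesis by (simp only: real_sqrt_divide real_sqrt_abs abs_power2)
  qed
  \<comment> \<open>This is half of the other root in the initial conditions, so the four prescribed
    slopes coincide, as q2 = q3 = q6 = q7 demands.\<close>
  have "lam * (sqrt 3 * a) = sqrt 3 / (2 * lam\<^sup>2)"
    using lam_pos by (simp add: a_def field_simps eval_nat_numeral)
  then show "qsol' 2 0 = - lam * sqrt (- a * (- 3 * a)) + sqrt ((3 * a - - 3 * a) / lam)"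
    "qsol' 3 0 = - lam * sqrt (- a * (- 3 * a)) + sqrt ((3 * a - - 3 * a) / lam)"
    "qsol' 6 0 = 3 * lam * sqrt (- a * (- 3 * a)) - sqrt ((3 * a - - 3 * a) / lam)"
    "qsol' 7 0 = 3 * lam * sqrt (- a * (- 3 * a)) - sqrt ((3 * a - - 3 * a) / lam)"
    unfolding s s' by (simp_all add: qsol'_def sol_0)
  have "((\<lambda>t. 2 / lam\<^sup>2 * (St t * Wt t)) has_real_derivative 0) (at 0)"
    using DERIV_cmult[OF DERIV_mult[OF sol_derivs(2)[of 0] sol_derivs(1)[of 0]], of "2 / lam\<^sup>2"] T_pos
    by (simp add: sol_0)
  then show "(qsol' 3 has_real_derivative 2 * 0) (at 0 within {0..T})"
    "(qsol' 2 has_real_derivative - (2 * 0)) (at 0 within {0..T})"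
    unfolding qsol'_def[abs_def] by (auto intro: has_field_derivative_at_within)
  show "tube_form Start T (phi Start)" "positive_form T (phi Start)"
    using phi_tube_form phi_positive T_pos by auto
  show "SO4_invariant T (\<lambda>_. phi Start)" by (rule phi_SO4_invariant)
  show "agrees_with_ansatz (phi Start) psol qsol {0..<T}"
    using phi_agrees T_pos by (simp add: agrees_with_ansatz_def)
qed

lemma phi_obtained_by_reflection:
  "obtained_by_reflection lam (1 / (2 * lam ^ 3)) (- 3 * (1 / (2 * lam ^ 3))) 0 T phi"
  unfolding obtained_by_reflection_def
proof (intro exI conjI)
  have "Y (T\<^sup>2) = 1 / 2" using Y_symmetric[of T] T_pos by simp
  then have "Wt T = 0" by (simp add: Wt_def)
  then show "tau_fixed qsol T"
    unfolding tau_fixed_def nat_1_8 by (auto simp: qsol_def)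
qed (rule qsol_is_eta phi_agrees_reflection)+

end

section \<open>Completeness\<close>

lemma norm_qmult: "norm (qmult p q) = norm p * norm q"
proof -
  obtain z w where p: "p = (z, w)" by (cases p)
  obtain z' w' where q: "q = (z', w')" by (cases q)
  have "(cmod (z * z' - w * cnj w'))\<^sup>2 + (cmod (z * w' + w * cnj z'))\<^sup>2
      = ((cmod z)\<^sup>2 + (cmod w)\<^sup>2) * ((cmod z')\<^sup>2 + (cmod w')\<^sup>2)"
    unfolding cmod_power2 by (simp add: algebra_simps power2_eq_square)
  then show ?thesis by (simp add: p q norm_prod_def real_sqrt_mult)
qed

lemma norm_qcnj: "norm (qcnj p) = norm p"
  by (cases p) (simp add: norm_prod_def)

lemma qmult_linear: "linear (qmult p)"
  by (cases p, rule linearI) (auto simp: algebra_simps scaleR_conv_of_real)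

lemma qmult_assoc: "qmult (qmult p q) r = qmult p (qmult q r)"
  by (cases p; cases q; cases r) (simp add: algebra_simps)

lemma qmult_qcnj:
  assumes "norm p = 1"
  shows "qmult p (qmult (qcnj p) q) = q"
proof -
  obtain z w where p: "p = (z, w)" by (cases p)
  have "(cmod z)\<^sup>2 + (cmod w)\<^sup>2 = 1" using assms by (simp add: p norm_prod_def)
  then have "complex_of_real ((cmod z)\<^sup>2 + (cmod w)\<^sup>2) = 1" by (simp only: of_real_1)
  then have "z * cnj z + w * cnj w = 1" unfolding of_real_add complex_norm_square .
  then have "qmult p (qcnj p) = qone" by (simp add: p qone_def)
  then have "qmult p (qmult (qcnj p) q) = qmult qone q" by (simp add: qmult_assoc[symmetric])
  then show ?thesis by (cases q) (simp add: qone_def)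
qed

lemma gmult_Sp1Sp1: "g \<in> Sp1Sp1 \<Longrightarrow> h \<in> Sp1Sp1 \<Longrightarrow> gmult g h \<in> Sp1Sp1"
  by (simp add: Sp1Sp1_def gmult_def norm_qmult)

lemma Sp1Sp1_compact: "compact Sp1Sp1"
proof -
  have *: "Sp1Sp1 = sphere (0::quat) 1 \<times> sphere (0::quat) 1" by (auto simp: Sp1Sp1_def)
  show ?thesis unfolding * by (intro compact_Times compact_sphere)
qed

text \<open>The polar form exp (alpha a) with a unit imaginary axis a; it supplies a one-parameter
  subgroup from 1 to q for \<open>short_curve\<close>.\<close>

lemma unit_quaternion_polar:
  assumes "norm q = 1"
  obtains a where "Re (fst a) = 0" "norm a = 1" "qmult a a = - qone"
    "q = cos (arccos (Re (fst q))) *\<^sub>R qone + sin (arccos (Re (fst q))) *\<^sub>R a"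
proof -
  obtain z w where q: "q = (z, w)" by (cases q)
  have n: "(Re z)\<^sup>2 + (Im z)\<^sup>2 + (Re w)\<^sup>2 + (Im w)\<^sup>2 = 1"
    using assms by (simp add: q norm_prod_def cmod_power2)
  then have "(Re z)\<^sup>2 \<le> 1" using zero_le_power2[of "Im z"] zero_le_power2[of "Re w"] zero_le_power2[of "Im w"] by linarith
  then have r: "- 1 \<le> Re z" "Re z \<le> 1" by (auto simp: abs_square_le_1 abs_le_iff)
  define s where "s = sin (arccos (Re z))"
  have s: "s\<^sup>2 = 1 - (Re z)\<^sup>2" using r by (simp add: s_def sin_arccos) (use \<open>(Re z)\<^sup>2 \<le> 1\<close> in simp)
  have sq: "qmult a a = - qone" if "Re (fst a) = 0" "norm a = 1" for a
  proof -
    obtain x y where a: "a = (x, y)" by (cases a)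
    have n: "(Im x)\<^sup>2 + (Re y)\<^sup>2 + (Im y)\<^sup>2 = 1" using that by (simp add: a norm_prod_def cmod_power2)
    show ?thesis using n that(1) by (simp add: a qone_def complex_eq_iff power2_eq_square)
  qed
  have c: "cos (arccos (Re (fst q))) = Re z" using r by (simp add: q)
  show ?thesis
  proof (cases "s = 0")
    \<comment> \<open>At q = 1 and q = - 1 the axis is arbitrary, and \<open>qi\<close>
      serves.\<close>
    case True
    then have sq0: "(Im z)\<^sup>2 + ((Re w)\<^sup>2 + (Im w)\<^sup>2) = 0" using n s by simp
    then have "Im z = 0" "Re w = 0" "Im w = 0"
      using sum_power2_eq_zero_iff[of "Re w" "Im w"] zero_le_power2[of "Im z"]
      by (smt (verit) zero_le_power2 zero_eq_power2)+
    then show ?thesis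
      by (intro that[of qi] sq) (use True c in \<open>auto simp: q qi_def qone_def s_def complex_eq_iff norm_prod_def\<close>)
  next
    case False
    let ?a = "(1 / s) *\<^sub>R (\<i> * of_real (Im z), w)"
    have "(norm ?a)\<^sup>2 = (1 / s)\<^sup>2 * ((Im z)\<^sup>2 + ((Re w)\<^sup>2 + (Im w)\<^sup>2))"
      by (simp add: norm_prod_def norm_mult power_mult_distrib cmod_power2 power_divide add_divide_distrib)
    also have "(Im z)\<^sup>2 + ((Re w)\<^sup>2 + (Im w)\<^sup>2) = s\<^sup>2" using n s by linarith
    also have "(1 / s)\<^sup>2 * s\<^sup>2 = 1" using False by (simp add: power_divide)
    finally have "sqrt ((norm ?a)\<^sup>2) = sqrt 1" by (simp only:)
    then have na: "norm ?a = 1" by (simp only: real_sqrt_abs abs_norm_cancel real_sqrt_one)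
    show ?thesis
      by (rule that[of ?a])
        (use na sq[of ?a] c False in \<open>auto simp: q qone_def s_def[symmetric] complex_eq_iff\<close>)
  qed
qed

lemma rotation_has_derivative:
  assumes "qmult a a = - qone"
  shows "((\<lambda>s. qmult p (cos (s * \<alpha>) *\<^sub>R qone + sin (s * \<alpha>) *\<^sub>R a)) has_vector_derivative
    qmult (qmult p (cos (s * \<alpha>) *\<^sub>R qone + sin (s * \<alpha>) *\<^sub>R a)) (\<alpha> *\<^sub>R a)) (at s within S)"
proof -
  have lin: "bounded_linear (qmult p)"
    using qmult_linear by (simp add: linear_conv_bounded_linear)
  have dc: "((\<lambda>s. cos (s * \<alpha>)) has_real_derivative - sin (s * \<alpha>) * \<alpha>) (at s within S)"
    and ds: "((\<lambda>s. sin (s * \<alpha>)) has_real_derivative cos (s * \<alpha>) * \<alpha>) (at s within S)"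
    by (auto intro!: derivative_eq_intros)
  have "((\<lambda>s. cos (s * \<alpha>) *\<^sub>R qone + sin (s * \<alpha>) *\<^sub>R a) has_vector_derivative
      (- sin (s * \<alpha>) * \<alpha>) *\<^sub>R qone + (cos (s * \<alpha>) * \<alpha>) *\<^sub>R a) (at s within S)"
    using has_vector_derivative_add[OF has_vector_derivative_scaleR[OF dc has_vector_derivative_const[of qone]]
        has_vector_derivative_scaleR[OF ds has_vector_derivative_const[of a]]] by simp
  from bounded_linear.has_vector_derivative[OF lin this]
  have d: "((\<lambda>s. qmult p (cos (s * \<alpha>) *\<^sub>R qone + sin (s * \<alpha>) *\<^sub>R a)) has_vector_derivative
      qmult p ((- sin (s * \<alpha>) * \<alpha>) *\<^sub>R qone + (cos (s * \<alpha>) * \<alpha>) *\<^sub>R a)) (at s within S)" .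
  have "qmult (c *\<^sub>R qone + s' *\<^sub>R a) (\<alpha> *\<^sub>R a) = (- s' * \<alpha>) *\<^sub>R qone + (c * \<alpha>) *\<^sub>R a" for c s'
  proof -
    have "qmult (c *\<^sub>R qone + s' *\<^sub>R a) (\<alpha> *\<^sub>R a) = (c * \<alpha>) *\<^sub>R a + (s' * \<alpha>) *\<^sub>R qmult a a"
      by (cases a) (simp add: qone_def scaleR_conv_of_real algebra_simps)
    then show ?thesis by (simp add: assms)
  qed
  with d show ?thesis unfolding qmult_assoc by simp
qed

lemma frame_coords:
  "Re (fst (fst v)) = 0 \<Longrightarrow> Re (fst (snd v)) = 0 \<Longrightarrow> frame (coords v) = v"
  by (cases v) (auto simp: frame_def coords_def qi_def qj_def qk_def complex_eq_iff prod_eq_iff)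

lemma coords_linear: "linear coords"
  by (rule linearI) (auto simp: coords_def vec_eq_iff forall_3 algebra_simps)

lemma joined_trans: "joined L h B C s \<Longrightarrow> joined L h A B r \<Longrightarrow> joined L h A C (r + s)"
proof (induction rule: joined.induct)
  case (refl A)
  then show ?case by simp
next
  case (step A B r' b x y l C)
  then show ?case using joined.step[of L h _ B "r + r'" b x y l C] by (simp add: add.assoc)
qed

lemma slice_rep_circ: "(circ_at b \<theta>, \<lambda>z. cis (4 * \<theta>) * z) \<in> slice_rep b"
proof -
  have "circ_at b \<theta> = gmult (circ_at b \<theta>) (qone, qone)"
    by (simp add: circ_at_def circ_def gmult_def qone_def)
  moreover have "(qone, qone) \<in> DeltaQ8" unfolding DeltaQ8_def by blast
  moreover have "(\<lambda>z. cis (4 * \<theta>) * z) = (\<lambda>z. cis (4 * \<theta>) *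
      (if (qone, qone) \<in> {(u, u) | u. u \<in> {qone, - qone, qi, - qi}} then z else cnj z))"
  proof -
    have "(qone, qone) \<in> {(u, u) | u. u \<in> {qone, - qone, qi, - qi}}" by blast
    then show ?thesis by (simp only: if_True)
  qed
  ultimately show ?thesis unfolding slice_rep_def by blast
qed

text \<open>The tubes of radius 2 T overlap: when |z| > T, the slice action rotates z to the
  positive axis, and the gluing then leads to a point of the other tube with |z| < T. So M_23 is
  covered by two compact half-tubes.\<close>

lemma M23_representative:
  assumes A: "A \<in> M23 (2 * T)" and T: "0 < T"
  obtains b g z where "(b, (g, z)) \<in> A" "g \<in> Sp1Sp1" "cmod z \<le> T"
proof -
  obtain b g z where A': "A = {(X, Y). same_point (2 * T) X Y} `` {(b, (g, z))}" and t: "(g, z) \<in> tube (2 * T)"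
    using A unfolding M23_def quotient_def by auto
  have g: "g \<in> Sp1Sp1" and z: "cmod z < 2 * T" using t by (auto simp: tube_def)
  have mem: "P \<in> A" if "same_point (2 * T) (b, (g, z)) P" for P using that by (simp add: A')
  show ?thesis
  proof (cases "cmod z \<le> T")
    case True
    then show ?thesis using that[of b g z] mem same_point.refl[OF t] g by blast
  next
    case False
    define \<theta> k where "\<theta> = Arg z / 4" and "k = circ_at b \<theta>"
    have z': "cis (4 * \<theta>) * of_real (cmod z) = z"
      using False T cis_Arg[of z] by (cases "z = 0") (auto simp: \<theta>_def sgn_div_norm scaleR_conv_of_real)
    have "same_point (2 * T) (b, (gmult g k, of_real (cmod z))) (b, (g, cis (4 * \<theta>) * of_real (cmod z)))"
      by (rule same_point.slice[OF g _ slice_rep_circ[of b \<theta>, folded k_def]]) (use z in simp)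
    then have 1: "same_point (2 * T) (b, (g, z)) (b, (gmult g k, of_real (cmod z)))"
      unfolding z' by (rule same_point.sym)
    have k: "gmult g k \<in> Sp1Sp1"
      by (rule gmult_Sp1Sp1[OF g]) (simp add: k_def circ_at_def circ_def Sp1Sp1_def norm_prod_def)
    have 2: "\<exists>b'. same_point (2 * T) (b, (gmult g k, of_real (cmod z))) (b', (gmult g k, of_real (2 * T - cmod z)))"
    proof (cases b)
      case Start
      then show ?thesis using same_point.glue[OF k, of "cmod z" "2 * T"] False T z by fastforce
    next
      case End
      have "same_point (2 * T) (Start, (gmult g k, of_real (2 * T - cmod z)))
          (End, (gmult g k, of_real (2 * T - (2 * T - cmod z))))"
        by (rule same_point.glue[OF k]) (use False T z in auto)
      then show ?thesis using End same_point.sym by fastforce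
    qed
    then obtain b' where "(b', (gmult g k, of_real (2 * T - cmod z))) \<in> A"
      using mem same_point.trans[OF 1] by blast
    moreover have "cmod (of_real (2 * T - cmod z)) \<le> T"
      unfolding norm_of_real using False z by auto
    ultimately show ?thesis using that k by blast
  qed
qed

lemma M23_class: "x \<in> tube L \<Longrightarrow> \<exists>B\<in>M23 L. (b, x) \<in> B"
proof
  assume x: "x \<in> tube L"
  show "{(X, Y). same_point L X Y} `` {(b, x)} \<in> M23 L"
    unfolding M23_def by (rule quotientI) (use x in simp)
  show "(b, x) \<in> {(X, Y). same_point L X Y} `` {(b, x)}"
    using same_point.refl[OF x] by simp
qed

text \<open>The geodesic distance on the 3-sphere: the argument of \<open>arccos\<close> is the
  inner product of p and q.\<close>

definition angle :: "quat \<Rightarrow> quat \<Rightarrow> real" where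
  "angle p q = arccos (Re (fst (qmult (qcnj p) q)))"

section \<open>Lengths of curves in the half-tubes and convergence of Cauchy sequences\<close>

context scale
begin

definition metric :: "orbit_end \<Rightarrow> pt \<Rightarrow> tvec \<Rightarrow> tvec \<Rightarrow> real" where
  "metric b x X X' = pack (covec b (snd x) X) \<bullet> pack (covec b (snd x) X')"

text \<open>Since \<open>covec\<close> does not depend on the group element, compactness of the disc
  |z| <= T bounds it on each basis vector, and linearity gives a uniform constant.\<close>

lemma covec_bounded: "\<exists>K\<ge>0. \<forall>z\<in>cball 0 T. \<forall>X. norm (pack (covec b z X)) \<le> K * norm X"
proof -
  have "\<exists>K\<ge>0. \<forall>z\<in>cball 0 T. norm (pack (covec b z X)) \<le> K" for X
  proof -
    have "continuous_on (cball 0 T) (\<lambda>z. pack (covec b z X) $ i)" for i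
    proof (rule continuous_on_compose2[OF smooth_fun_imp_continuous_on[OF covec_smooth[of b X i]],
          of "cball 0 T" "\<lambda>z. (((0, 0), (0, 0)), z)", unfolded snd_conv])
      show "(\<lambda>z. (((0, 0), (0, 0)), z)) ` cball 0 T \<subseteq> {x::pt. (cmod (snd x))\<^sup>2 \<in> J}"
        using square_mem_J T_pos by auto
    qed (intro continuous_intros)
    then have "continuous_on (cball 0 T) (\<lambda>z. pack (covec b z X))"
      using continuous_on_vec_lambda[of "cball 0 T" "\<lambda>i z. pack (covec b z X) $ i"] by simp
    then have "bounded ((\<lambda>z. pack (covec b z X)) ` cball 0 T)"
      by (intro compact_imp_bounded compact_continuous_image compact_cball)
    then obtain K where "0 < K" "\<forall>x\<in>(\<lambda>z. pack (covec b z X)) ` cball 0 T. norm x \<le> K"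
      unfolding bounded_pos by blast
    then show ?thesis by (intro exI[of _ K]) auto
  qed
  then obtain K where K: "\<And>X. 0 \<le> K X" "\<And>X z. z \<in> cball 0 T \<Longrightarrow> norm (pack (covec b z X)) \<le> K X"
    by metis
  show ?thesis
  proof (intro exI[of _ "\<Sum>e\<in>Basis. K e"] conjI ballI allI)
    show "0 \<le> (\<Sum>e\<in>(Basis::tvec set). K e)" by (intro sum_nonneg K)
    fix z X assume z: "z \<in> cball (0::complex) T"
    have lin: "linear (\<lambda>X. pack (covec b z X))"
      using linear_compose[OF covec_linear pack_linear] by (simp add: o_def)
    have "pack (covec b z X) = pack (covec b z (\<Sum>e\<in>Basis. (X \<bullet> e) *\<^sub>R e))" by (simp add: euclidean_representation)
    also have "\<dots> = (\<Sum>e\<in>Basis. (X \<bullet> e) *\<^sub>R pack (covec b z e))"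
      by (simp add: linear_sum[OF lin] linear_scale[OF lin])
    also have "norm \<dots> \<le> (\<Sum>e\<in>Basis. norm X * K e)"
    proof (rule sum_norm_le)
      fix e :: tvec assume "e \<in> Basis"
      then show "norm ((X \<bullet> e) *\<^sub>R pack (covec b z e)) \<le> norm X * K e"
        using K(2)[OF z, of e] Basis_le_norm[of e X] by (simp add: mult_mono)
    qed
    finally show "norm (pack (covec b z X)) \<le> (\<Sum>e\<in>Basis. K e) * norm X"
      unfolding sum_distrib_right by (simp only: mult.commute)
  qed
qed

text \<open>Turning each quaternion about a fixed axis while z moves on a straight line gives a
  curve whose velocity X is constant in the left trivialisation; \<open>covec_bounded\<close> then
  bounds its length by a multiple of the norm of X.\<close>

lemma short_curve:
  "\<exists>K\<ge>0. \<forall>g\<in>Sp1Sp1. \<forall>g'\<in>Sp1Sp1. \<forall>z\<in>cball 0 T. \<forall>z'\<in>cball 0 T.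
     \<exists>l. C1_curve (2 * T) (metric b) (g, z) (g', z') l \<and>
       l \<le> K * (angle (fst g) (fst g') + angle (snd g) (snd g') + cmod (z' - z))"
proof -
  obtain K where K: "0 \<le> K" "\<And>z X. z \<in> cball 0 T \<Longrightarrow> norm (pack (covec b z X)) \<le> K * norm X"
    using covec_bounded by metis
  obtain M where M: "0 < M" "\<And>v. norm (coords v) \<le> norm v * M"
    using bounded_linear.pos_bounded[of coords] coords_linear by (auto simp: linear_conv_bounded_linear)
  show ?thesis
  proof (rule exI[of _ "K * (M + 1)"], intro conjI ballI)
    show "0 \<le> K * (M + 1)" using K M by simp
    fix g g' and z z' :: complex assume g: "g \<in> Sp1Sp1" and g': "g' \<in> Sp1Sp1" and z: "z \<in> cball 0 T" and z': "z' \<in> cball 0 T"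
    have n: "norm (fst g) = 1" "norm (snd g) = 1" "norm (fst g') = 1" "norm (snd g') = 1"
      using g g' by (auto simp: Sp1Sp1_def)
    define \<alpha> \<beta> where "\<alpha> = angle (fst g) (fst g')" and "\<beta> = angle (snd g) (snd g')"
    obtain a where a: "Re (fst a) = 0" "norm a = 1" "qmult a a = - qone"
      "qmult (qcnj (fst g)) (fst g') = cos \<alpha> *\<^sub>R qone + sin \<alpha> *\<^sub>R a"
      using unit_quaternion_polar[of "qmult (qcnj (fst g)) (fst g')"] n
      unfolding \<alpha>_def angle_def by (auto simp: norm_qmult norm_qcnj)
    obtain a' where a': "Re (fst a') = 0" "norm a' = 1" "qmult a' a' = - qone"
      "qmult (qcnj (snd g)) (snd g') = cos \<beta> *\<^sub>R qone + sin \<beta> *\<^sub>R a'"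
      using unit_quaternion_polar[of "qmult (qcnj (snd g)) (snd g')"] n
      unfolding \<beta>_def angle_def by (auto simp: norm_qmult norm_qcnj)
    have range: "0 \<le> \<alpha>" "0 \<le> \<beta>"
    proof -
      have "\<bar>Re (fst q)\<bar> \<le> 1" if "norm q = 1" for q :: quat
        using that norm_fst_le[of "fst q" "snd q"] abs_Re_le_cmod[of "fst q"] by simp
      then have "\<bar>Re (fst (qmult (qcnj p) q))\<bar> \<le> 1" if "norm p = 1" "norm q = 1" for p q
        using that by (simp add: norm_qmult norm_qcnj)
      from this[OF n(1,3)] this[OF n(2,4)] show "0 \<le> \<alpha>" "0 \<le> \<beta>"
        unfolding \<alpha>_def \<beta>_def angle_def by (auto intro!: arccos_lbound simp: abs_le_iff)
    qed
    let ?q = "\<lambda>\<alpha> a s. cos (s * \<alpha>) *\<^sub>R qone + sin (s * \<alpha>) *\<^sub>R a"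
    define \<xi> where "\<xi> = coords (\<alpha> *\<^sub>R a, \<beta> *\<^sub>R a')"
    define c where "c = (\<lambda>s. ((qmult (fst g) (?q \<alpha> a s), qmult (snd g) (?q \<beta> a' s)), z + s *\<^sub>R (z' - z)))"
    define X where "X = (\<xi>, z' - z)"
    have fr: "frame \<xi> = (\<alpha> *\<^sub>R a, \<beta> *\<^sub>R a')"
      unfolding \<xi>_def by (rule frame_coords) (use a a' in auto)
    have nq: "norm (?q \<alpha> a s) = 1" if "Re (fst a) = 0" "norm a = 1" for \<alpha> s and a :: quat
    proof -
      obtain x y where xy: "a = (x, y)" by (cases a)
      have "(Im x)\<^sup>2 + ((Re y)\<^sup>2 + (Im y)\<^sup>2) = 1" using that by (simp add: xy norm_prod_def cmod_power2)
      then have "(cos (s * \<alpha>))\<^sup>2 + ((sin (s * \<alpha>))\<^sup>2 * ((Im x)\<^sup>2 + ((Re y)\<^sup>2 + (Im y)\<^sup>2))) = 1" by simp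
      then have "(norm (?q \<alpha> a s))\<^sup>2 = 1"
        using that(1) by (simp add: xy qone_def norm_prod_def cmod_power2 power_mult_distrib algebra_simps)
      then show ?thesis by (simp add: power2_eq_1_iff) (use norm_ge_zero[of "?q \<alpha> a s"] in linarith)
    qed
    have zs: "z + s *\<^sub>R (z' - z) \<in> cball 0 T" if "s \<in> {0..1}" for s
    proof -
      have "(1 - s) *\<^sub>R z + s *\<^sub>R z' \<in> cball 0 T"
        using that z z' by (intro convexD[OF convex_cball]) auto
      then show ?thesis by (simp add: algebra_simps)
    qed
    have C: "C1_curve (2 * T) (metric b) (g, z) (g', z') (integral {0..1} (\<lambda>s. sqrt (metric b (c s) X X)))"
      unfolding C1_curve_def
    proof (intro exI[of _ c] exI[of _ "\<lambda>_. X"] conjI ballI)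
      show "c 0 = (g, z)"
        by (cases g; cases "fst g"; cases "snd g") (auto simp: c_def qone_def)
      show "c 1 = (g', z')"
        unfolding c_def using qmult_qcnj[OF n(1), of "fst g'"] qmult_qcnj[OF n(2), of "snd g'"] a(4) a'(4)
        by (simp add: prod_eq_iff)
      fix s :: real assume s: "s \<in> {0..1}"
      have "norm (z + s *\<^sub>R (z' - z)) < 2 * T" using zs[OF s] T_pos by auto
      then show "c s \<in> tube (2 * T)"
        using nq[OF a(1,2)] nq[OF a'(1,2)] n by (simp add: c_def tube_def Sp1Sp1_def norm_qmult)
      have dz: "((\<lambda>s. z + s *\<^sub>R (z' - z)) has_vector_derivative z' - z) (at s within {0..1})"
        by (auto intro!: derivative_eq_intros)
      show "(c has_vector_derivative tangent_vector (c s) X) (at s within {0..1})"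
        unfolding c_def tangent_vector_def X_def fst_conv snd_conv fr gmult_def
        by (intro has_vector_derivative_Pair rotation_has_derivative a(3) a'(3) dz)
    qed auto
    have nX: "norm X \<le> (M + 1) * (\<alpha> + \<beta> + cmod (z' - z))"
    proof -
      have "norm (\<alpha> *\<^sub>R a, \<beta> *\<^sub>R a') \<le> \<alpha> + \<beta>"
        using norm_Pair_le[of "\<alpha> *\<^sub>R a" "\<beta> *\<^sub>R a'"] a(2) a'(2) range by simp
      then have "norm \<xi> \<le> (\<alpha> + \<beta>) * M"
        unfolding \<xi>_def using M(2)[of "(\<alpha> *\<^sub>R a, \<beta> *\<^sub>R a')"] M(1)
        by (meson mult_right_mono less_imp_le order_trans)
      moreover have "norm X \<le> norm \<xi> + cmod (z' - z)" unfolding X_def by (rule norm_Pair_le)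
      moreover have "0 \<le> M * cmod (z' - z)" using M(1) by simp
      ultimately show ?thesis using range by (simp add: algebra_simps)
    qed
    have le: "sqrt (metric b (c s) X X) \<le> K * norm X" if "s \<in> {0..1}" for s
    proof -
      have "sqrt (metric b (c s) X X) = norm (pack (covec b (z + s *\<^sub>R (z' - z)) X))"
        by (simp add: metric_def c_def norm_eq_sqrt_inner)
      then show ?thesis using K(2)[OF zs[OF that]] by simp
    qed
    have "integral {0..1} (\<lambda>s. sqrt (metric b (c s) X X)) \<le> K * norm X"
    \<comment> \<open>A non-integrable function has integral 0 by convention, and the bound holds in
      that case too.\<close>
    proof (cases "(\<lambda>s. sqrt (metric b (c s) X X)) integrable_on {0..1}")
      case True
      then have "integral {0..1} (\<lambda>s. sqrt (metric b (c s) X X)) \<le> integral {0..1} (\<lambda>s::real. K * norm X)"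
        by (intro integral_le) (use le in auto)
      then show ?thesis by simp
    next
      case False
      then show ?thesis using K(1) by (simp add: not_integrable_integral)
    qed
    also have "\<dots> \<le> K * ((M + 1) * (\<alpha> + \<beta> + cmod (z' - z)))"
      by (rule mult_left_mono[OF nX K(1)])
    finally show "\<exists>l. C1_curve (2 * T) (metric b) (g, z) (g', z') l \<and>
       l \<le> K * (M + 1) * (angle (fst g) (fst g') + angle (snd g) (snd g') + cmod (z' - z))"
      using C by (auto simp: \<alpha>_def \<beta>_def mult.assoc)
  qed
qed

lemma angle_tendsto:
  assumes "p \<longlonglongrightarrow> q" "\<And>n. norm (p n) = 1" "norm q = 1"
  shows "(\<lambda>n. angle (p n) q) \<longlonglongrightarrow> 0"
proof -
  have e: "Re (fst (qmult (qcnj u) v)) = u \<bullet> v" for u v :: quat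
    by (cases u; cases v) (simp add: inner_complex_def algebra_simps)
  have "(\<lambda>n. p n \<bullet> q) \<longlonglongrightarrow> q \<bullet> q" by (intro tendsto_intros assms)
  then have l: "(\<lambda>n. p n \<bullet> q) \<longlonglongrightarrow> 1" using assms(3) by (simp add: dot_square_norm)
  have r: "\<bar>p n \<bullet> q\<bar> \<le> 1" for n
    using Cauchy_Schwarz_ineq2[of "p n" q] assms by simp
  have "(\<lambda>n. arccos (p n \<bullet> q)) \<longlonglongrightarrow> arccos 1"
    by (rule continuous_on_tendsto_compose[OF continuous_on_arccos' l])
      (use r in \<open>auto simp: abs_le_iff intro!: always_eventually\<close>)
  then show ?thesis by (simp add: angle_def e)
qed

lemma phi_complete: "complete_structure (2 * T) phi"
  unfolding complete_structure_def
proof (intro exI[of _ metric] conjI allI ballI impI)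
  fix b x assume "x \<in> tube (2 * T)"
  then have "adapted (phi b x) (\<lambda>X. pack (covec b (snd x) X))"
    by (intro phi_adapted tube_J) auto
  then show "is_metric (phi b x) (metric b x)" unfolding is_metric_def metric_def by blast
next
  fix A assume "(\<forall>n. A n \<in> M23 (2 * T)) \<and>
    (\<forall>\<epsilon>>0. \<exists>N::nat. \<forall>m\<ge>N. \<forall>n\<ge>N. dist_less (2 * T) metric (A m) (A n) \<epsilon>)"
  then have A: "\<And>n. A n \<in> M23 (2 * T)"
    and cauchy: "\<And>\<epsilon>. 0 < \<epsilon> \<Longrightarrow> \<exists>N. \<forall>m\<ge>N. \<forall>n\<ge>N. dist_less (2 * T) metric (A m) (A n) \<epsilon>" by auto
  have "\<exists>b g z. (b, (g, z)) \<in> A n \<and> g \<in> Sp1Sp1 \<and> cmod z \<le> T" for n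
    using M23_representative[OF A T_pos] by metis
  then obtain b g z where rep: "\<And>n. (b n, (g n, z n)) \<in> A n" "\<And>n. g n \<in> Sp1Sp1" "\<And>n. cmod (z n) \<le> T"
    by metis
  \<comment> \<open>Infinitely many representatives lie in the same tube, where they can be joined
    by the curves of \<open>short_curve\<close>.\<close>
  obtain b0 and r :: "nat \<Rightarrow> nat" where r: "strict_mono r" "\<And>n. b (r n) = b0"
  proof -
    have "infinite {n. b n = Start} \<or> infinite {n. b n = End}"
    proof (rule ccontr)
      assume "\<not> ?thesis"
      then have "finite ({n. b n = Start} \<union> {n. b n = End})" by simp
      moreover have "{n. b n = Start} \<union> {n. b n = End} = UNIV" using orbit_end.exhaust by blast
      ultimately show False by simp
    qed
    then obtain b0 where "infinite {n. b n = b0}" by blast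
    then obtain r :: "nat \<Rightarrow> nat" where "strict_mono r" "\<And>n. r n \<in> {n. b n = b0}"
      using infinite_enumerate by blast
    then show ?thesis using that[of r b0] by simp
  qed
  have "compact (Sp1Sp1 \<times> cball (0::complex) T)" by (intro compact_Times Sp1Sp1_compact compact_cball)
  moreover have "\<forall>n. (g (r n), z (r n)) \<in> Sp1Sp1 \<times> cball 0 T" using rep by simp
  ultimately obtain x r' where x: "x \<in> Sp1Sp1 \<times> cball (0::complex) T" and r': "strict_mono r'"
    and lim: "((\<lambda>n. (g (r n), z (r n))) \<circ> r') \<longlonglongrightarrow> x"
    by (rule seq_compactE[OF compact_imp_seq_compact])
  obtain g0 z0 where x0: "x = (g0, z0)" by (cases x)
  define u where "u = r \<circ> r'"
  have u: "strict_mono u" unfolding u_def by (rule strict_mono_o[OF r(1) r'])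
  have g0: "g0 \<in> Sp1Sp1" and z0: "z0 \<in> cball 0 T" using x by (auto simp: x0)
  have lg: "(\<lambda>n. g (u n)) \<longlonglongrightarrow> g0" and lz: "(\<lambda>n. z (u n)) \<longlonglongrightarrow> z0"
    using tendsto_fst[OF lim] tendsto_snd[OF lim] by (simp_all add: o_def u_def x0)
  obtain B where B: "B \<in> M23 (2 * T)" "(b0, (g0, z0)) \<in> B"
    using M23_class[of "(g0, z0)" "2 * T" b0] g0 z0 T_pos by (auto simp: tube_def)
  obtain K where K: "0 \<le> K" "\<And>g g' z z'. g \<in> Sp1Sp1 \<Longrightarrow> g' \<in> Sp1Sp1 \<Longrightarrow> z \<in> cball 0 T \<Longrightarrow> z' \<in> cball 0 T \<Longrightarrow>
      \<exists>l. C1_curve (2 * T) (metric b0) (g, z) (g', z') l \<and>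
        l \<le> K * (angle (fst g) (fst g') + angle (snd g) (snd g') + cmod (z' - z))"
    using short_curve[of b0] by blast
  define \<delta> where "\<delta> n = K * (angle (fst (g (u n))) (fst g0) + angle (snd (g (u n))) (snd g0) + cmod (z0 - z (u n)))" for n
  have \<delta>: "\<delta> \<longlonglongrightarrow> 0"
  proof -
    have "(\<lambda>n. angle (fst (g (u n))) (fst g0)) \<longlonglongrightarrow> 0" "(\<lambda>n. angle (snd (g (u n))) (snd g0)) \<longlonglongrightarrow> 0"
      using rep(2) g0 by (auto intro!: angle_tendsto tendsto_fst[OF lg] tendsto_snd[OF lg] simp: Sp1Sp1_def)
    moreover have "(\<lambda>n. cmod (z0 - z (u n))) \<longlonglongrightarrow> cmod (z0 - z0)" by (intro tendsto_intros lz)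
    ultimately have "\<delta> \<longlonglongrightarrow> K * (0 + 0 + cmod (z0 - z0))"
      unfolding \<delta>_def by (intro tendsto_mult[OF tendsto_const] tendsto_add)
    then show ?thesis by simp
  qed
  have near: "\<exists>l\<le>\<delta> n. joined (2 * T) metric (A (u n)) B l" for n
  proof -
    have "z (u n) \<in> cball 0 T" using rep(3) by simp
    from K(2)[OF rep(2)[of "u n"] g0 this z0] obtain l where
      l: "C1_curve (2 * T) (metric b0) (g (u n), z (u n)) (g0, z0) l" "l \<le> \<delta> n"
      unfolding \<delta>_def by blast
    have "(b0, (g (u n), z (u n))) \<in> A (u n)" using rep(1)[of "u n"] r(2) by (simp add: u_def)
    from joined.step[where h = metric, OF joined.refl[OF A[of "u n"]] this l(1) B(2,1)] l(2) show ?thesis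
      by auto
  qed
  show "\<exists>B\<in>M23 (2 * T). \<forall>\<epsilon>>0. \<exists>N. \<forall>n\<ge>N. dist_less (2 * T) metric (A n) B \<epsilon>"
  proof (intro bexI[OF _ B(1)] allI impI)
    fix \<epsilon> :: real assume \<epsilon>: "0 < \<epsilon>"
    then obtain N where N: "\<And>m n. N \<le> m \<Longrightarrow> N \<le> n \<Longrightarrow> dist_less (2 * T) metric (A m) (A n) (\<epsilon> / 2)"
      using cauchy[of "\<epsilon> / 2"] by auto
    have "eventually (\<lambda>n. \<delta> n < \<epsilon> / 2) sequentially" using order_tendstoD(2)[OF \<delta>, of "\<epsilon> / 2"] \<epsilon> by simp
    then obtain m where "\<And>n. m \<le> n \<Longrightarrow> \<delta> n < \<epsilon> / 2" unfolding eventually_sequentially by blast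
    \<comment> \<open>A strictly increasing \<open>u\<close> satisfies k <= u k, so this index is
      late enough both for the Cauchy estimate and for the convergence of the subsequence.\<close>
    then have k: "\<delta> (max m N) < \<epsilon> / 2" "N \<le> u (max m N)"
      using strict_mono_imp_increasing[OF u, of "max m N"] by auto
    show "\<exists>N. \<forall>n\<ge>N. dist_less (2 * T) metric (A n) B \<epsilon>"
    proof (intro exI[of _ N] allI impI)
      fix n assume "N \<le> n"
      from N[OF this k(2)] obtain l where l: "l < \<epsilon> / 2" "joined (2 * T) metric (A n) (A (u (max m N))) l"
        unfolding dist_less_def by blast
      obtain l' where l': "l' \<le> \<delta> (max m N)" "joined (2 * T) metric (A (u (max m N))) B l'"
        using near by blast
      have "joined (2 * T) metric (A n) B (l + l')" by (rule joined_trans[OF l'(2) l(2)])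
      moreover have "l + l' < \<epsilon>" using l(1) l'(1) k(1) by linarith
      ultimately show "dist_less (2 * T) metric (A n) B \<epsilon>" unfolding dist_less_def by blast
    qed
  qed
qed

end

theorem proposition5p6:
  fixes lam :: real
  assumes "lam = 6 / sqrt 5"
  shows "\<exists>(a::real) (c::real) (\<nu>::real) (T::real) \<phi>.
           \<bar>a - 0.025880416406250467\<bar> \<le> 1 / 10 ^ 7 \<and>
           \<bar>c - (- 0.07764124921873236)\<bar> \<le> 3 / 10 ^ 7 \<and>
           \<nu> = 0 \<and>
           \<bar>T - 0.8578017401911906\<bar> \<le> 5 / 10 ^ 7 \<and>
           G2_structure_M23 (2 * T) \<phi> \<and>
           nearly_parallel lam (2 * T) \<phi> \<and>
           complete_structure (2 * T) \<phi> \<and>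
           SO4_invariant (2 * T) \<phi> \<and>
           U1_invariant (2 * T) \<phi> \<and>
           obtained_by_reflection lam a c \<nu> T \<phi>"
proof -
  interpret scale lam by unfold_locales (simp add: assms)
  define a where "a = 1 / (2 * lam ^ 3)"
  \<comment> \<open>From lambda^3 = 216 / (5 sqrt 5).\<close>
  have a: "a = 5 * sqrt 5 / 432"
    by (simp add: a_def assms power_divide power3_eq_cube field_simps)
  have "\<bar>a - 0.025880416406250467\<bar> \<le> 1 / 10 ^ 7" "\<bar>- 3 * a - (- 0.07764124921873236)\<bar> \<le> 3 / 10 ^ 7"
    unfolding a abs_le_iff using sqrt_5_bounds by (simp_all add: field_simps)
  then have "\<bar>a - 0.025880416406250467\<bar> \<le> 1 / 10 ^ 7 \<and> \<bar>- 3 * a - (- 0.07764124921873236)\<bar> \<le> 3 / 10 ^ 7 \<and>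
      (0::real) = 0 \<and> \<bar>T - 0.8578017401911906\<bar> \<le> 5 / 10 ^ 7 \<and> G2_structure_M23 (2 * T) phi \<and>
      nearly_parallel lam (2 * T) phi \<and> complete_structure (2 * T) phi \<and> SO4_invariant (2 * T) phi \<and>
      U1_invariant (2 * T) phi \<and> obtained_by_reflection lam a (- 3 * a) 0 T phi"
    by (intro conjI HOL.refl T_bounds[OF assms] phi_G2 phi_nearly_parallel[OF order_refl] phi_complete
        phi_SO4_invariant(1) phi_U1_invariant phi_obtained_by_reflection[folded a_def])
  then show ?thesis by blast
qed

end
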